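(* For $i\in\{1,2\}$ and $(\xi,\eta;\lambda,\nu)\in(\mathbb Z/2\mathbb Z)^5\times\mathbb C^5$ one has $$\mathrm{Diff}_{G_i'}(I(\xi,\lambda),J(\eta,\nu))=\begin{cases}\mathbb C\,\mathbb D_i(\lambda,\nu)&\text{if }(\xi,\eta;\lambda,\nu)\in\mathrm{Supp}_i(\mathbb D),\\ \{0\}&\text{otherwise,}\end{cases}$$ where the operators have the following two (equal) expressions, in symmetrized and in ordered form: $$\mathbb D_1(\lambda,\nu)=\mathrm{Rest}_1\circ\big(T^{\mathrm{sym}}_{(\nu_1-\lambda_1,\ \nu_1+\nu_2-\lambda_1-\lambda_2)}\,p^{(\nu_1-\lambda_1,\ \nu_1+\nu_2-\lambda_1-\lambda_2)}_{\lambda_1+\nu_1-\lambda_2-\nu_2-2,\ \nu_1+\nu_2-\lambda_1-\lambda_2}\big)(D_1,D_2,D_3)$$ $$=\mathrm{Rest}_1\circ T^{\mathrm{ord}}_{(\nu_1-\lambda_1,\ \nu_1+\nu_2-\lambda_1-\lambda_2)}\,{}_2F_0[\lambda_1-\nu_1,\ \lambda_1-\nu_2-1;D_1,D_2,D_3],$$ $$\mathbb D_2(\lambda,\nu)=\mathrm{Rest}_2\circ\big(T^{\mathrm{sym}}_{(\lambda_2+\lambda_3-\nu_1-\nu_2,\ \lambda_3-\nu_2)}\,p^{(\lambda_3-\nu_2,\ \lambda_2+\lambda_3-\nu_1-\nu_2)}_{\lambda_3+\nu_2-\lambda_2-\nu_1+2,\ \lambda_2+\lambda_3-\nu_1-\nu_2}\big)(D_1,D_2,D_3)$$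 $$=\mathrm{Rest}_2\circ T^{\mathrm{ord}}_{(\lambda_2+\lambda_3-\nu_1-\nu_2,\ \lambda_3-\nu_2)}\,{}_2F_0[\nu_2-\lambda_3,\ \nu_2-\lambda_2+1;D_1,D_2,D_3].$$
   Context: $\mathbb N=\{0,1,2,\dots\}$, $\mathbb N_+=\{1,2,\dots\}$; $[a,b]=\emptyset$ if $b<a$. $G=GL(3,\mathbb R)$, $G'=GL(2,\mathbb R)$; $P=MAN_+\subset G$ is the group of invertible upper triangular matrices, $M=\{\mathrm{diag}(\pm1,\pm1,\pm1)\}$, $A$ = positive diagonal matrices, $N_+$ = upper unipotent. For $\xi\in(\mathbb Z/2\mathbb Z)^3,\lambda\in\mathbb C^3$, $I(\xi,\lambda)=\mathrm{Ind}_P^G(\mathbb C_\xi\boxtimes\mathbb C_\lambda)$ is the unnormalized principal series: smooth $f$ on $G$ with $f(gman)=\prod_j m_j^{-\xi_j}\prod_j a_j^{-\lambda_j}f(g)$, with left translation. $J(\eta,\nu)$ ($\eta\in(\mathbb Z/2\mathbb Z)^2,\nu\in\mathbb C^2$) is the analogous principal series of $G'$ induced from its upper triangular subgroup $P'$. Let $\iota_1(g')=\begin{pmatrix}g'&0\\0&1\end{pmatrix}$, $\iota_2(g')=\begin{pmatrix}1&0\\0&g'\end{pmatrix}$, $G_i'=\iota_i(G')$; regard $J(\eta,\nu)$ as a representation of $G_i'$. $\mathrm{Diff}_{G_i'}(I(\xi,\lambda),J(\eta,\nu))$ is the space of $G_i'$-intertwining differential operators $I(\xi,\lambda)\to J(\eta,\nu)$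 with respect to the natural map $G_i'/\iota_i(P')\to G/P$. With $N_1^-=E_{21},N_2^-=E_{32},N_3^-=E_{31}$, use coordinates $(x_1,x_2,x_3)\mapsto\exp(x_1N_1^-+x_2N_2^-+x_3N_3^-)$ on the lower unipotent group $N_-$ and $x_i\mapsto\exp(x_iN_i^-)$ on $N_-\cap G_i'$; restricting to these cells, such operators are viewed as operators $C^\infty(\mathbb R^3)\to C^\infty(\mathbb R)$. $\mathrm{Rest}_1$ is restriction to $x_2=x_3=0$, $\mathrm{Rest}_2$ is restriction to $x_1=x_3=0$. $\Phi_{1,a}=\{(\lambda,\nu)\in\mathbb C^5:\nu_1-\lambda_1,\ \nu_2-\lambda_2\in\mathbb N\}$; $\Phi_{1,b}=\{(\lambda,\nu)\in\mathbb C^5:\nu_1-\lambda_1,\,-(\nu_2-\lambda_2)\in\mathbb N_+,\ \nu_1-\lambda_1+\nu_2-\lambda_2\in\mathbb N,\ \nu_1-\lambda_2\in[1,\nu_1-\lambda_1+\nu_2-\lambda_2+1]\cap\mathbb Z\}$; $\Phi_{2,a}=\{(\lambda,\nu)\in\mathbb C^5:\lambda_3-\nu_2,\ \lambda_2-\nu_1\in\mathbb N\}$; $\Phi_{2,b}=\{(\lambda,\nu)\in\mathbb C^5:\lambda_3-\nu_2,\,-(\lambda_2-\nu_1)\in\mathbb N_+,\ \lambda_3-\nu_2+\lambda_2-\nu_1\in\mathbb N,\ \lambda_2-\nu_2\in[1,\lambda_3-\nu_2+\lambda_2-\nu_1+1]\cap\mathbb Z\}$; $\Phi_i=\Phi_{i,a}\cup\Phi_{i,b}$.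 $\mathrm{Supp}_1(\mathbb D)=\{(\xi,\eta;\lambda,\nu):(\lambda,\nu)\in\Phi_1,\ \xi_1+\eta_1\equiv\nu_1-\lambda_1,\ \xi_2+\eta_2\equiv\nu_2-\lambda_2\bmod2\}$; $\mathrm{Supp}_2(\mathbb D)=\{(\xi,\eta;\lambda,\nu):(\lambda,\nu)\in\Phi_2,\ \xi_2+\eta_1\equiv\lambda_2-\nu_1,\ \xi_3+\eta_2\equiv\lambda_3-\nu_2\bmod2\}$. Operators: $D_1=\frac{\partial}{\partial x_1}+\frac{x_2}2\frac{\partial}{\partial x_3}$, $D_2=\frac{\partial}{\partial x_2}-\frac{x_1}2\frac{\partial}{\partial x_3}$, $D_3=\frac{\partial}{\partial x_3}$. For $\alpha=(\alpha_1,\alpha_2)\in\mathbb N^2$ and a polynomial $q(t)=\sum_{n=0}^{\min(\alpha_1,\alpha_2)}c_nt^n$, $(T^{\mathrm{sym}}_\alpha q)(D_1,D_2,D_3)=\sum_nc_n\,\mathrm{sym}_{\alpha_1+\alpha_2-n}(D_1^{\alpha_1-n}D_2^{\alpha_2-n}D_3^n)$ and $(T^{\mathrm{ord}}_\alpha q)(D_1,D_2,D_3)=\sum_nc_n\,D_1^{\alpha_1-n}D_2^{\alpha_2-n}D_3^n$, where $\mathrm{sym}_k(Y_1\cdots Y_k)=\frac1{k!}\sum_{\tau\in\mathfrak S_k}Y_{\tau(1)}\cdots Y_{\tau(k)}$. $T^{\mathrm{ord}}_\alpha\,{}_2F_0[\cdots;D_1,D_2,D_3]$ means $T^{\mathrm{ord}}_\alpha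 q$ with $q(t)={}_2F_0[\cdots;t]$. $(x)_n=x(x+1)\cdots(x+n-1)$; ${}_2F_0[a,b;t]=\sum_k\frac{(a)_k(b)_k}{k!}t^k$. Cayley continuants: $\mathrm{Cay}_n(x,y)$ are the polynomials with $(1+t)^{\frac{y+x}2}(1-t)^{\frac{y-x}2}=\sum_{n\ge0}\mathrm{Cay}_n(x,y)\frac{t^n}{n!}$. For $\beta_1,\beta_2\in\mathbb N$ and $a\in\mathbb C$, $p^{(\beta_1,\beta_2)}_{a,\beta_2}(t)=\sum_{n=0}^{\min(\beta_1,\beta_2)}\frac{(-\beta_1)_n}{2^nn!}\mathrm{Cay}_n(a,\beta_2)\,t^n$. *)

theory Defs
  imports
    "HOL-Analysis.Analysis"
    "HOL-Library.Z2"
    "HOL-Computational_Algebra.Formal_Power_Series"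
    "HOL-Combinatorics.Permutations"
begin

definition dderiv ::
  "'a::real_normed_vector \<Rightarrow> ('a \<Rightarrow> 'b::real_normed_vector) \<Rightarrow> 'a \<Rightarrow> 'b" where
  "dderiv v f = (\<lambda>x. frechet_derivative f (at x) v)"

text \<open>On an open subset of a finite-dimensional space this is the class $C^\infty$: all iterated
  directional derivatives, along arbitrary lists of directions (including the empty list), are
  Frechet differentiable.\<close>

definition smooth_on ::
  "'a::real_normed_vector set \<Rightarrow> ('a \<Rightarrow> 'b::real_normed_vector) \<Rightarrow> bool" where
  "smooth_on S f \<longleftrightarrow> (\<forall>vs. \<forall>x\<in>S. foldr dderiv vs f differentiable (at x))"

definition partial :: "'n \<Rightarrow> (real^'n::finite \<Rightarrow> complex) \<Rightarrow> real^'n \<Rightarrow> complex" where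
  "partial j = dderiv (axis j 1)"

definition GL :: "(real^'n::finite^'n) set" where
  "GL = {g. invertible g}"

definition diag_mat :: "real^'n::finite \<Rightarrow> real^'n^'n" where
  "diag_mat v = (\<chi> r c. if r = c then v $ r else 0)"

definition sign_pow :: "bit \<Rightarrow> real \<Rightarrow> complex" where
  "sign_pow e m = (if e = 0 then 1 else complex_of_real m)"

text \<open>The upper unipotent subgroups are spelled out entrywise: in the index type \<open>3\<close> the index
  \<open>3\<close> equals \<open>0\<close>, so the order of that type is not the order of rows and columns.\<close>

definition unip3 :: "(real^3^3) set" where
  "unip3 = {u. u$1$1 = 1 \<and> u$2$2 = 1 \<and> u$3$3 = 1 \<and> u$2$1 = 0 \<and> u$3$1 = 0 \<and> u$3$2 = 0}"

definition unip2 :: "(real^2^2) set" where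
  "unip2 = {u. u$1$1 = 1 \<and> u$2$2 = 1 \<and> u$2$1 = 0}"

text \<open>Functions on the general linear group are total functions on matrices that vanish on the
  singular ones. Since \<open>m $ j\<close> is a sign and exponents live modulo 2,
  \<open>sign_pow (\<xi> $ j) (m $ j)\<close> is $m_j^{-\xi_j}$.\<close>

definition principal_series ::
  "(real^'n::finite^'n) set \<Rightarrow> bit^'n \<Rightarrow> complex^'n \<Rightarrow> (real^'n^'n \<Rightarrow> complex) set" where
  "principal_series N \<xi> lam = {f.
     smooth_on GL f \<and> (\<forall>g. g \<notin> GL \<longrightarrow> f g = 0) \<and>
     (\<forall>g\<in>GL. \<forall>m a. \<forall>n\<in>N. (\<forall>j. m $ j \<in> {1, -1}) \<longrightarrow> (\<forall>j. a $ j > 0) \<longrightarrow>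
        f (g ** diag_mat m ** diag_mat a ** n)
          = (\<Prod>j\<in>UNIV. sign_pow (\<xi> $ j) (m $ j))
            * (\<Prod>j\<in>UNIV. complex_of_real (a $ j) powr (- (lam $ j))) * f g)}"

definition I_series :: "bit^3 \<Rightarrow> complex^3 \<Rightarrow> (real^3^3 \<Rightarrow> complex) set" where
  "I_series = principal_series unip3"

definition J_series :: "bit^2 \<Rightarrow> complex^2 \<Rightarrow> (real^2^2 \<Rightarrow> complex) set" where
  "J_series = principal_series unip2"

definition left_translate ::
  "real^'n::finite^'n \<Rightarrow> (real^'n^'n \<Rightarrow> complex) \<Rightarrow> real^'n^'n \<Rightarrow> complex" where
  "left_translate h f = (\<lambda>g. f (matrix_inv h ** g))"

definition iota :: "nat \<Rightarrow> real^2^2 \<Rightarrow> real^3^3" where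
  "iota i g =
     (if i = 1
      then vector [vector [g$1$1, g$1$2, 0], vector [g$2$1, g$2$2, 0], vector [0, 0, 1]]
      else vector [vector [1, 0, 0], vector [0, g$1$1, g$1$2], vector [0, g$2$1, g$2$2]])"

definition elem_mat :: "'n::finite \<Rightarrow> 'n \<Rightarrow> real^'n^'n" where
  "elem_mat i j = (\<chi> r c. if r = i \<and> c = j then 1 else 0)"

definition mat_exp :: "real^'n::finite^'n \<Rightarrow> real^'n^'n" where
  "mat_exp X = (\<Sum>k. (1 / fact k) *\<^sub>R (((**) X ^^ k) (mat 1)))"

definition cell3 :: "real^3 \<Rightarrow> real^3^3" where
  "cell3 x = mat_exp (x$1 *\<^sub>R elem_mat 2 1 + x$2 *\<^sub>R elem_mat 3 2 + x$3 *\<^sub>R elem_mat 3 1)"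

text \<open>\<open>iota i (cell2 t)\<close> is $\exp(t N_i^-)$ with $N_1^- = E_{21}$ and $N_2^- = E_{32}$,
  that is, \<open>cell3 (axis_pt i t)\<close>.\<close>

definition cell2 :: "real \<Rightarrow> real^2^2" where
  "cell2 t = mat_exp (t *\<^sub>R elem_mat 2 1)"

definition axis_pt :: "nat \<Rightarrow> real \<Rightarrow> real^3" where
  "axis_pt i t = (if i = 1 then axis 1 t else axis 2 t)"

definition Rest :: "nat \<Rightarrow> (real^3 \<Rightarrow> complex) \<Rightarrow> real \<Rightarrow> complex" where
  "Rest i F = (\<lambda>t. F (axis_pt i t))"

text \<open>An operator \<open>T\<close> from sections over $G/P$ to sections over $G'/P'$ is a differential operator
  with respect to the map induced by \<open>iota i\<close> if near every point of $G'/P'$ it is, in local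
  coordinates and trivializations, a finite sum of smooth coefficients times partial derivatives
  evaluated along the map. Near the base point of \<open>h\<close> we use the charts \<open>t \<mapsto> h ** cell2 t\<close> of
  $G'/P'$ and \<open>x \<mapsto> iota i h ** cell3 x\<close> of $G/P$ together with the trivializations of the line
  bundles that they define; in these charts the map is \<open>axis_pt i\<close>. The list \<open>js\<close> stands for the
  partial derivative $\partial_{j_1}\cdots\partial_{j_k}$.\<close>

definition differential_operator ::
  "nat \<Rightarrow> (real^3^3 \<Rightarrow> complex) set \<Rightarrow> ((real^3^3 \<Rightarrow> complex) \<Rightarrow> real^2^2 \<Rightarrow> complex) \<Rightarrow> bool" where
  "differential_operator i V T \<longleftrightarrow>
     (\<forall>h\<in>GL. \<exists>U js_set a. open U \<and> 0 \<in> U \<and> finite js_set \<and> (\<forall>js\<in>js_set. smooth_on U (a js)) \<and>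
        (\<forall>f\<in>V. \<forall>t\<in>U. T f (h ** cell2 t) =
           (\<Sum>js\<in>js_set. a js t * foldr partial js (\<lambda>x. f (iota i h ** cell3 x)) (axis_pt i t))))"

text \<open>Operators are extended by zero outside \<open>I_series \<xi> lam\<close>, so that each operator is represented
  by exactly one function.\<close>

definition Diff ::
  "nat \<Rightarrow> bit^3 \<Rightarrow> complex^3 \<Rightarrow> bit^2 \<Rightarrow> complex^2
     \<Rightarrow> ((real^3^3 \<Rightarrow> complex) \<Rightarrow> real^2^2 \<Rightarrow> complex) set" where
  "Diff i \<xi> lam \<eta> \<nu> = {T.
     (\<forall>f\<in>I_series \<xi> lam. T f \<in> J_series \<eta> \<nu>) \<and>
     (\<forall>f. f \<notin> I_series \<xi> lam \<longrightarrow> T f = (\<lambda>g. 0)) \<and>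
     (\<forall>f1\<in>I_series \<xi> lam. \<forall>f2\<in>I_series \<xi> lam. \<forall>c1 c2.
        T (\<lambda>g. c1 * f1 g + c2 * f2 g) = (\<lambda>g. c1 * T f1 g + c2 * T f2 g)) \<and>
     (\<forall>h\<in>GL. \<forall>f\<in>I_series \<xi> lam.
        T (left_translate (iota i h) f) = left_translate h (T f)) \<and>
     differential_operator i (I_series \<xi> lam) T}"

definition Nats_pos :: "complex set" where
  "Nats_pos = \<nat> - {0}"

definition Phi_a :: "nat \<Rightarrow> ((complex^3) \<times> (complex^2)) set" where
  "Phi_a i = {(lam, \<nu>).
     if i = 1 then \<nu>$1 - lam$1 \<in> \<nat> \<and> \<nu>$2 - lam$2 \<in> \<nat>
     else lam$3 - \<nu>$2 \<in> \<nat> \<and> lam$2 - \<nu>$1 \<in> \<nat>}"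

definition Phi_b :: "nat \<Rightarrow> ((complex^3) \<times> (complex^2)) set" where
  "Phi_b i = {(lam, \<nu>).
     if i = 1
     then \<nu>$1 - lam$1 \<in> Nats_pos \<and> - (\<nu>$2 - lam$2) \<in> Nats_pos \<and>
       (\<exists>N::nat. \<nu>$1 - lam$1 + \<nu>$2 - lam$2 = of_nat N \<and>
          \<nu>$1 - lam$2 \<in> of_int ` {1..int N + 1})
     else lam$3 - \<nu>$2 \<in> Nats_pos \<and> - (lam$2 - \<nu>$1) \<in> Nats_pos \<and>
       (\<exists>N::nat. lam$3 - \<nu>$2 + lam$2 - \<nu>$1 = of_nat N \<and>
          lam$2 - \<nu>$2 \<in> of_int ` {1..int N + 1})}"

definition Phi :: "nat \<Rightarrow> ((complex^3) \<times> (complex^2)) set" where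
  "Phi i = Phi_a i \<union> Phi_b i"

definition cong_mod2 :: "bit \<Rightarrow> complex \<Rightarrow> bool" where
  "cong_mod2 e z \<longleftrightarrow> (\<exists>k::int. z = of_int k \<and> e = of_int k)"

definition Supp :: "nat \<Rightarrow> ((bit^3) \<times> (bit^2) \<times> (complex^3) \<times> (complex^2)) set" where
  "Supp i = {(\<xi>, \<eta>, lam, \<nu>). (lam, \<nu>) \<in> Phi i \<and>
     (if i = 1
      then cong_mod2 (\<xi>$1 + \<eta>$1) (\<nu>$1 - lam$1) \<and> cong_mod2 (\<xi>$2 + \<eta>$2) (\<nu>$2 - lam$2)
      else cong_mod2 (\<xi>$2 + \<eta>$1) (lam$2 - \<nu>$1) \<and> cong_mod2 (\<xi>$3 + \<eta>$2) (lam$3 - \<nu>$2))}"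

type_synonym operator = "(real^3 \<Rightarrow> complex) \<Rightarrow> real^3 \<Rightarrow> complex"

definition D1 :: operator where
  "D1 F = (\<lambda>x. partial 1 F x + complex_of_real (x$2 / 2) * partial 3 F x)"

definition D2 :: operator where
  "D2 F = (\<lambda>x. partial 2 F x - complex_of_real (x$1 / 2) * partial 3 F x)"

definition D3 :: operator where
  "D3 = partial 3"

definition sym_op :: "operator list \<Rightarrow> operator" where
  "sym_op Ys F = (\<lambda>x. (1 / fact (length Ys)) *
     (\<Sum>\<tau> | \<tau> permutes {..<length Ys}. foldr (\<circ>) (permute_list \<tau> Ys) id F x))"

text \<open>The polynomial \<open>q\<close> is given by its coefficient sequence as a power series; it is meant to have
  degree at most \<open>min \<alpha>1 \<alpha>2\<close>. This holds for all series used below when the parameters lie in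
  \<open>Phi i\<close>, where the hypergeometric series terminates by that degree.\<close>

definition T_sym :: "nat \<times> nat \<Rightarrow> complex fps \<Rightarrow> operator" where
  "T_sym \<alpha> q F = (\<lambda>x. \<Sum>n\<le>min (fst \<alpha>) (snd \<alpha>). fps_nth q n *
     sym_op (replicate (fst \<alpha> - n) D1 @ replicate (snd \<alpha> - n) D2 @ replicate n D3) F x)"

definition T_ord :: "nat \<times> nat \<Rightarrow> complex fps \<Rightarrow> operator" where
  "T_ord \<alpha> q F = (\<lambda>x. \<Sum>n\<le>min (fst \<alpha>) (snd \<alpha>). fps_nth q n *
     ((D1 ^^ (fst \<alpha> - n)) \<circ> (D2 ^^ (snd \<alpha> - n)) \<circ> (D3 ^^ n)) F x)"

definition hyp2F0 :: "complex \<Rightarrow> complex \<Rightarrow> complex fps" where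
  "hyp2F0 a b = Abs_fps (\<lambda>k. pochhammer a k * pochhammer b k / fact k)"

text \<open>\<open>fps_binomial c\<close> is the binomial series $(1+t)^c$.\<close>

definition Cay :: "nat \<Rightarrow> complex \<Rightarrow> complex \<Rightarrow> complex" where
  "Cay n x y = fact n * fps_nth
     (fps_binomial ((y + x) / 2) * fps_compose (fps_binomial ((y - x) / 2)) (- fps_X)) n"

definition p_poly :: "nat \<Rightarrow> nat \<Rightarrow> complex \<Rightarrow> complex fps" where
  "p_poly \<beta>1 \<beta>2 a = Abs_fps (\<lambda>n. if n \<le> min \<beta>1 \<beta>2
     then pochhammer (- of_nat \<beta>1) n / (2 ^ n * fact n) * Cay n a (of_nat \<beta>2) else 0)"

definition nat_of :: "complex \<Rightarrow> nat" where
  "nat_of z = (THE n. z = of_nat n)"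

definition DD_sym ::
  "nat \<Rightarrow> complex^3 \<Rightarrow> complex^2 \<Rightarrow> (real^3 \<Rightarrow> complex) \<Rightarrow> real \<Rightarrow> complex" where
  "DD_sym i lam \<nu> =
     (if i = 1
      then let \<alpha>1 = nat_of (\<nu>$1 - lam$1); \<alpha>2 = nat_of (\<nu>$1 + \<nu>$2 - lam$1 - lam$2)
        in Rest 1 \<circ> T_sym (\<alpha>1, \<alpha>2) (p_poly \<alpha>1 \<alpha>2 (lam$1 + \<nu>$1 - lam$2 - \<nu>$2 - 2))
      else let \<alpha>1 = nat_of (lam$2 + lam$3 - \<nu>$1 - \<nu>$2); \<alpha>2 = nat_of (lam$3 - \<nu>$2)
        in Rest 2 \<circ> T_sym (\<alpha>1, \<alpha>2) (p_poly \<alpha>2 \<alpha>1 (lam$3 + \<nu>$2 - lam$2 - \<nu>$1 + 2)))"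

definition DD_ord ::
  "nat \<Rightarrow> complex^3 \<Rightarrow> complex^2 \<Rightarrow> (real^3 \<Rightarrow> complex) \<Rightarrow> real \<Rightarrow> complex" where
  "DD_ord i lam \<nu> =
     (if i = 1
      then let \<alpha>1 = nat_of (\<nu>$1 - lam$1); \<alpha>2 = nat_of (\<nu>$1 + \<nu>$2 - lam$1 - lam$2)
        in Rest 1 \<circ> T_ord (\<alpha>1, \<alpha>2) (hyp2F0 (lam$1 - \<nu>$1) (lam$1 - \<nu>$2 - 1))
      else let \<alpha>1 = nat_of (lam$2 + lam$3 - \<nu>$1 - \<nu>$2); \<alpha>2 = nat_of (lam$3 - \<nu>$2)
        in Rest 2 \<circ> T_ord (\<alpha>1, \<alpha>2) (hyp2F0 (\<nu>$2 - lam$3) (\<nu>$2 - lam$2 + 1)))"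

definition given_on_cells_by ::
  "(real^3^3 \<Rightarrow> complex) set \<Rightarrow> ((real^3^3 \<Rightarrow> complex) \<Rightarrow> real^2^2 \<Rightarrow> complex)
     \<Rightarrow> ((real^3 \<Rightarrow> complex) \<Rightarrow> real \<Rightarrow> complex) \<Rightarrow> bool" where
  "given_on_cells_by V T D \<longleftrightarrow> (\<forall>f\<in>V. T f \<circ> cell2 = D (f \<circ> cell3))"

end

(*
  A differential operator intertwining the two principal series is determined by its value at the
  identity, a distribution supported at the identity coset of G/P.  Products of quotients of minors
  by sums of squares of minors give sections with enough jets there, so such distributions are
  freely spanned by ordered monomials N1^p N2^q N3^r of left-invariant derivatives.  The diagonal
  subgroup of P' singles out the monomials with p + r and q + r prescribed by (lambda, nu), which
  gives the integrality and parity conditions.  For those, invariance under the unipotent part of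
  P' is annihilation by one raising element, and commuting it past the monomials yields the
  first-order recurrence of the coefficients of 2F0; the recurrence must also stop at the last
  monomial, which is the condition Phi.  The symmetrized form follows from Weyl ordering in the
  Heisenberg algebra and a substitution in the generating function of the Cayley continuants.
*)

theory Submission
  imports Defs
begin

section \<open>Calculus of smooth functions\<close>

text \<open>Everything is done on the group instead of in charts. \<open>right_deriv X\<close>
  differentiates along g exp(sX) and so commutes with left translation: a constant-coefficient
  combination of words in such operators, evaluated at \<open>iota i h\<close>, intertwines
  automatically, and only its behaviour under right multiplication by P' remains to be checked. On
  the open cell E_21, E_32, E_31 act as \<open>D1\<close>, \<open>D2\<close>, \<open>D3\<close>. The
  raising element is E_12 for i = 1 and E_23 for i = 2. The recurrence is (A + n)(B + n) c_n = (n +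
  1) c_(n+1) with A = \<open>par_A\<close>, B = \<open>par_B\<close>. At the last index m = min(a,
  b) its right side is 0, so a nonzero solution exists exactly if (A)_(m+1) (B)_(m+1) = 0. Vanishing
  of the first factor gives \<open>Phi_a\<close>, of the second alone \<open>Phi_b\<close>. Two
  obstacles shape the text: derivatives of nondifferentiable functions are arbitrary values, so
  operator identities hold only on a function space; and independence of the monomials needs global
  sections, so local coordinates of the flag manifold are replaced by global functions with the same
  first jet.\<close>

primrec differentiable_upto ::
  "nat \<Rightarrow> 'a::real_normed_vector set \<Rightarrow> ('a \<Rightarrow> 'b::real_normed_vector) \<Rightarrow> bool" where
  "differentiable_upto 0 S f \<longleftrightarrow> (\<forall>x\<in>S. f differentiable (at x))"
| "differentiable_upto (Suc n) S f \<longleftrightarrow>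
     (\<forall>x\<in>S. f differentiable (at x)) \<and> (\<forall>v. differentiable_upto n S (dderiv v f))"

lemma differentiable_upto_differentiable:
  "differentiable_upto n S f \<Longrightarrow> x \<in> S \<Longrightarrow> f differentiable (at x)"
  by (cases n) auto

text \<open>Ties the order-by-order recursion, which inductions over products and composites can
  use, to the quantification over lists in \<open>smooth_on\<close>. The recursion strips the
  innermost derivative, which is the last entry of the list; hence \<open>rev_cases\<close>.\<close>

lemma differentiable_upto_iff:
  "differentiable_upto n S f \<longleftrightarrow>
     (\<forall>vs. length vs \<le> n \<longrightarrow> (\<forall>x\<in>S. foldr dderiv vs f differentiable (at x)))"
proof (induction n arbitrary: f)
  case (Suc n)
  show ?case
  proof
    assume L: "differentiable_upto (Suc n) S f"
    show "\<forall>vs. length vs \<le> Suc n \<longrightarrow> (\<forall>x\<in>S. foldr dderiv vs f differentiable (at x))"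
    proof (intro allI impI)
      fix vs :: "'a list" assume "length vs \<le> Suc n"
      with L Suc.IH show "\<forall>x\<in>S. foldr dderiv vs f differentiable (at x)"
        by (cases vs rule: rev_cases) auto
    qed
  next
    assume R: "\<forall>vs. length vs \<le> Suc n \<longrightarrow> (\<forall>x\<in>S. foldr dderiv vs f differentiable (at x))"
    have "foldr dderiv vs (dderiv v f) differentiable (at x)" if "length vs \<le> n" "x \<in> S" for vs v x
      using R[rule_format, of "vs @ [v]"] that by simp
    moreover have "\<forall>x\<in>S. f differentiable (at x)"
      using R[rule_format, of "[]"] by simp
    ultimately show "differentiable_upto (Suc n) S f"
      using Suc.IH by simp
  qed
qed simp

lemma smooth_on_iff_upto: "smooth_on S f \<longleftrightarrow> (\<forall>n. differentiable_upto n S f)"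
  unfolding smooth_on_def differentiable_upto_iff by blast

lemma smooth_on_differentiable: "smooth_on S f \<Longrightarrow> x \<in> S \<Longrightarrow> f differentiable (at x)"
  using smooth_on_iff_upto differentiable_upto_differentiable by blast

lemma smooth_on_dderiv: "smooth_on S f \<Longrightarrow> smooth_on S (dderiv v f)"
  unfolding smooth_on_iff_upto by (metis differentiable_upto.simps(2))

lemma differentiable_cong_open:
  assumes "open S" "x \<in> S" "\<And>y. y \<in> S \<Longrightarrow> f y = g y" "f differentiable (at x)"
  shows "g differentiable (at x)"
  using assms by (meson differentiable_def has_derivative_transform_within_open)

lemma dderiv_cong_open:
  assumes "open S" "x \<in> S" "\<And>y. y \<in> S \<Longrightarrow> f y = g y"
  shows "dderiv v f x = dderiv v g x"
proof -
  \<comment> \<open>\<open>frechet_derivative\<close> is a choice among all derivatives, so equal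
    sets of derivatives give equal values even where neither function is differentiable.\<close>
  have "(f has_derivative F) (at x) = (g has_derivative F) (at x)" for F
    using has_derivative_transform_within_open[of f F x UNIV S g]
      has_derivative_transform_within_open[of g F x UNIV S f] assms by auto
  then show ?thesis
    by (simp add: dderiv_def frechet_derivative_def)
qed

lemma dderiv_eq: "(f has_derivative f') (at x) \<Longrightarrow> dderiv v f x = f' v"
  by (metis dderiv_def frechet_derivative_at)

lemma has_derivative_dderiv:
  "f differentiable (at x) \<Longrightarrow> (f has_derivative (\<lambda>v. dderiv v f x)) (at x)"
  unfolding dderiv_def by (simp add: frechet_derivative_works[symmetric])

lemma linear_dderiv: "f differentiable (at x) \<Longrightarrow> linear (\<lambda>v. dderiv v f x)"
  using has_derivative_dderiv has_derivative_linear by blast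

lemma differentiable_upto_cong:
  assumes "open S" "differentiable_upto n S f" "\<And>y. y \<in> S \<Longrightarrow> f y = g y"
  shows "differentiable_upto n S g"
  using assms(2,3)
proof (induction n arbitrary: f g)
  case 0
  then show ?case
    using differentiable_cong_open[OF assms(1), of _ f g] by auto
next
  case (Suc n)
  have "differentiable_upto n S (dderiv v g)" for v
    using Suc.IH[of "dderiv v f" "dderiv v g"] Suc.prems
      dderiv_cong_open[OF assms(1), of _ f g] by auto
  then show ?case
    using Suc.prems differentiable_cong_open[OF assms(1), of _ f g] by auto
qed

lemma smooth_on_cong:
  "open S \<Longrightarrow> smooth_on S f \<Longrightarrow> (\<And>y. y \<in> S \<Longrightarrow> f y = g y) \<Longrightarrow> smooth_on S g"
  unfolding smooth_on_iff_upto using differentiable_upto_cong by blast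

lemma differentiable_upto_const: "differentiable_upto n S (\<lambda>x. c)"
proof (induction n arbitrary: c)
  case (Suc n)
  have "dderiv v (\<lambda>x. c) = (\<lambda>x. 0)" for v :: 'a
    by (simp add: dderiv_def)
  with Suc show ?case by simp
qed simp

lemma smooth_on_const [simp]: "smooth_on S (\<lambda>x. c)"
  unfolding smooth_on_iff_upto by (simp add: differentiable_upto_const)

lemma dderiv_add:
  "f differentiable (at x) \<Longrightarrow> g differentiable (at x) \<Longrightarrow>
    dderiv v (\<lambda>x. f x + g x) x = dderiv v f x + dderiv v g x"
  by (rule dderiv_eq[THEN trans], rule has_derivative_add) (auto intro: has_derivative_dderiv)

lemma dderiv_sum:
  assumes "\<And>i. i \<in> I \<Longrightarrow> f i differentiable (at x)"
  shows "dderiv v (\<lambda>x. \<Sum>i\<in>I. f i x) x = (\<Sum>i\<in>I. dderiv v (f i) x)"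
  by (rule dderiv_eq[THEN trans], rule has_derivative_sum)
     (auto intro: has_derivative_dderiv assms)

lemma dderiv_mult:
  fixes f g :: "'a::real_normed_vector \<Rightarrow> 'b::real_normed_algebra"
  shows "f differentiable (at x) \<Longrightarrow> g differentiable (at x) \<Longrightarrow>
    dderiv v (\<lambda>x. f x * g x) x = f x * dderiv v g x + dderiv v f x * g x"
  by (rule dderiv_eq[THEN trans], rule has_derivative_mult) (auto intro: has_derivative_dderiv)

lemma dderiv_cmult:
  fixes f :: "'a::real_normed_vector \<Rightarrow> 'b::real_normed_algebra"
  shows "f differentiable (at x) \<Longrightarrow> dderiv v (\<lambda>x. c * f x) x = c * dderiv v f x"
  by (subst dderiv_mult) (auto simp: dderiv_def)

lemma differentiable_upto_Suc_imp: "differentiable_upto (Suc n) S f \<Longrightarrow> differentiable_upto n S f"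
  by (simp add: differentiable_upto_iff)

lemma differentiable_upto_add:
  assumes "open S" "differentiable_upto n S f" "differentiable_upto n S g"
  shows "differentiable_upto n S (\<lambda>x. f x + g x)"
  using assms(2,3)
proof (induction n arbitrary: f g)
  case (Suc n)
  have "differentiable_upto n S (dderiv v (\<lambda>x. f x + g x))" for v
    by (rule differentiable_upto_cong[OF assms(1) Suc.IH[of "dderiv v f" "dderiv v g"]])
       (use Suc.prems in \<open>auto simp: dderiv_add\<close>)
  then show ?case
    using Suc.prems by auto
qed auto

lemma differentiable_upto_sum:
  assumes "open S" "\<And>i. i \<in> I \<Longrightarrow> differentiable_upto n S (f i)"
  shows "differentiable_upto n S (\<lambda>x. \<Sum>i\<in>I. f i x)"
  using assms(2)
  by (induction I rule: infinite_finite_induct)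
     (auto intro!: differentiable_upto_add assms(1) simp: differentiable_upto_const)

lemma smooth_on_add:
  "open S \<Longrightarrow> smooth_on S f \<Longrightarrow> smooth_on S g \<Longrightarrow> smooth_on S (\<lambda>x. f x + g x)"
  unfolding smooth_on_iff_upto by (simp add: differentiable_upto_add)

lemma differentiable_upto_mult:
  fixes f g :: "'a::real_normed_vector \<Rightarrow> 'b::real_normed_algebra"
  assumes "open S" "differentiable_upto n S f" "differentiable_upto n S g"
  shows "differentiable_upto n S (\<lambda>x. f x * g x)"
  using assms(2,3)
proof (induction n arbitrary: f g)
  case (Suc n)
  have "differentiable_upto n S (dderiv v (\<lambda>x. f x * g x))" for v
  proof (rule differentiable_upto_cong[OF assms(1)])
    show "differentiable_upto n S (\<lambda>x. f x * dderiv v g x + dderiv v f x * g x)"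
      using Suc.prems Suc.prems[THEN differentiable_upto_Suc_imp]
      by (intro differentiable_upto_add assms(1) Suc.IH) simp_all
    show "\<And>y. y \<in> S \<Longrightarrow> f y * dderiv v g y + dderiv v f y * g y = dderiv v (\<lambda>x. f x * g x) y"
      using Suc.prems by (auto simp: dderiv_mult)
  qed
  then show ?case
    using Suc.prems by auto
qed auto

lemma smooth_on_mult:
  fixes f g :: "'a::real_normed_vector \<Rightarrow> 'b::real_normed_algebra"
  shows "open S \<Longrightarrow> smooth_on S f \<Longrightarrow> smooth_on S g \<Longrightarrow> smooth_on S (\<lambda>x. f x * g x)"
  unfolding smooth_on_iff_upto by (simp add: differentiable_upto_mult)

lemma smooth_on_cmult:
  fixes f :: "'a::real_normed_vector \<Rightarrow> 'b::real_normed_algebra"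
  shows "open S \<Longrightarrow> smooth_on S f \<Longrightarrow> smooth_on S (\<lambda>x. c * f x)"
  by (intro smooth_on_mult) auto

lemma smooth_on_sum:
  assumes "open S" "\<And>i. i \<in> I \<Longrightarrow> smooth_on S (f i)"
  shows "smooth_on S (\<lambda>x. \<Sum>i\<in>I. f i x)"
  using assms(2)
  by (induction I rule: infinite_finite_induct) (auto intro!: smooth_on_add assms(1))

lemma smooth_on_power:
  fixes f :: "'a::real_normed_vector \<Rightarrow> 'b::real_normed_algebra_1"
  assumes "open S" "smooth_on S f"
  shows "smooth_on S (\<lambda>x. f x ^ n)"
  by (induction n) (auto intro!: smooth_on_mult assms)

lemma smooth_on_minus:
  fixes f :: "'a::real_normed_vector \<Rightarrow> 'b::real_normed_algebra_1"
  shows "open S \<Longrightarrow> smooth_on S f \<Longrightarrow> smooth_on S (\<lambda>x. - f x)"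
  using smooth_on_cmult[of S f "-1"] by simp

lemma smooth_on_diff:
  fixes f :: "'a::real_normed_vector \<Rightarrow> 'b::real_normed_algebra_1"
  shows "open S \<Longrightarrow> smooth_on S f \<Longrightarrow> smooth_on S g \<Longrightarrow> smooth_on S (\<lambda>x. f x - g x)"
  using smooth_on_add[of S f "\<lambda>x. - g x"] smooth_on_minus[of S g] by simp

text \<open>The same \<open>f'\<close> at every point makes each directional derivative
  constant.\<close>

lemma smooth_on_affine:
  assumes "\<And>x. (f has_derivative f') (at x)"
  shows "smooth_on S f"
proof -
  have "dderiv v f = (\<lambda>x. f' v)" for v
    using assms dderiv_eq by fastforce
  then have "differentiable_upto n S f" for n
    using assms by (cases n) (auto simp: differentiable_upto_const differentiable_def)
  then show ?thesis
    by (simp add: smooth_on_iff_upto)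
qed

lemma smooth_on_bounded_linear: "bounded_linear f \<Longrightarrow> smooth_on S f"
  by (rule smooth_on_affine) (rule bounded_linear_imp_has_derivative)

lemma dderiv_powr:
  fixes f :: "'a::real_normed_vector \<Rightarrow> complex"
  assumes "f differentiable (at x)" "f x \<notin> \<real>\<^sub>\<le>\<^sub>0"
  shows "((\<lambda>x. f x powr z) has_derivative (\<lambda>v. z * f x powr (z - 1) * dderiv v f x)) (at x)"
proof -
  have "((\<lambda>w. w powr z) has_derivative (*) (z * f x powr (z - 1))) (at (f x))"
    using has_field_derivative_powr[OF assms(2)] by (simp add: has_field_derivative_def)
  from has_derivative_compose[OF has_derivative_dderiv[OF assms(1)] this] show ?thesis
    by simp
qed

text \<open>A derivative of \<open>f powr z\<close> contains \<open>f powr (z - 1)\<close>, so the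
  induction on the order runs over all exponents at once.\<close>

lemma smooth_on_powr:
  fixes f :: "'a::real_normed_vector \<Rightarrow> complex"
  assumes S: "open S" and f: "smooth_on S f" and pos: "\<And>x. x \<in> S \<Longrightarrow> f x \<notin> \<real>\<^sub>\<le>\<^sub>0"
  shows "smooth_on S (\<lambda>x. f x powr z)"
proof -
  have d: "\<forall>x\<in>S. (\<lambda>x. f x powr z) differentiable (at x)" for z
    unfolding differentiable_def using dderiv_powr[OF smooth_on_differentiable[OF f]] pos by blast
  have "differentiable_upto n S (\<lambda>x. f x powr z)" for n
  proof (induction n arbitrary: z)
    case (Suc n)
    have "differentiable_upto n S (dderiv v (\<lambda>x. f x powr z))" for v
    proof (rule differentiable_upto_cong[OF S])
      show "differentiable_upto n S (\<lambda>x. z * f x powr (z - 1) * dderiv v f x)"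
        using smooth_on_dderiv[OF f, of v]
        by (intro differentiable_upto_mult S Suc differentiable_upto_const)
           (auto simp: smooth_on_iff_upto)
      show "\<And>y. y \<in> S \<Longrightarrow> z * f y powr (z - 1) * dderiv v f y = dderiv v (\<lambda>x. f x powr z) y"
        using dderiv_eq[OF dderiv_powr[OF smooth_on_differentiable[OF f]]] pos by simp
    qed
    with d show ?case by simp
  qed (use d in simp)
  then show ?thesis
    by (simp add: smooth_on_iff_upto)
qed

section \<open>Chain rule and symmetry of second derivatives\<close>

lemma dderiv_Basis:
  fixes f :: "'a::euclidean_space \<Rightarrow> 'b::real_normed_vector"
  assumes "f differentiable (at x)"
  shows "dderiv v f x = (\<Sum>b\<in>Basis. (v \<bullet> b) *\<^sub>R dderiv b f x)"
proof -
  interpret linear "\<lambda>v. dderiv v f x" by (rule linear_dderiv[OF assms])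
  show ?thesis
    by (subst euclidean_representation[symmetric, of v]) (simp add: sum scale)
qed

lemma dderiv_compose:
  assumes "(\<phi> has_derivative \<phi>') (at x)" "f differentiable (at (\<phi> x))"
  shows "dderiv v (\<lambda>x. f (\<phi> x)) x = dderiv (\<phi>' v) f (\<phi> x)"
  by (rule dderiv_eq[THEN trans], rule has_derivative_compose[OF assms(1)])
     (auto intro: has_derivative_dderiv assms)

text \<open>By the chain rule a derivative of the composite is a sum of products of a derivative of
  a component of the inner map with a composite of a partial derivative of \<open>f\<close>; the
  induction on the order therefore generalizes over \<open>f\<close>. Components are made complex so
  that they multiply with values of \<open>f\<close>.\<close>

lemma smooth_on_compose:
  fixes f :: "'b::euclidean_space \<Rightarrow> complex" and \<phi> :: "'a::real_normed_vector \<Rightarrow> 'b"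
  assumes S: "open S" and T: "open T" and \<phi>: "\<phi> ` S \<subseteq> T"
    and c: "\<And>b. b \<in> Basis \<Longrightarrow> smooth_on S (\<lambda>x. complex_of_real (\<phi> x \<bullet> b))"
    and f: "smooth_on T f"
  shows "smooth_on S (\<lambda>x. f (\<phi> x))"
proof -
  define \<phi>' where "\<phi>' x v = (\<Sum>b\<in>Basis. Re (dderiv v (\<lambda>x. complex_of_real (\<phi> x \<bullet> b)) x) *\<^sub>R b)" for x v
  have \<phi>': "(\<phi> has_derivative \<phi>' x) (at x)" if "x \<in> S" for x
  proof (subst has_derivative_componentwise_within, intro ballI)
    fix b :: 'b assume b: "b \<in> Basis"
    have "((\<lambda>x. Re (complex_of_real (\<phi> x \<bullet> b))) has_derivative
        (\<lambda>v. Re (dderiv v (\<lambda>x. complex_of_real (\<phi> x \<bullet> b)) x))) (at x)"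
      by (intro bounded_linear.has_derivative[OF bounded_linear_Re] has_derivative_dderiv
          smooth_on_differentiable[OF c[OF b] that])
    then show "((\<lambda>x. \<phi> x \<bullet> b) has_derivative (\<lambda>v. \<phi>' x v \<bullet> b)) (at x)"
      using b by (simp add: \<phi>'_def inner_sum_left inner_Basis if_distrib cong: if_cong)
  qed
  have comp: "dderiv v (\<lambda>x. complex_of_real (\<phi> x \<bullet> b)) x = complex_of_real (\<phi>' x v \<bullet> b)"
    if "x \<in> S" for x v b
    by (intro dderiv_eq bounded_linear.has_derivative[OF bounded_linear_of_real]
        has_derivative_inner_left \<phi>' that)
  have fd: "\<forall>x\<in>S. (\<lambda>x. f (\<phi> x)) differentiable (at x)" if "smooth_on T f" for f :: "'b \<Rightarrow> complex"
  proof
    fix x assume "x \<in> S"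
    with \<phi> have "f differentiable (at (\<phi> x))"
      by (intro smooth_on_differentiable[OF that]) auto
    from has_derivative_compose[OF \<phi>'[OF \<open>x \<in> S\<close>] has_derivative_dderiv[OF this]]
    show "(\<lambda>x. f (\<phi> x)) differentiable (at x)"
      by (meson differentiable_def)
  qed
  have "differentiable_upto n S (\<lambda>x. f (\<phi> x))" for n
    using f
  proof (induction n arbitrary: f)
    case 0
    then show ?case using fd by simp
  next
    case (Suc n)
    have "differentiable_upto n S (dderiv v (\<lambda>x. f (\<phi> x)))" for v
    proof (rule differentiable_upto_cong[OF S])
      have "smooth_on S (\<lambda>x. dderiv v (\<lambda>x. complex_of_real (\<phi> x \<bullet> b)) x)" if "b \<in> Basis" for b
        using smooth_on_dderiv[OF c[OF that]] .
      then have "differentiable_upto n S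
          (\<lambda>x. dderiv v (\<lambda>x. complex_of_real (\<phi> x \<bullet> b)) x * dderiv b f (\<phi> x))" if "b \<in> Basis" for b
        using that by (intro differentiable_upto_mult S Suc.IH smooth_on_dderiv Suc.prems)
                      (auto simp: smooth_on_iff_upto)
      then show "differentiable_upto n S
          (\<lambda>x. \<Sum>b\<in>Basis. dderiv v (\<lambda>x. complex_of_real (\<phi> x \<bullet> b)) x * dderiv b f (\<phi> x))"
        by (rule differentiable_upto_sum[OF S])
      fix y assume y: "y \<in> S"
      with \<phi> have d: "f differentiable (at (\<phi> y))"
        by (intro smooth_on_differentiable[OF Suc.prems]) auto
      show "(\<Sum>b\<in>Basis. dderiv v (\<lambda>x. complex_of_real (\<phi> x \<bullet> b)) y * dderiv b f (\<phi> y)) =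
          dderiv v (\<lambda>x. f (\<phi> x)) y"
        by (subst dderiv_compose[OF \<phi>'[OF y] d], subst dderiv_Basis[OF d])
           (simp add: comp[OF y] scaleR_conv_of_real)
    qed
    then show ?case using fd[OF Suc.prems] by simp
  qed
  then show ?thesis
    by (simp add: smooth_on_iff_upto)
qed

lemma smooth_on_compose_affine:
  fixes f :: "'b::euclidean_space \<Rightarrow> complex" and \<phi> :: "'a::real_normed_vector \<Rightarrow> 'b"
  assumes "open S" "open T" "\<phi> ` S \<subseteq> T" "\<And>x. (\<phi> has_derivative \<phi>') (at x)" "smooth_on T f"
  shows "smooth_on S (\<lambda>x. f (\<phi> x))"
  by (rule smooth_on_compose[OF assms(1-3) _ assms(5)], rule smooth_on_affine,
      rule bounded_linear.has_derivative[OF bounded_linear_of_real], rule has_derivative_inner_left,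
      rule assms)

text \<open>The second difference of \<open>f\<close> along \<open>v\<close> and \<open>w\<close> is symmetric in \<open>v\<close> and \<open>w\<close>, and divided by
  \<open>t\<^sup>2\<close> it tends to \<open>dderiv w (dderiv v f) x\<close>.\<close>

lemma second_difference_tendsto:
  fixes f :: "'a::real_normed_vector \<Rightarrow> 'b::real_normed_vector"
  assumes S: "open S" "x \<in> S" and f: "\<And>y. y \<in> S \<Longrightarrow> f differentiable (at y)"
    and g: "dderiv v f differentiable (at x)"
  shows "((\<lambda>t. (f (x + t *\<^sub>R v + t *\<^sub>R w) - f (x + t *\<^sub>R v) - f (x + t *\<^sub>R w) + f x) /\<^sub>R t\<^sup>2)
      \<longlongrightarrow> dderiv w (dderiv v f) x) (at_right 0)"
proof -
  define L where "L h = dderiv h (dderiv v f) x" for h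
  interpret L: linear L
    unfolding L_def by (rule linear_dderiv[OF g])
  have L: "(dderiv v f has_derivative L) (at x)"
    unfolding L_def by (rule has_derivative_dderiv[OF g])
  obtain r where r: "r > 0" "ball x r \<subseteq> S"
    using S openE by blast
  define M where "M = norm v + norm w + 1"
  have M: "M > 0"
    unfolding M_def by (smt (verit) norm_ge_zero)
  show ?thesis
  proof (rule tendstoI)
    fix e :: real assume e: "e > 0"
    \<comment> \<open>The bound on the derivative below is 2 e' t M, which leaves 2 e' M = e / 2
      after division by \<open>t\<close>.\<close>
    define e' where "e' = e / (4 * M)"
    have e': "e' > 0" using e M by (simp add: e'_def)
    obtain d where d: "d > 0" and dd: "\<And>y. norm (y - x) < d \<Longrightarrow>
        norm (dderiv v f y - dderiv v f x - L (y - x)) \<le> e' * norm (y - x)"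
      using L e' unfolding has_derivative_at_alt by blast
    define \<delta> where "\<delta> = min r d / M"
    have \<delta>: "\<delta> > 0" using r d M by (simp add: \<delta>_def)
    have bound: "norm ((f (x + t *\<^sub>R v + t *\<^sub>R w) - f (x + t *\<^sub>R v) - f (x + t *\<^sub>R w) + f x) /\<^sub>R t\<^sup>2 - L w) < e"
      if t: "0 < t" "t < \<delta>" for t
    proof -
      have tM: "t * M < r" "t * M < d"
        using t M by (auto simp: \<delta>_def field_simps min_def split: if_splits)
      have small: "norm (s *\<^sub>R v + u *\<^sub>R w) \<le> t * M" if "0 \<le> s" "s \<le> t" "0 \<le> u" "u \<le> t" for s u
      proof -
        have "norm (s *\<^sub>R v + u *\<^sub>R w) \<le> s * norm v + u * norm w"
          using norm_triangle_ineq[of "s *\<^sub>R v" "u *\<^sub>R w"] that by simp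
        also have "\<dots> \<le> t * norm v + t * norm w"
          using that by (intro add_mono mult_right_mono) auto
        also have "\<dots> \<le> t * M"
          using t by (simp add: M_def algebra_simps)
        finally show ?thesis .
      qed
      have inS: "x + s *\<^sub>R v + u *\<^sub>R w \<in> S" if "0 \<le> s" "s \<le> t" "0 \<le> u" "u \<le> t" for s u
        using small[OF that] r tM by (auto simp: dist_norm subset_iff norm_minus_commute add.assoc)
      \<comment> \<open>The second difference as an increment in the \<open>v\<close> direction
        alone, minus its expected value. The mean value inequality for this function of
        \<open>s\<close> uses only first derivatives of \<open>f\<close> and the expansion of
        \<open>dderiv v f\<close> at \<open>x\<close>.\<close>
      define \<psi> where "\<psi> s = f (x + s *\<^sub>R v + t *\<^sub>R w) - f (x + s *\<^sub>R v) - (s * t) *\<^sub>R L w" for s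
      define \<psi>' where "\<psi>' s = dderiv v f (x + s *\<^sub>R v + t *\<^sub>R w) - dderiv v f (x + s *\<^sub>R v) - t *\<^sub>R L w" for s
      have der: "(\<psi> has_vector_derivative \<psi>' s) (at s within {0..t})" if s: "s \<in> {0..t}" for s
      proof -
        have 1: "((\<lambda>s. f (x + s *\<^sub>R v + u *\<^sub>R w)) has_vector_derivative
            dderiv v f (x + s *\<^sub>R v + u *\<^sub>R w)) (at s within {0..t})" if "0 \<le> u" "u \<le> t" for u
        proof -
          have fd: "f differentiable (at (x + s *\<^sub>R v + u *\<^sub>R w))"
            using inS[of s u] s that f by auto
          have "((\<lambda>s. x + s *\<^sub>R v + u *\<^sub>R w) has_derivative (\<lambda>h. h *\<^sub>R v)) (at s within {0..t})"
            by (auto intro!: derivative_eq_intros)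
          from has_derivative_compose[OF this has_derivative_dderiv[OF fd]] show ?thesis
            by (simp add: has_vector_derivative_def linear_scale[OF linear_dderiv[OF fd]])
        qed
        show ?thesis
          unfolding \<psi>_def \<psi>'_def
          using 1[of t] 1[of 0] t
          by (auto intro!: derivative_eq_intros simp: has_vector_derivative_def scaleR_diff_right)
      qed
      have bd: "norm (\<psi>' s) \<le> 2 * e' * (t * M)" if s: "s \<in> {0..t}" for s
      proof -
        have a: "norm (dderiv v f (x + s *\<^sub>R v + u *\<^sub>R w) - dderiv v f x - L (s *\<^sub>R v + u *\<^sub>R w)) \<le> e' * (t * M)"
          if "0 \<le> u" "u \<le> t" for u
        proof -
          have "norm (s *\<^sub>R v + u *\<^sub>R w) \<le> t * M"
            using small s that by auto
          with dd[of "x + s *\<^sub>R v + u *\<^sub>R w"] tM e' show ?thesis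
            by (smt (verit) add.assoc add_diff_cancel_left' mult_left_mono)
        qed
        have "\<psi>' s = (dderiv v f (x + s *\<^sub>R v + t *\<^sub>R w) - dderiv v f x - L (s *\<^sub>R v + t *\<^sub>R w))
            - (dderiv v f (x + s *\<^sub>R v + 0 *\<^sub>R w) - dderiv v f x - L (s *\<^sub>R v + 0 *\<^sub>R w))"
          by (simp add: \<psi>'_def L.add L.scale)
        then have "norm (\<psi>' s) \<le> e' * (t * M) + e' * (t * M)"
          using a[of t] a[of 0] t by (smt (verit) norm_triangle_ineq4)
        then show ?thesis by (simp add: mult_ac)
      qed
      have "norm (\<psi> t - \<psi> 0) \<le> 2 * e' * (t * M) * norm (t - 0)"
      proof (rule differentiable_bound[where S = "{0..t}" and f' = "\<lambda>s h. h *\<^sub>R \<psi>' s"])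
        show "onorm (\<lambda>h. h *\<^sub>R \<psi>' s) \<le> 2 * e' * (t * M)" if "s \<in> {0..t}" for s
          using bd[OF that] by (simp add: onorm_scaleR_left onorm_id)
      qed (use der t in \<open>auto simp: has_vector_derivative_def\<close>)
      then have "norm (\<psi> t - \<psi> 0) \<le> 2 * e' * M * t\<^sup>2"
        using t by (simp add: power2_eq_square mult_ac)
      moreover have "\<psi> t - \<psi> 0 = t\<^sup>2 *\<^sub>R
          ((f (x + t *\<^sub>R v + t *\<^sub>R w) - f (x + t *\<^sub>R v) - f (x + t *\<^sub>R w) + f x) /\<^sub>R t\<^sup>2 - L w)"
        using t by (simp add: \<psi>_def scaleR_diff_right flip: power2_eq_square)
      ultimately have "norm ((f (x + t *\<^sub>R v + t *\<^sub>R w) - f (x + t *\<^sub>R v) - f (x + t *\<^sub>R w) + f x) /\<^sub>R t\<^sup>2 - L w)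
          \<le> 2 * e' * M"
        using t by (simp add: mult.commute)
      also have "\<dots> < e"
        using e M by (simp add: e'_def)
      finally show ?thesis .
    qed
    show "\<forall>\<^sub>F t in at_right 0.
        dist ((f (x + t *\<^sub>R v + t *\<^sub>R w) - f (x + t *\<^sub>R v) - f (x + t *\<^sub>R w) + f x) /\<^sub>R t\<^sup>2)
          (dderiv w (dderiv v f) x) < e"
      unfolding eventually_at_right_field
      using bound \<delta> by (auto simp: dist_norm L_def intro!: exI[of _ \<delta>])
  qed
qed

lemma dderiv_commute:
  assumes "open S" "x \<in> S" "smooth_on S f"
  shows "dderiv v (dderiv w f) x = dderiv w (dderiv v f) x"
proof -
  have *: "((\<lambda>t. (f (x + t *\<^sub>R v + t *\<^sub>R w) - f (x + t *\<^sub>R v) - f (x + t *\<^sub>R w) + f x) /\<^sub>R t\<^sup>2)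
      \<longlongrightarrow> dderiv w (dderiv v f) x) (at_right 0)" for v w
    by (rule second_difference_tendsto[OF assms(1,2)])
       (simp_all add: smooth_on_differentiable[OF assms(3)]
          smooth_on_differentiable[OF smooth_on_dderiv[OF assms(3)] assms(2)])
  have "(\<lambda>t. (f (x + t *\<^sub>R w + t *\<^sub>R v) - f (x + t *\<^sub>R w) - f (x + t *\<^sub>R v) + f x) /\<^sub>R t\<^sup>2) =
    (\<lambda>t. (f (x + t *\<^sub>R v + t *\<^sub>R w) - f (x + t *\<^sub>R v) - f (x + t *\<^sub>R w) + f x) /\<^sub>R t\<^sup>2)"
    by (simp add: algebra_simps)
  with *[of w v] *[of v w] show ?thesis
    using tendsto_unique[OF trivial_limit_at_right_real] by fastforce
qed

section \<open>Operators on spaces of smooth functions\<close>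

text \<open>Vanishing outside \<open>S\<close> turns equality on \<open>S\<close> into equality of
  functions, so operator identities can be rewritten without mentioning points.\<close>

definition Csmooth :: "'a::real_normed_vector set \<Rightarrow> ('a \<Rightarrow> complex) set" where
  "Csmooth S = {f. smooth_on S f \<and> (\<forall>x. x \<notin> S \<longrightarrow> f x = 0)}"

definition vfield ::
  "'a::real_normed_vector set \<Rightarrow> ('a \<Rightarrow> 'a) \<Rightarrow> ('a \<Rightarrow> complex) \<Rightarrow> 'a \<Rightarrow> complex" where
  "vfield S a f = (\<lambda>x. if x \<in> S then dderiv (a x) f x else 0)"

text \<open>Linearity is asked on \<open>V\<close> only, because derivatives of nondifferentiable
  functions are arbitrary values.\<close>

definition linear_op_on :: "('a \<Rightarrow> complex) set \<Rightarrow> (('a \<Rightarrow> complex) \<Rightarrow> 'a \<Rightarrow> complex) \<Rightarrow> bool" where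
  "linear_op_on V X \<longleftrightarrow> (\<forall>f\<in>V. X f \<in> V) \<and>
     (\<forall>f\<in>V. \<forall>g\<in>V. X (\<lambda>x. f x + g x) = (\<lambda>x. X f x + X g x)) \<and>
     (\<forall>f\<in>V. \<forall>c. X (\<lambda>x. c * f x) = (\<lambda>x. c * X f x))"

lemma CsmoothD: "f \<in> Csmooth S \<Longrightarrow> smooth_on S f" "f \<in> Csmooth S \<Longrightarrow> x \<notin> S \<Longrightarrow> f x = 0"
  by (auto simp: Csmooth_def)

lemma Csmooth_differentiable: "f \<in> Csmooth S \<Longrightarrow> x \<in> S \<Longrightarrow> f differentiable (at x)"
  using CsmoothD(1) smooth_on_differentiable by blast

lemma Csmooth_add: "open S \<Longrightarrow> f \<in> Csmooth S \<Longrightarrow> g \<in> Csmooth S \<Longrightarrow> (\<lambda>x. f x + g x) \<in> Csmooth S"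
  by (auto simp: Csmooth_def smooth_on_add)

lemma Csmooth_mult: "open S \<Longrightarrow> f \<in> Csmooth S \<Longrightarrow> g \<in> Csmooth S \<Longrightarrow> (\<lambda>x. f x * g x) \<in> Csmooth S"
  by (auto simp: Csmooth_def smooth_on_mult)

lemma Csmooth_cmult: "open S \<Longrightarrow> f \<in> Csmooth S \<Longrightarrow> (\<lambda>x. c * f x) \<in> Csmooth S"
  by (auto simp: Csmooth_def smooth_on_cmult)

lemma Csmooth_zero: "(\<lambda>x. 0) \<in> Csmooth S"
  by (auto simp: Csmooth_def)

lemma vfield_Basis:
  fixes a :: "'a::euclidean_space \<Rightarrow> 'a"
  assumes "x \<in> S" "f \<in> Csmooth S"
  shows "vfield S a f x = (\<Sum>b\<in>Basis. complex_of_real (a x \<bullet> b) * dderiv b f x)"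
  using assms
  by (simp add: vfield_def scaleR_conv_of_real dderiv_Basis[OF Csmooth_differentiable, where v = "a x"])

lemma vfield_Csmooth:
  fixes a :: "'a::euclidean_space \<Rightarrow> 'a"
  assumes "open S" "\<And>x. (a has_derivative A) (at x)" "f \<in> Csmooth S"
  shows "vfield S a f \<in> Csmooth S"
proof -
  have "smooth_on S (\<lambda>x. complex_of_real (a x \<bullet> b))" for b
    by (rule smooth_on_affine, rule bounded_linear.has_derivative[OF bounded_linear_of_real],
        rule has_derivative_inner_left, rule assms)
  then have "smooth_on S (\<lambda>x. \<Sum>b\<in>Basis. complex_of_real (a x \<bullet> b) * dderiv b f x)"
    using smooth_on_dderiv[OF CsmoothD(1)[OF assms(3)]]
    by (intro smooth_on_sum smooth_on_mult assms(1))
  then have "smooth_on S (vfield S a f)"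
    by (rule smooth_on_cong[OF assms(1)]) (simp add: vfield_Basis assms(3))
  then show ?thesis
    by (auto simp: Csmooth_def vfield_def)
qed

lemma vfield_add:
  "f \<in> Csmooth S \<Longrightarrow> g \<in> Csmooth S \<Longrightarrow>
    vfield S a (\<lambda>x. f x + g x) = (\<lambda>x. vfield S a f x + vfield S a g x)"
  by (auto simp: vfield_def fun_eq_iff dderiv_add Csmooth_differentiable)

lemma vfield_cmult:
  "f \<in> Csmooth S \<Longrightarrow> vfield S a (\<lambda>x. c * f x) = (\<lambda>x. c * vfield S a f x)"
  by (auto simp: vfield_def fun_eq_iff dderiv_cmult Csmooth_differentiable)

lemma vfield_mult:
  "f \<in> Csmooth S \<Longrightarrow> g \<in> Csmooth S \<Longrightarrow>
    vfield S a (\<lambda>x. f x * g x) = (\<lambda>x. f x * vfield S a g x + vfield S a f x * g x)"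
  by (auto simp: vfield_def fun_eq_iff dderiv_mult Csmooth_differentiable)

lemma linear_op_on_vfield:
  fixes a :: "'a::euclidean_space \<Rightarrow> 'a"
  assumes "open S" "\<And>x. (a has_derivative A) (at x)"
  shows "linear_op_on (Csmooth S) (vfield S a)"
  unfolding linear_op_on_def using vfield_Csmooth[OF assms] vfield_add vfield_cmult by blast

lemma dderiv_vfield:
  fixes a :: "'a::euclidean_space \<Rightarrow> 'a"
  assumes S: "open S" "x \<in> S" and a: "(a has_derivative A) (at x)" and f: "f \<in> Csmooth S"
  shows "dderiv w (vfield S a f) x = dderiv (A w) f x +
    (\<Sum>b\<in>Basis. complex_of_real (a x \<bullet> b) * dderiv w (dderiv b f) x)"
proof -
  have d: "(\<lambda>x. complex_of_real (a x \<bullet> b)) differentiable (at x)"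
    "dderiv w (\<lambda>x. complex_of_real (a x \<bullet> b)) x = complex_of_real (A w \<bullet> b)" for b
  proof -
    have "((\<lambda>x. complex_of_real (a x \<bullet> b)) has_derivative (\<lambda>v. complex_of_real (A v \<bullet> b))) (at x)"
      by (intro bounded_linear.has_derivative[OF bounded_linear_of_real] has_derivative_inner_left a)
    then show "(\<lambda>x. complex_of_real (a x \<bullet> b)) differentiable (at x)"
      "dderiv w (\<lambda>x. complex_of_real (a x \<bullet> b)) x = complex_of_real (A w \<bullet> b)"
      by (auto simp: differentiable_def dderiv_eq)
  qed
  have fd: "dderiv b f differentiable (at x)" for b
    using smooth_on_differentiable[OF smooth_on_dderiv[OF CsmoothD(1)[OF f]] S(2)] .
  have "dderiv w (vfield S a f) x =
      dderiv w (\<lambda>x. \<Sum>b\<in>Basis. complex_of_real (a x \<bullet> b) * dderiv b f x) x"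
    by (rule dderiv_cong_open[OF S]) (simp add: vfield_Basis f)
  also have "\<dots> = (\<Sum>b\<in>Basis. complex_of_real (a x \<bullet> b) * dderiv w (dderiv b f) x +
      complex_of_real (A w \<bullet> b) * dderiv b f x)"
    by (subst dderiv_sum) (simp_all add: d fd dderiv_mult differentiable_mult)
  finally show ?thesis
    using dderiv_Basis[OF Csmooth_differentiable[OF f S(2)], of "A w"]
    by (simp add: sum.distrib scaleR_conv_of_real)
qed

text \<open>The second-order parts of the two iterated derivatives agree by symmetry of second
  derivatives (\<open>eq\<close>); what remains is the Lie bracket B(a x) - A(b x) of two affine
  fields.\<close>

lemma vfield_commutator:
  fixes a b :: "'a::euclidean_space \<Rightarrow> 'a"
  assumes S: "open S" and a: "\<And>x. (a has_derivative A) (at x)"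
    and b: "\<And>x. (b has_derivative B) (at x)" and f: "f \<in> Csmooth S"
  shows "vfield S a (vfield S b f) =
    (\<lambda>x. vfield S b (vfield S a f) x + vfield S (\<lambda>x. B (a x) - A (b x)) f x)"
proof
  fix x
  show "vfield S a (vfield S b f) x =
    vfield S b (vfield S a f) x + vfield S (\<lambda>x. B (a x) - A (b x)) f x"
  proof (cases "x \<in> S")
    case True
    have lin: "dderiv v (dderiv c f) x = (\<Sum>d\<in>Basis. complex_of_real (v \<bullet> d) * dderiv d (dderiv c f) x)" for v c
      by (subst dderiv_Basis[OF smooth_on_differentiable[OF smooth_on_dderiv[OF CsmoothD(1)[OF f]] True]])
         (simp only: scaleR_conv_of_real)
    have "(\<Sum>c\<in>Basis. complex_of_real (b x \<bullet> c) * dderiv (a x) (dderiv c f) x) =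
       (\<Sum>c\<in>Basis. \<Sum>d\<in>Basis. complex_of_real (b x \<bullet> c) * (complex_of_real (a x \<bullet> d) * dderiv d (dderiv c f) x))"
      by (simp only: lin[of "a x"] sum_distrib_left)
    also have "\<dots> = (\<Sum>d\<in>Basis. \<Sum>c\<in>Basis. complex_of_real (a x \<bullet> d) * (complex_of_real (b x \<bullet> c) * dderiv c (dderiv d f) x))"
      by (subst sum.swap, intro sum.cong refl, subst dderiv_commute[OF S True CsmoothD(1)[OF f]])
         (simp only: mult.left_commute)
    also have "\<dots> = (\<Sum>d\<in>Basis. complex_of_real (a x \<bullet> d) * dderiv (b x) (dderiv d f) x)"
      by (simp only: lin[of "b x"] sum_distrib_left)
    finally have eq: "(\<Sum>c\<in>Basis. complex_of_real (b x \<bullet> c) * dderiv (a x) (dderiv c f) x) =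
        (\<Sum>d\<in>Basis. complex_of_real (a x \<bullet> d) * dderiv (b x) (dderiv d f) x)" .
    have "vfield S a (vfield S b f) x = dderiv (a x) (vfield S b f) x"
      "vfield S b (vfield S a f) x = dderiv (b x) (vfield S a f) x"
      "vfield S (\<lambda>x. B (a x) - A (b x)) f x = dderiv (B (a x)) f x - dderiv (A (b x)) f x"
      using True linear_diff[OF linear_dderiv[OF Csmooth_differentiable[OF f True]]]
      by (simp_all add: vfield_def)
    then show ?thesis
      unfolding dderiv_vfield[OF S True b f, of "a x"] dderiv_vfield[OF S True a f, of "b x"] eq
      by (simp only:) simp
  qed (simp add: vfield_def)
qed

locale function_space =
  fixes V :: "('a \<Rightarrow> complex) set"
  assumes add_mem [simp]: "f \<in> V \<Longrightarrow> g \<in> V \<Longrightarrow> (\<lambda>x. f x + g x) \<in> V"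
    and cmult_mem [simp]: "f \<in> V \<Longrightarrow> (\<lambda>x. c * f x) \<in> V"
    and zero_mem [simp]: "(\<lambda>x. 0) \<in> V"
begin

lemma sum_mem: "(\<And>i. i \<in> I \<Longrightarrow> f i \<in> V) \<Longrightarrow> (\<lambda>x. \<Sum>i\<in>I. f i x) \<in> V"
  by (induction I rule: infinite_finite_induct) auto

lemma op_mem: "linear_op_on V X \<Longrightarrow> f \<in> V \<Longrightarrow> X f \<in> V"
  by (simp add: linear_op_on_def)

lemma op_add: "linear_op_on V X \<Longrightarrow> f \<in> V \<Longrightarrow> g \<in> V \<Longrightarrow> X (\<lambda>x. f x + g x) = (\<lambda>x. X f x + X g x)"
  by (simp add: linear_op_on_def)

lemma op_cmult: "linear_op_on V X \<Longrightarrow> f \<in> V \<Longrightarrow> X (\<lambda>x. c * f x) = (\<lambda>x. c * X f x)"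
  by (simp add: linear_op_on_def)

lemma op_zero: "linear_op_on V X \<Longrightarrow> X (\<lambda>x. 0) = (\<lambda>x. 0)"
  using op_cmult[of X "\<lambda>x. 0" 0] by simp

lemma op_sum:
  assumes "linear_op_on V X" "\<And>i. i \<in> I \<Longrightarrow> f i \<in> V"
  shows "X (\<lambda>x. \<Sum>i\<in>I. c i * f i x) = (\<lambda>x. \<Sum>i\<in>I. c i * X (f i) x)"
  using assms(2)
proof (induction I rule: infinite_finite_induct)
  case (insert i I)
  have "(\<lambda>x. \<Sum>i\<in>I. c i * f i x) \<in> V"
    using insert by (intro sum_mem) auto
  then have "X (\<lambda>x. c i * f i x + (\<Sum>i\<in>I. c i * f i x)) =
      (\<lambda>x. c i * X (f i) x + X (\<lambda>x. \<Sum>i\<in>I. c i * f i x) x)"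
    using insert.prems by (simp add: op_add[OF assms(1)] op_cmult[OF assms(1)])
  with insert show ?case by simp
qed (simp_all add: op_zero[OF assms(1)])

lemma op_comp:
  assumes "linear_op_on V X" "linear_op_on V Y"
  shows "linear_op_on V (\<lambda>f. X (Y f))"
  unfolding linear_op_on_def
  using assms by (auto simp: op_mem op_add op_cmult)

lemma op_funpow:
  assumes "linear_op_on V X"
  shows "linear_op_on V (X ^^ n)"
proof (induction n)
  case (Suc n)
  have "X ^^ Suc n = (\<lambda>f. X ((X ^^ n) f))"
    by auto
  with op_comp[OF assms Suc] show ?case by simp
qed (simp add: linear_op_on_def)

end

lemma function_space_Csmooth: "open S \<Longrightarrow> function_space (Csmooth S)"
  by unfold_locales (auto simp: Csmooth_add Csmooth_cmult Csmooth_zero)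

section \<open>Heisenberg triples of operators\<close>

text \<open>The coefficients of the symmetrization of \<open>X\<^sup>p Y\<^sup>q\<close> in the ordered monomials
  \<open>X\<^sup>p\<^sup>-\<^sup>k Y\<^sup>q\<^sup>-\<^sup>k Z\<^sup>k\<close>, for operators with \<open>Y X = X Y + Z\<close>
  and \<open>Z\<close> central.\<close>

definition weyl :: "nat \<Rightarrow> nat \<Rightarrow> nat \<Rightarrow> complex" where
  "weyl p q k = of_nat (p choose k) * of_nat (q choose k) * fact k / 2 ^ k"

lemma weyl_eq_0: "k > p \<or> k > q \<Longrightarrow> weyl p q k = 0"
  by (auto simp: weyl_def)

lemma binomial_absorb: "of_nat p * of_nat ((p - 1) choose k) = (of_nat p - of_nat k :: complex) * of_nat (p choose k)"
proof (cases "k \<le> p")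
  case True
  then have "of_nat (p * ((p - 1) choose k)) = (of_nat ((p - k) * (p choose k)) :: complex)"
    by (metis binomial_absorb_comp)
  with True show ?thesis
    by (simp add: of_nat_diff)
next
  case False
  then show ?thesis by (auto simp: binomial_eq_0)
qed

text \<open>This, \<open>weyl_right\<close> and \<open>weyl_step\<close> are the coefficient
  identities behind \<open>sym_mon_rec\<close>. The differences are taken in the complex numbers, so
  indices beyond \<open>p\<close> or \<open>q\<close> need no separate treatment there.\<close>

lemma weyl_left: "of_nat p * weyl (p - 1) q k = (of_nat p - of_nat k) * weyl p q k"
proof -
  have "of_nat p * weyl (p - 1) q k = (of_nat p * of_nat ((p - 1) choose k)) * of_nat (q choose k) * fact k / 2 ^ k"
    by (simp add: weyl_def)
  also have "\<dots> = (of_nat p - of_nat k) * weyl p q k"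
    unfolding binomial_absorb by (simp add: weyl_def)
  finally show ?thesis .
qed

lemma weyl_right: "of_nat q * weyl p (q - 1) k = (of_nat q - of_nat k) * weyl p q k"
  using weyl_left[of q p k] by (simp add: weyl_def mult_ac)

lemma binomial_step: "(of_nat p - of_nat k :: complex) * of_nat (p choose k) = of_nat (Suc k) * of_nat (p choose Suc k)"
proof (cases "k \<le> p")
  case True
  have "of_nat ((p - k) * (p choose k)) = (of_nat (Suc k * (p choose Suc k)) :: complex)"
    by (metis binomial_absorb_comp binomial_absorption)
  with True show ?thesis
    by (simp add: of_nat_diff algebra_simps)
qed (auto simp: binomial_eq_0)

lemma weyl_step: "(of_nat p - of_nat k) * (of_nat q - of_nat k) * weyl p q k = 2 * of_nat (Suc k) * weyl p q (Suc k)"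
proof -
  have "(of_nat p - of_nat k) * (of_nat q - of_nat k) * weyl p q k =
      ((of_nat p - of_nat k) * of_nat (p choose k)) * ((of_nat q - of_nat k) * of_nat (q choose k)) * fact k / 2 ^ k"
    by (simp add: weyl_def)
  also have "\<dots> = 2 * of_nat (Suc k) * weyl p q (Suc k)"
    unfolding binomial_step weyl_def by (simp add: field_simps)
  finally show ?thesis .
qed

text \<open>Instantiated twice: by \<open>D1\<close>, \<open>D2\<close>, \<open>D3\<close> on R^3,
  and by the right derivatives along E_21, E_32, E_31 on GL(3,R), where [E_32, E_21] = E_31 is
  central.\<close>

locale heisenberg = function_space +
  fixes X Y Z :: "('a \<Rightarrow> complex) \<Rightarrow> 'a \<Rightarrow> complex"
  assumes lin_X: "linear_op_on V X" and lin_Y: "linear_op_on V Y" and lin_Z: "linear_op_on V Z"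
    and YX: "f \<in> V \<Longrightarrow> Y (X f) = (\<lambda>x. X (Y f) x + Z f x)"
    and ZX: "f \<in> V \<Longrightarrow> Z (X f) = X (Z f)"
    and ZY: "f \<in> V \<Longrightarrow> Z (Y f) = Y (Z f)"
begin

definition mon :: "nat \<Rightarrow> nat \<Rightarrow> nat \<Rightarrow> ('a \<Rightarrow> complex) \<Rightarrow> 'a \<Rightarrow> complex" where
  "mon p q r f = (X ^^ p) ((Y ^^ q) ((Z ^^ r) f))"

lemma mem [simp]: "f \<in> V \<Longrightarrow> X f \<in> V" "f \<in> V \<Longrightarrow> Y f \<in> V" "f \<in> V \<Longrightarrow> Z f \<in> V"
  using lin_X lin_Y lin_Z op_mem by auto

lemma pow_mem [simp]: "f \<in> V \<Longrightarrow> (X ^^ n) f \<in> V" "f \<in> V \<Longrightarrow> (Y ^^ n) f \<in> V" "f \<in> V \<Longrightarrow> (Z ^^ n) f \<in> V"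
  using lin_X lin_Y lin_Z op_funpow op_mem by auto

lemma mon_mem [simp]: "f \<in> V \<Longrightarrow> mon p q r f \<in> V"
  by (simp add: mon_def)

lemma linear_op_on_mon: "linear_op_on V (mon p q r)"
  unfolding mon_def[abs_def]
  by (rule op_comp[OF op_funpow[OF lin_X] op_comp[OF op_funpow[OF lin_Y] op_funpow[OF lin_Z]]])

lemma Z_Xpow: "f \<in> V \<Longrightarrow> Z ((X ^^ n) f) = (X ^^ n) (Z f)"
  by (induction n) (auto simp: ZX)

lemma Z_Ypow: "f \<in> V \<Longrightarrow> Z ((Y ^^ n) f) = (Y ^^ n) (Z f)"
  by (induction n) (auto simp: ZY)

lemma Zpow_X: "f \<in> V \<Longrightarrow> (Z ^^ n) (X f) = X ((Z ^^ n) f)"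
  by (induction n) (auto simp: ZX)

lemma Zpow_Y: "f \<in> V \<Longrightarrow> (Z ^^ n) (Y f) = Y ((Z ^^ n) f)"
  by (induction n) (auto simp: ZY)

text \<open>Each of the \<open>n\<close> crossings of \<open>Y\<close> past an \<open>X\<close>
  leaves one central \<open>Z\<close>. At \<open>n = 0\<close> the truncated exponent is multiplied
  by 0.\<close>

lemma Y_Xpow:
  "f \<in> V \<Longrightarrow> Y ((X ^^ n) f) = (\<lambda>x. (X ^^ n) (Y f) x + of_nat n * (X ^^ (n - 1)) (Z f) x)"
proof (induction n)
  case (Suc n)
  have "Y (X ((X ^^ n) f)) = (\<lambda>x. X (Y ((X ^^ n) f)) x + (X ^^ n) (Z f) x)"
    using Suc.prems by (simp add: YX Z_Xpow)
  also have "X (Y ((X ^^ n) f)) = (\<lambda>x. X ((X ^^ n) (Y f)) x + of_nat n * X ((X ^^ (n - 1)) (Z f)) x)"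
    using Suc by (simp add: op_add[OF lin_X] op_cmult[OF lin_X])
  finally show ?case
    by (cases n) (auto simp: algebra_simps)
qed simp

lemma Ypow_X:
  "f \<in> V \<Longrightarrow> (Y ^^ n) (X f) = (\<lambda>x. X ((Y ^^ n) f) x + of_nat n * (Y ^^ (n - 1)) (Z f) x)"
proof (induction n)
  case (Suc n)
  have "Y ((Y ^^ n) (X f)) = (\<lambda>x. Y (X ((Y ^^ n) f)) x + of_nat n * Y ((Y ^^ (n - 1)) (Z f)) x)"
    using Suc by (simp add: op_add[OF lin_Y] op_cmult[OF lin_Y])
  also have "Y (X ((Y ^^ n) f)) = (\<lambda>x. X (Y ((Y ^^ n) f)) x + (Y ^^ n) (Z f) x)"
    using Suc.prems by (simp add: YX Z_Ypow)
  finally show ?case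
    by (cases n) (auto simp: algebra_simps)
qed simp

lemma X_mon: "X (mon p q r f) = mon (Suc p) q r f"
  by (simp add: mon_def)

lemma Z_mon: "f \<in> V \<Longrightarrow> Z (mon p q r f) = mon p q (Suc r) f"
  by (simp add: mon_def Z_Xpow Z_Ypow)

lemma Y_mon:
  "f \<in> V \<Longrightarrow> Y (mon p q r f) = (\<lambda>x. mon p (Suc q) r f x + of_nat p * mon (p - 1) q (Suc r) f x)"
  by (simp add: mon_def Y_Xpow Z_Ypow)

lemma mon_Z: "mon p q r (Z f) = mon p q (Suc r) f"
  by (simp add: mon_def funpow_swap1)

lemma mon_Y: "f \<in> V \<Longrightarrow> mon p q r (Y f) = mon p (Suc q) r f"
  by (simp add: mon_def Zpow_Y funpow_swap1)

lemma mon_X: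
  assumes "f \<in> V"
  shows "mon p q r (X f) = (\<lambda>x. mon (Suc p) q r f x + of_nat q * mon p (q - 1) (Suc r) f x)"
proof -
  have "mon p q r (X f) = (X ^^ p) (\<lambda>x. X ((Y ^^ q) ((Z ^^ r) f)) x +
      of_nat q * (Y ^^ (q - 1)) (Z ((Z ^^ r) f)) x)"
    using assms by (simp add: mon_def Zpow_X Ypow_X)
  also have "\<dots> = (\<lambda>x. (X ^^ p) (X ((Y ^^ q) ((Z ^^ r) f))) x +
      of_nat q * (X ^^ p) ((Y ^^ (q - 1)) (Z ((Z ^^ r) f))) x)"
    using assms by (simp add: op_add[OF op_funpow[OF lin_X]] op_cmult[OF op_funpow[OF lin_X]])
  finally show ?thesis
    by (simp add: mon_def funpow_swap1)
qed

text \<open>The claimed value of the symmetrized product of \<open>p\<close> factors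
  \<open>X\<close>, \<open>q\<close> factors \<open>Y\<close> and \<open>r\<close> factors
  \<open>Z\<close>; \<open>sum_permuted_words\<close> verifies it.\<close>

definition sym_mon :: "nat \<Rightarrow> nat \<Rightarrow> nat \<Rightarrow> ('a \<Rightarrow> complex) \<Rightarrow> 'a \<Rightarrow> complex" where
  "sym_mon p q r f = (\<lambda>x. \<Sum>k\<le>p. weyl p q k * mon (p - k) (q - k) (r + k) f x)"

text \<open>Terms beyond min(p, q) vanish with \<open>weyl\<close>, so sums with different
  parameters can be given one common range.\<close>

lemma sym_mon_alt:
  assumes "N \<ge> p \<or> N \<ge> q"
  shows "sym_mon p q r f x = (\<Sum>k\<le>N. weyl p q k * mon (p - k) (q - k) (r + k) f x)"
proof -
  have "(\<Sum>k\<le>N. weyl p q k * mon (p - k) (q - k) (r + k) f x) =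
      (\<Sum>k\<le>min p q. weyl p q k * mon (p - k) (q - k) (r + k) f x)"
    if "N \<ge> p \<or> N \<ge> q" for N
    by (rule sum.mono_neutral_right) (use that in \<open>auto simp: weyl_eq_0\<close>)
  from this[OF assms] this[of p] show ?thesis
    by (simp add: sym_mon_def)
qed

text \<open>The recursion that any symmetrization obeys, by splitting words according to the
  rightmost letter, which is applied first: a proportion p : (p + q + r) of them ends in
  \<open>X\<close>, and so on. Here it is checked on the closed form by comparing
  coefficients.\<close>

lemma sym_mon_rec:
  assumes f: "f \<in> V"
  shows "of_nat (p + q + r) * sym_mon p q r f x =
    of_nat p * sym_mon (p - 1) q r (X f) x + of_nat q * sym_mon p (q - 1) r (Y f) x +
    of_nat r * sym_mon p q (r - 1) (Z f) x"
proof -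
  define N where "N = p + q"
  define t where "t k = mon (p - k) (q - k) (r + k) f x" for k
  define w where "w = weyl p q"
  have wN: "w (Suc N) = 0"
    by (simp add: w_def N_def weyl_eq_0)
  have Zp: "of_nat r * sym_mon p q (r - 1) (Z f) x = (\<Sum>k\<le>N. of_nat r * (w k * t k))"
    by (cases r) (auto simp: sym_mon_alt[of p N] N_def mon_Z t_def w_def sum_distrib_left)
  have Yp: "of_nat q * sym_mon p (q - 1) r (Y f) x = (\<Sum>k\<le>N. (of_nat q - of_nat k) * w k * t k)"
  proof -
    have "of_nat q * sym_mon p (q - 1) r (Y f) x =
        (\<Sum>k\<le>N. of_nat q * weyl p (q - 1) k * mon (p - k) (Suc (q - 1 - k)) (r + k) f x)"
      by (simp add: sym_mon_alt[of p N] N_def mon_Y f sum_distrib_left mult.assoc)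
    also have "\<dots> = (\<Sum>k\<le>N. of_nat q * weyl p (q - 1) k * t k)"
    proof (rule sum.cong[OF refl])
      fix k
      have z: "of_nat q * weyl p (q - 1) k = 0" if "\<not> q > k"
        using that by (cases q) (auto simp: weyl_eq_0)
      have "Suc (q - 1 - k) = q - k" if "q > k"
        using that by simp
      then show "of_nat q * weyl p (q - 1) k * mon (p - k) (Suc (q - 1 - k)) (r + k) f x =
          of_nat q * weyl p (q - 1) k * t k"
        using z by (cases "q > k") (auto simp: t_def)
    qed
    finally show ?thesis by (simp only: weyl_right w_def)
  qed
  \<comment> \<open>Moving the rightmost \<open>X\<close> to the left of the power of
    \<open>Y\<close> leaves a term with one more \<open>Z\<close>; it belongs to index k + 1 and is
    rewritten by \<open>weyl_step\<close>. The total factor of the k-th term is (p - k) + 2 k + (q -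
    k) + r = p + q + r.\<close>
  have Xp: "of_nat p * sym_mon (p - 1) q r (X f) x =
      (\<Sum>k\<le>N. (of_nat p - of_nat k) * w k * t k) + (\<Sum>k\<le>N. 2 * of_nat k * w k * t k)"
  proof -
    have "of_nat p * sym_mon (p - 1) q r (X f) x =
        (\<Sum>k\<le>N. of_nat p * weyl (p - 1) q k * mon (Suc (p - 1 - k)) (q - k) (r + k) f x) +
        (\<Sum>k\<le>N. of_nat p * weyl (p - 1) q k * (of_nat (q - k) * mon (p - 1 - k) (q - k - 1) (Suc (r + k)) f x))"
      by (subst sym_mon_alt[where N = N])
         (simp_all add: N_def mon_X f sum_distrib_left algebra_simps sum.distrib)
    also have "(\<Sum>k\<le>N. of_nat p * weyl (p - 1) q k * mon (Suc (p - 1 - k)) (q - k) (r + k) f x) =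
        (\<Sum>k\<le>N. of_nat p * weyl (p - 1) q k * t k)"
    proof (rule sum.cong[OF refl])
      fix k
      have z: "of_nat p * weyl (p - 1) q k = 0" if "\<not> p > k"
        using that by (cases p) (auto simp: weyl_eq_0)
      have "Suc (p - 1 - k) = p - k" if "p > k"
        using that by simp
      then show "of_nat p * weyl (p - 1) q k * mon (Suc (p - 1 - k)) (q - k) (r + k) f x =
          of_nat p * weyl (p - 1) q k * t k"
        using z by (cases "p > k") (auto simp: t_def)
    qed
    also have "(\<Sum>k\<le>N. of_nat p * weyl (p - 1) q k * (of_nat (q - k) * mon (p - 1 - k) (q - k - 1) (Suc (r + k)) f x)) =
        (\<Sum>k\<le>N. 2 * of_nat (Suc k) * w (Suc k) * t (Suc k))"
    proof (rule sum.cong[OF refl])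
      fix k
      have "of_nat p * weyl (p - 1) q k * of_nat (q - k) = 2 * of_nat (Suc k) * w (Suc k)"
        unfolding weyl_left w_def weyl_step[symmetric]
        by (cases "k \<le> q") (auto simp: of_nat_diff weyl_eq_0)
      moreover have "mon (p - 1 - k) (q - k - 1) (Suc (r + k)) f x = t (Suc k)"
        by (simp add: t_def)
      ultimately show "of_nat p * weyl (p - 1) q k * (of_nat (q - k) * mon (p - 1 - k) (q - k - 1) (Suc (r + k)) f x) =
          2 * of_nat (Suc k) * w (Suc k) * t (Suc k)"
        by (metis mult.assoc)
    qed
    also have "\<dots> = (\<Sum>k\<le>Suc N. 2 * of_nat k * w k * t k)"
      by (subst sum.atMost_Suc_shift) simp
    also have "\<dots> = (\<Sum>k\<le>N. 2 * of_nat k * w k * t k)"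
      by (simp add: wN)
    finally show ?thesis
      by (simp only: weyl_left w_def)
  qed
  have "of_nat (p + q + r) * sym_mon p q r f x = (\<Sum>k\<le>N. of_nat (p + q + r) * (w k * t k))"
    by (simp add: sym_mon_alt[of p N] N_def t_def w_def sum_distrib_left)
  also have "\<dots> = of_nat p * sym_mon (p - 1) q r (X f) x + of_nat q * sym_mon p (q - 1) r (Y f) x +
      of_nat r * sym_mon p q (r - 1) (Z f) x"
    unfolding Xp Yp Zp sum.distrib[symmetric]
    by (intro sum.cong refl) (simp add: algebra_simps)
  finally show ?thesis .
qed

end

section \<open>Commuting weight and raising operators past powers and monomials\<close>

context function_space
begin

lemma weight_pow:
  assumes H: "linear_op_on V H" and W: "linear_op_on V W"
    and HW: "\<And>f. f \<in> V \<Longrightarrow> H (W f) = (\<lambda>x. W (H f) x + w * W f x)"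
    and f: "f \<in> V" and Hf: "H f = (\<lambda>x. \<mu> * f x)"
  shows "H ((W ^^ n) f) = (\<lambda>x. (\<mu> + of_nat n * w) * (W ^^ n) f x)"
proof (induction n)
  case (Suc n)
  have "(W ^^ n) f \<in> V"
    using op_mem[OF op_funpow[OF W] f] .
  then have "H (W ((W ^^ n) f)) = (\<lambda>x. W (H ((W ^^ n) f)) x + w * W ((W ^^ n) f) x)"
    and "W (\<lambda>x. (\<mu> + of_nat n * w) * (W ^^ n) f x) = (\<lambda>x. (\<mu> + of_nat n * w) * W ((W ^^ n) f) x)"
    by (simp_all add: HW op_cmult[OF W])
  with Suc show ?case
    by (simp add: algebra_simps)
qed (simp add: Hf)

text \<open>The sl_2 string formula for [E, W] = H and [H, W] = -2 W. \<open>E g\<close> is kept,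
  since \<open>g\<close> will be a word in the other operators applied to a section and is not
  annihilated by \<open>E\<close>.\<close>

lemma raise_pow:
  assumes H: "linear_op_on V H" and W: "linear_op_on V W"
    and EW: "\<And>f. f \<in> V \<Longrightarrow> E (W f) = (\<lambda>x. W (E f) x + H f x)"
    and HW: "\<And>f. f \<in> V \<Longrightarrow> H (W f) = (\<lambda>x. W (H f) x + (- 2) * W f x)"
    and E: "linear_op_on V E" and g: "g \<in> V" and Hg: "H g = (\<lambda>x. \<kappa> * g x)"
  shows "E ((W ^^ n) g) =
    (\<lambda>x. (W ^^ n) (E g) x + of_nat n * (\<kappa> - of_nat n + 1) * (W ^^ (n - 1)) g x)"
proof (induction n)
  case (Suc n)
  have m: "(W ^^ n) g \<in> V" "(W ^^ (n - 1)) g \<in> V" "(W ^^ n) (E g) \<in> V"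
    using op_mem[OF op_funpow[OF W] g] op_mem[OF op_funpow[OF W] op_mem[OF E g]] by auto
  have "E (W ((W ^^ n) g)) = (\<lambda>x. W (E ((W ^^ n) g)) x + H ((W ^^ n) g) x)"
    by (rule EW[OF m(1)])
  also have "W (E ((W ^^ n) g)) = (\<lambda>x. W ((W ^^ n) (E g)) x +
      of_nat n * (\<kappa> - of_nat n + 1) * W ((W ^^ (n - 1)) g) x)"
    unfolding Suc using m by (simp add: op_add[OF W] op_cmult[OF W])
  also have "H ((W ^^ n) g) = (\<lambda>x. (\<kappa> + of_nat n * (- 2)) * (W ^^ n) g x)"
    by (rule weight_pow[OF H W HW g Hg])
  finally show ?case
    by (cases n) (auto simp: fun_eq_iff algebra_simps)
qed simp

text \<open>Each crossing of \<open>E\<close> past a \<open>Z\<close> leaves one \<open>s U\<close>,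
  and \<open>U\<close> commutes with \<open>Z\<close>. Used with \<open>U = Y\<close>,
  \<open>s = -1\<close> for E_12 and with \<open>U = X\<close>, \<open>s = 1\<close> for
  E_23.\<close>

lemma central_pow:
  assumes E: "linear_op_on V E" and Z: "linear_op_on V Z" and U: "linear_op_on V U"
    and EZ: "\<And>f. f \<in> V \<Longrightarrow> E (Z f) = (\<lambda>x. Z (E f) x + s * U f x)"
    and ZU: "\<And>f. f \<in> V \<Longrightarrow> Z (U f) = U (Z f)"
    and f: "f \<in> V" and Ef: "E f = (\<lambda>x. 0)"
  shows "E ((Z ^^ n) f) = (\<lambda>x. s * of_nat n * U ((Z ^^ (n - 1)) f) x)"
proof (induction n)
  case (Suc n)
  have m: "(Z ^^ k) f \<in> V" "U ((Z ^^ k) f) \<in> V" for k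
    using op_mem[OF op_funpow[OF Z] f] op_mem[OF U] by auto
  have "E (Z ((Z ^^ n) f)) = (\<lambda>x. Z (E ((Z ^^ n) f)) x + s * U ((Z ^^ n) f) x)"
    by (rule EZ[OF m(1)])
  also have "Z (E ((Z ^^ n) f)) = (\<lambda>x. s * of_nat n * U (Z ((Z ^^ (n - 1)) f)) x)"
    unfolding Suc using m by (simp add: op_cmult[OF Z] ZU)
  finally show ?case
    by (cases n) (auto simp: fun_eq_iff algebra_simps)
qed (simp add: Ef)

lemma commuting_pow:
  assumes "linear_op_on V W" "\<And>f. f \<in> V \<Longrightarrow> E (W f) = W (E f)" "f \<in> V"
  shows "E ((W ^^ n) f) = (W ^^ n) (E f)"
  by (induction n) (use assms op_mem[OF op_funpow] in auto)

end

context heisenberg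
begin

text \<open>The commutation pattern of E_12 with E_21, E_32, E_31. It commutes with
  \<open>Y\<close>, so the result has two sources: the sl_2 string in \<open>X\<close>, and each
  \<open>Z\<close> turned into \<open>- Y\<close>, which joins the existing power of
  \<open>Y\<close> without reordering.\<close>

lemma raise_mon_X:
  assumes E: "linear_op_on V E" and H: "linear_op_on V H"
    and EX: "\<And>f. f \<in> V \<Longrightarrow> E (X f) = (\<lambda>x. X (E f) x + H f x)"
    and EY: "\<And>f. f \<in> V \<Longrightarrow> E (Y f) = Y (E f)"
    and EZ: "\<And>f. f \<in> V \<Longrightarrow> E (Z f) = (\<lambda>x. Z (E f) x + (- 1) * Y f x)"
    and HX: "\<And>f. f \<in> V \<Longrightarrow> H (X f) = (\<lambda>x. X (H f) x + (- 2) * X f x)"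
    and HY: "\<And>f. f \<in> V \<Longrightarrow> H (Y f) = (\<lambda>x. Y (H f) x + 1 * Y f x)"
    and HZ: "\<And>f. f \<in> V \<Longrightarrow> H (Z f) = (\<lambda>x. Z (H f) x + (- 1) * Z f x)"
    and f: "f \<in> V" and Ef: "E f = (\<lambda>x. 0)" and Hf: "H f = (\<lambda>x. \<mu> * f x)"
  shows "E (mon p q r f) = (\<lambda>x.
    of_nat p * (\<mu> + of_nat q - of_nat r - of_nat p + 1) * mon (p - 1) q r f x
    - of_nat r * mon p (Suc q) (r - 1) f x)"
proof -
  define g where "g = (Y ^^ q) ((Z ^^ r) f)"
  have g: "g \<in> V" using f by (simp add: g_def)
  have "H ((Z ^^ r) f) = (\<lambda>x. (\<mu> + of_nat r * (- 1)) * (Z ^^ r) f x)"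
    by (rule weight_pow[OF H lin_Z HZ f Hf])
  from weight_pow[OF H lin_Y HY _ this, of q] f
  have Hg: "H g = (\<lambda>x. (\<mu> + of_nat q - of_nat r) * g x)"
    by (simp add: g_def algebra_simps)
  have "E g = (Y ^^ q) (E ((Z ^^ r) f))"
    unfolding g_def using f by (intro commuting_pow[OF lin_Y] EY) auto
  also have "E ((Z ^^ r) f) = (\<lambda>x. (- of_nat r) * Y ((Z ^^ (r - 1)) f) x)"
    using central_pow[OF E lin_Z lin_Y EZ ZY f Ef] by simp
  also have "(Y ^^ q) \<dots> = (\<lambda>x. (- of_nat r) * (Y ^^ Suc q) ((Z ^^ (r - 1)) f) x)"
    using f by (subst op_cmult[OF op_funpow[OF lin_Y]]) (simp_all add: funpow_swap1)
  finally have Eg: "(X ^^ p) (E g) = (\<lambda>x. (- of_nat r) * mon p (Suc q) (r - 1) f x)"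
    using f by (simp only:, subst op_cmult[OF op_funpow[OF lin_X]]) (simp_all add: mon_def)
  show ?thesis
    using raise_pow[OF H lin_X EX HX E g Hg, of p] unfolding Eg
    by (simp add: mon_def g_def fun_eq_iff algebra_simps)
qed

text \<open>The commutation pattern of E_23. The \<open>X\<close> made from a \<open>Z\<close>
  stands to the right of the power of \<open>Y\<close> and must be moved to the front; the
  correction q r from this cancels the \<open>- r\<close> in the weight, q (\<mu> - r - q + 1) + q r
  = q (\<mu> - q + 1).\<close>

lemma raise_mon_Y:
  assumes E: "linear_op_on V E" and H: "linear_op_on V H"
    and EY: "\<And>f. f \<in> V \<Longrightarrow> E (Y f) = (\<lambda>x. Y (E f) x + H f x)"
    and EX: "\<And>f. f \<in> V \<Longrightarrow> E (X f) = X (E f)"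
    and EZ: "\<And>f. f \<in> V \<Longrightarrow> E (Z f) = (\<lambda>x. Z (E f) x + 1 * X f x)"
    and HY: "\<And>f. f \<in> V \<Longrightarrow> H (Y f) = (\<lambda>x. Y (H f) x + (- 2) * Y f x)"
    and HZ: "\<And>f. f \<in> V \<Longrightarrow> H (Z f) = (\<lambda>x. Z (H f) x + (- 1) * Z f x)"
    and f: "f \<in> V" and Ef: "E f = (\<lambda>x. 0)" and Hf: "H f = (\<lambda>x. \<mu> * f x)"
  shows "E (mon p q r f) = (\<lambda>x.
    of_nat q * (\<mu> - of_nat q + 1) * mon p (q - 1) r f x
    + of_nat r * mon (Suc p) q (r - 1) f x)"
proof -
  define g where "g = (Z ^^ r) f"
  have g: "g \<in> V" using f by (simp add: g_def)
  have Hg: "H g = (\<lambda>x. (\<mu> - of_nat r) * g x)"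
    using weight_pow[OF H lin_Z HZ f Hf, of r] by (simp add: g_def)
  have Eg: "E g = (\<lambda>x. of_nat r * X ((Z ^^ (r - 1)) f) x)"
    using central_pow[OF E lin_Z lin_X EZ ZX f Ef] by (simp add: g_def)
  have "(Y ^^ q) (E g) = (\<lambda>x. of_nat r * (Y ^^ q) (X ((Z ^^ (r - 1)) f)) x)"
    using f by (simp add: Eg op_cmult[OF op_funpow[OF lin_Y]])
  also have "\<dots> = (\<lambda>x. of_nat r * X ((Y ^^ q) ((Z ^^ (r - 1)) f)) x +
      of_nat q * of_nat r * (Y ^^ (q - 1)) g x)"
    using f by (cases r) (auto simp: Ypow_X g_def fun_eq_iff algebra_simps)
  finally have "E ((Y ^^ q) g) = (\<lambda>x. of_nat r * X ((Y ^^ q) ((Z ^^ (r - 1)) f)) x +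
      of_nat q * (\<mu> - of_nat q + 1) * (Y ^^ (q - 1)) g x)"
    using raise_pow[OF H lin_Y EY HY E g Hg, of q] by (simp add: fun_eq_iff algebra_simps)
  then have "(X ^^ p) (E ((Y ^^ q) g)) = (\<lambda>x. of_nat r * (X ^^ p) (X ((Y ^^ q) ((Z ^^ (r - 1)) f))) x +
      of_nat q * (\<mu> - of_nat q + 1) * (X ^^ p) ((Y ^^ (q - 1)) g) x)"
    using f g by (simp add: op_add[OF op_funpow[OF lin_X]] op_cmult[OF op_funpow[OF lin_X]])
  moreover have "E (mon p q r f) = (X ^^ p) (E ((Y ^^ q) g))"
    unfolding mon_def g_def[symmetric] using g by (intro commuting_pow[OF lin_X] EX) auto
  ultimately show ?thesis
    by (simp add: mon_def g_def fun_eq_iff algebra_simps funpow_swap1)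
qed

definition mon_sum :: "nat \<Rightarrow> nat \<Rightarrow> (nat \<Rightarrow> complex) \<Rightarrow> ('a \<Rightarrow> complex) \<Rightarrow> 'a \<Rightarrow> complex" where
  "mon_sum a b c f = (\<lambda>x. \<Sum>n\<le>min a b. c n * mon (a - n) (b - n) n f x)"

lemma mon_sum_mem: "f \<in> V \<Longrightarrow> mon_sum a b c f \<in> V"
  unfolding mon_sum_def by (intro sum_mem) auto

lemma linear_op_on_mon_sum: "linear_op_on V (mon_sum a b c)"
  unfolding linear_op_on_def using mon_sum_mem
  by (auto simp: mon_sum_def op_add[OF linear_op_on_mon] op_cmult[OF linear_op_on_mon]
      sum.distrib sum_distrib_left algebra_simps)

text \<open>The string term of index n and the \<open>Z\<close> term of index n + 1 land on the same
  monomial, so each image monomial carries one two-term expression in the coefficients. At n =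
  min(a, b) only its first part survives: this is where the recurrence has to stop.\<close>

lemma raise_mon_sum_X:
  assumes E: "linear_op_on V E"
    and raise: "\<And>p q r. E (mon p q r f) = (\<lambda>x.
      of_nat p * (\<mu> + of_nat q - of_nat r - of_nat p + 1) * mon (p - 1) q r f x
      - of_nat r * mon p (Suc q) (r - 1) f x)"
    and f: "f \<in> V" and c: "c (Suc (min a b)) = 0"
  shows "E (mon_sum a b c f) = (\<lambda>x. \<Sum>n\<le>min a b.
    ((- of_nat a + of_nat n) * (of_nat a - of_nat b - \<mu> - 1 + of_nat n) * c n - of_nat (Suc n) * c (Suc n))
    * mon (a - n - 1) (b - n) n f x)"
proof
  fix x
  define m where "m = min a b"
  define t where "t n = mon (a - n - 1) (b - n) n f x" for n
  have "E (mon_sum a b c f) x = (\<Sum>n\<le>m. c n * E (mon (a - n) (b - n) n f) x)"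
    unfolding mon_sum_def m_def using f by (subst op_sum[OF E]) auto
  also have "\<dots> = (\<Sum>n\<le>m. (- of_nat a + of_nat n) * (of_nat a - of_nat b - \<mu> - 1 + of_nat n) * c n * t n)
      - (\<Sum>n\<le>m. of_nat n * c n * mon (a - n) (Suc (b - n)) (n - 1) f x)"
    unfolding sum_subtractf[symmetric]
    by (intro sum.cong refl) (auto simp: raise t_def m_def of_nat_diff algebra_simps)
  \<comment> \<open>The added term n = m + 1 is 0 by the convention on \<open>c\<close>; it lets the
    sum be shifted without losing its range.\<close>
  also have "(\<Sum>n\<le>m. of_nat n * c n * mon (a - n) (Suc (b - n)) (n - 1) f x) =
      (\<Sum>n\<le>Suc m. of_nat n * c n * mon (a - n) (Suc (b - n)) (n - 1) f x)"
    using c by (simp add: m_def)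
  also have "\<dots> = (\<Sum>n\<le>m. of_nat (Suc n) * c (Suc n) * mon (a - Suc n) (Suc (b - Suc n)) n f x)"
    by (subst sum.atMost_Suc_shift) simp
  also have "\<dots> = (\<Sum>n\<le>m. of_nat (Suc n) * c (Suc n) * t n)"
  proof (intro sum.cong refl)
    fix n assume "n \<in> {..m}"
    \<comment> \<open>At n = m the truncated subtraction may clip, but there
      \<open>c (Suc n)\<close> vanishes.\<close>
    then have "n = m \<or> Suc (b - Suc n) = b - n"
      by (auto simp: m_def)
    then show "of_nat (Suc n) * c (Suc n) * mon (a - Suc n) (Suc (b - Suc n)) n f x = of_nat (Suc n) * c (Suc n) * t n"
      using c by (auto simp: t_def m_def)
  qed
  finally show "E (mon_sum a b c f) x = (\<Sum>n\<le>min a b.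
    ((- of_nat a + of_nat n) * (of_nat a - of_nat b - \<mu> - 1 + of_nat n) * c n - of_nat (Suc n) * c (Suc n))
    * mon (a - n - 1) (b - n) n f x)"
    by (simp only: m_def t_def left_diff_distrib sum_subtractf)
qed

text \<open>The companion for E_23. Its string and \<open>Z\<close> contributions have the opposite
  signs, so the overall minus brings the bracket to the same hypergeometric shape, with
  \<open>b\<close> in the place of \<open>a\<close>.\<close>

lemma raise_mon_sum_Y:
  assumes E: "linear_op_on V E"
    and raise: "\<And>p q r. E (mon p q r f) = (\<lambda>x.
      of_nat q * (\<mu> - of_nat q + 1) * mon p (q - 1) r f x
      + of_nat r * mon (Suc p) q (r - 1) f x)"
    and f: "f \<in> V" and c: "c (Suc (min a b)) = 0"
  shows "E (mon_sum a b c f) = (\<lambda>x. - (\<Sum>n\<le>min a b.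
    ((- of_nat b + of_nat n) * (\<mu> - of_nat b + 1 + of_nat n) * c n - of_nat (Suc n) * c (Suc n))
    * mon (a - n) (b - n - 1) n f x))"
proof
  fix x
  define m where "m = min a b"
  define t where "t n = mon (a - n) (b - n - 1) n f x" for n
  have "- E (mon_sum a b c f) x = - (\<Sum>n\<le>m. c n * E (mon (a - n) (b - n) n f) x)"
    unfolding mon_sum_def m_def using f by (subst op_sum[OF E]) auto
  also have "\<dots> = (\<Sum>n\<le>m. (- of_nat b + of_nat n) * (\<mu> - of_nat b + 1 + of_nat n) * c n * t n)
      - (\<Sum>n\<le>m. of_nat n * c n * mon (Suc (a - n)) (b - n) (n - 1) f x)"
    unfolding sum_subtractf[symmetric] sum_negf[symmetric]
    by (intro sum.cong refl) (auto simp: raise t_def m_def of_nat_diff algebra_simps)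
  also have "(\<Sum>n\<le>m. of_nat n * c n * mon (Suc (a - n)) (b - n) (n - 1) f x) =
      (\<Sum>n\<le>Suc m. of_nat n * c n * mon (Suc (a - n)) (b - n) (n - 1) f x)"
    using c by (simp add: m_def)
  also have "\<dots> = (\<Sum>n\<le>m. of_nat (Suc n) * c (Suc n) * mon (Suc (a - Suc n)) (b - Suc n) n f x)"
    by (subst sum.atMost_Suc_shift) simp
  also have "\<dots> = (\<Sum>n\<le>m. of_nat (Suc n) * c (Suc n) * t n)"
  proof (intro sum.cong refl)
    fix n assume "n \<in> {..m}"
    then have "n = m \<or> Suc (a - Suc n) = a - n"
      by (auto simp: m_def)
    then show "of_nat (Suc n) * c (Suc n) * mon (Suc (a - Suc n)) (b - Suc n) n f x = of_nat (Suc n) * c (Suc n) * t n"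
      using c by (auto simp: t_def m_def)
  qed
  finally have "- E (mon_sum a b c f) x = (\<Sum>n\<le>min a b.
    ((- of_nat b + of_nat n) * (\<mu> - of_nat b + 1 + of_nat n) * c n - of_nat (Suc n) * c (Suc n))
    * mon (a - n) (b - n - 1) n f x)"
    by (simp only: m_def t_def left_diff_distrib sum_subtractf)
  then show "E (mon_sum a b c f) x = - (\<Sum>n\<le>min a b.
    ((- of_nat b + of_nat n) * (\<mu> - of_nat b + 1 + of_nat n) * c n - of_nat (Suc n) * c (Suc n))
    * mon (a - n) (b - n - 1) n f x)"
    by (metis minus_minus)
qed

end

section \<open>Symmetrization\<close>

text \<open>Prepares induction on word length. Every permutation of n + 1 positions is a
  transposition of n and b after a permutation fixing n; it puts the letter \<open>ys ! b\<close>
  last. The remaining letters are \<open>zs\<close>, where position b has been overwritten by the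
  last letter.\<close>

lemma permute_list_transpose_comp:
  assumes q: "q permutes {..<n}" and b: "b \<le> n" and len: "length ys = Suc n"
  defines "zs \<equiv> (if b = n then butlast ys else (butlast ys)[b := last ys])"
  shows "permute_list (Transposition.transpose n b \<circ> q) ys = permute_list q zs @ [ys ! b]"
    and "length zs = n" and "mset ys = add_mset (ys ! b) (mset zs)"
proof -
  show lz: "length zs = n"
    using len by (simp add: zs_def)
  have "ys \<noteq> []" using len by auto
  then have ys: "ys = butlast ys @ [last ys]" by simp
  have last: "last ys = ys ! n"
    using len \<open>ys \<noteq> []\<close> by (simp add: last_conv_nth)
  show "permute_list (Transposition.transpose n b \<circ> q) ys = permute_list q zs @ [ys ! b]"
  proof (rule nth_equalityI)
    show "length (permute_list (Transposition.transpose n b \<circ> q) ys) = length (permute_list q zs @ [ys ! b])"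
      by (simp add: lz len)
    fix i assume "i < length (permute_list (Transposition.transpose n b \<circ> q) ys)"
    then have i: "i < Suc n" by (simp add: len)
    have L: "permute_list (Transposition.transpose n b \<circ> q) ys ! i = ys ! Transposition.transpose n b (q i)"
      using i len by (simp add: permute_list_def del: upt_Suc)
    show "permute_list (Transposition.transpose n b \<circ> q) ys ! i = (permute_list q zs @ [ys ! b]) ! i"
    proof (cases "i = n")
      case True
      have "q n = n" using permutes_not_in[OF q] by simp
      then show ?thesis using True L lz by (simp add: nth_append)
    next
      case False
      then have i: "i < n" using i by simp
      then have qi: "q i < n" using permutes_in_image[OF q, of i] by simp
      have "permute_list q zs ! i = zs ! q i"
        using i lz by (simp add: permute_list_def)
      also have "\<dots> = ys ! Transposition.transpose n b (q i)"
        using qi b len by (auto simp: zs_def nth_list_update nth_butlast last Transposition.transpose_def)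
      finally show ?thesis using L i lz by (simp add: nth_append)
    qed
  qed
  show "mset ys = add_mset (ys ! b) (mset zs)"
  proof (cases "b = n")
    case True
    have "mset ys = mset (butlast ys @ [last ys])" using ys by simp
    then show ?thesis using True last by (simp add: zs_def)
  next
    case False
    with b have "b < length (butlast ys)" using len by simp
    then have "mset ((butlast ys)[b := last ys]) = add_mset (last ys) (mset (butlast ys) - {#butlast ys ! b#})"
      and "butlast ys ! b \<in># mset (butlast ys)"
      by (auto simp: mset_update)
    moreover have "mset ys = add_mset (last ys) (mset (butlast ys))"
      using arg_cong[OF ys, of mset] by simp
    moreover have "butlast ys ! b = ys ! b"
      using \<open>b < length (butlast ys)\<close> by (simp add: nth_butlast)
    ultimately show ?thesis using False
      by (simp add: zs_def)
  qed
qed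

text \<open>Summation by letter instead of by position. With \<open>g\<close> constantly 1 it
  expresses the length through the three counts.\<close>

lemma sum_tags:
  fixes g :: "nat \<Rightarrow> complex"
  assumes "set ys \<subseteq> {0, 1, 2}"
  shows "(\<Sum>b<length ys. g (ys ! b)) =
    of_nat (count (mset ys) 0) * g 0 + of_nat (count (mset ys) 1) * g 1 + of_nat (count (mset ys) 2) * g 2"
proof -
  have "(\<Sum>b<length ys. g (ys ! b)) = sum_list (map g ys)"
    by (simp add: sum_list_sum_nth atLeast0LessThan)
  also have "\<dots> = of_nat (count (mset ys) 0) * g 0 + of_nat (count (mset ys) 1) * g 1 + of_nat (count (mset ys) 2) * g 2"
    using assms by (induction ys) (auto simp: algebra_simps)
  finally show ?thesis .
qed

context heisenberg
begin

text \<open>Words are lists of tags and not of operators, so that letters can be counted even if two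
  of the operators should coincide.\<close>

definition tag_op :: "nat \<Rightarrow> ('a \<Rightarrow> complex) \<Rightarrow> 'a \<Rightarrow> complex" where
  "tag_op t = (if t = 0 then X else if t = 1 then Y else Z)"

lemma foldr_comp_snoc: "foldr (\<circ>) (l @ [h]) id = foldr (\<circ>) l h"
  by simp

text \<open>Grouping the permutations by the letter that ends up last, hence acts first, reproduces
  \<open>sym_mon_rec\<close>; the induction generalizes over \<open>f\<close> because that letter is
  absorbed into the argument.\<close>

lemma sum_permuted_words:
  assumes "set ys \<subseteq> {0, 1, 2}" "f \<in> V"
  shows "(\<Sum>\<tau> | \<tau> permutes {..<length ys}. foldr (\<circ>) (permute_list \<tau> (map tag_op ys)) id f x) =
    fact (length ys) * sym_mon (count (mset ys) 0) (count (mset ys) 1) (count (mset ys) 2) f x"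
  using assms
proof (induction "length ys" arbitrary: ys f)
  case 0
  then show ?case
    by (simp add: permutes_empty sym_mon_def weyl_def mon_def)
next
  case (Suc n)
  define c0 c1 c2 where "c0 = count (mset ys) 0" "c1 = count (mset ys) 1" "c2 = count (mset ys) 2"
  define g where "g t = (if t = 0 then sym_mon (c0 - 1) c1 c2 (X f) x
    else if t = 1 then sym_mon c0 (c1 - 1) c2 (Y f) x else sym_mon c0 c1 (c2 - 1) (Z f) x)" for t :: nat
  have len: "length ys = Suc n" using Suc.hyps(2) by simp
  have c: "c0 + c1 + c2 = Suc n"
    using Suc.prems(1) len unfolding c0_c1_c2_def
  proof -
    have "(\<Sum>b<length ys. (\<lambda>_. 1 :: complex) (ys ! b)) = of_nat c0 * 1 + of_nat c1 * 1 + of_nat c2 * 1"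
      unfolding c0_c1_c2_def by (rule sum_tags[OF Suc.prems(1)])
    then have "of_nat (length ys) = (of_nat (c0 + c1 + c2) :: complex)" by simp
    then show "count (mset ys) 0 + count (mset ys) 1 + count (mset ys) 2 = Suc n"
      unfolding of_nat_eq_iff using len c0_c1_c2_def by simp
  qed
  have step: "(\<Sum>q | q permutes {..<n}. foldr (\<circ>) (permute_list (Transposition.transpose n b \<circ> q) (map tag_op ys)) id f x) =
      fact n * g (ys ! b)" if b: "b < Suc n" for b
  proof -
    define zs where "zs = (if b = n then butlast ys else (butlast ys)[b := last ys])"
    have lz: "length zs = n" and mz: "mset ys = add_mset (ys ! b) (mset zs)"
      using permute_list_transpose_comp(2,3)[OF permutes_id _ len, of b] b unfolding zs_def by auto
    have sz: "set zs \<subseteq> {0, 1, 2}" and tb: "ys ! b \<in> {0, 1, 2}"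
      using Suc.prems(1) arg_cong[OF mz, of set_mset] by auto
    have "tag_op (ys ! b) f \<in> V"
      using Suc.prems(2) by (auto simp: tag_op_def)
    note IH = Suc.hyps(1)[of zs "tag_op (ys ! b) f", OF lz[symmetric] sz this]
    have "foldr (\<circ>) (permute_list (Transposition.transpose n b \<circ> q) (map tag_op ys)) id f =
        foldr (\<circ>) (permute_list q (map tag_op zs)) id (tag_op (ys ! b) f)" if q: "q permutes {..<n}" for q
    proof -
      have "Transposition.transpose n b \<circ> q permutes {..<length ys}"
        unfolding len lessThan_Suc using b
        by (intro permutes_compose permutes_swap_id permutes_subset[OF q]) auto
      then have "permute_list (Transposition.transpose n b \<circ> q) (map tag_op ys) = map tag_op (permute_list (Transposition.transpose n b \<circ> q) ys)"
        by (rule permute_list_map)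
      also have "\<dots> = map tag_op (permute_list q zs) @ [tag_op (ys ! b)]"
        using permute_list_transpose_comp(1)[OF q _ len, of b] b unfolding zs_def by simp
      also have "map tag_op (permute_list q zs) = permute_list q (map tag_op zs)"
        using q lz by (intro permute_list_map[symmetric]) simp
      finally have "foldr (\<circ>) (permute_list (Transposition.transpose n b \<circ> q) (map tag_op ys)) id =
          foldr (\<circ>) (permute_list q (map tag_op zs)) (tag_op (ys ! b))"
        by (simp only: foldr_comp_snoc)
      moreover have "foldr (\<circ>) l h = foldr (\<circ>) l id \<circ> h" for l and h :: "('a \<Rightarrow> complex) \<Rightarrow> 'a \<Rightarrow> complex"
        by (induction l) (auto simp: comp_assoc)
      ultimately show ?thesis
        by (metis comp_apply)
    qed
    then have "(\<Sum>q | q permutes {..<n}. foldr (\<circ>) (permute_list (Transposition.transpose n b \<circ> q) (map tag_op ys)) id f x) =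
        fact n * sym_mon (count (mset zs) 0) (count (mset zs) 1) (count (mset zs) 2) (tag_op (ys ! b) f) x"
      using IH unfolding lz by simp
    also have "sym_mon (count (mset zs) 0) (count (mset zs) 1) (count (mset zs) 2) (tag_op (ys ! b) f) x = g (ys ! b)"
      using tb unfolding g_def c0_c1_c2_def mz by (auto simp: tag_op_def)
    finally show ?thesis .
  qed
  have "(\<Sum>\<tau> | \<tau> permutes {..<length ys}. foldr (\<circ>) (permute_list \<tau> (map tag_op ys)) id f x) =
     (\<Sum>b<Suc n. \<Sum>q | q permutes {..<n}. foldr (\<circ>) (permute_list (Transposition.transpose n b \<circ> q) (map tag_op ys)) id f x)"
    unfolding len lessThan_Suc by (rule sum_over_permutations_insert) auto
  also have "\<dots> = fact n * (\<Sum>b<length ys. g (ys ! b))"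
    by (simp only: len sum_distrib_left) (intro sum.cong refl step, simp)
  also have "(\<Sum>b<length ys. g (ys ! b)) = of_nat c0 * g 0 + of_nat c1 * g 1 + of_nat c2 * g 2"
    unfolding c0_c1_c2_def by (rule sum_tags[OF Suc.prems(1)])
  also have "\<dots> = of_nat (c0 + c1 + c2) * sym_mon c0 c1 c2 f x"
    unfolding sym_mon_rec[OF Suc.prems(2)] by (simp add: g_def)
  finally show ?case
    unfolding c len c0_c1_c2_def[symmetric] by (simp only: fact_Suc mult.assoc mult.left_commute)
qed

end

section \<open>Cayley continuants and the hypergeometric coefficients\<close>

text \<open>Both series solve the linear equation U y' = W y, so the quotient F / G has derivative
  0; the factor G U can be cancelled in an integral domain.\<close>

lemma fps_ODE_unique:
  fixes F G :: "complex fps"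
  assumes F: "fps_deriv F * U = W * F" and G: "fps_deriv G * U = W * G"
    and nz: "fps_nth F 0 = 1" "fps_nth G 0 = 1" "fps_nth U 0 \<noteq> 0"
  shows "F = G"
proof -
  define Q where "Q = F * inverse G"
  have GQ: "F = G * Q"
    using nz by (simp add: Q_def mult.left_commute inverse_mult_eq_1')
  have "(fps_deriv G * Q + G * fps_deriv Q) * U = W * G * Q"
    using F unfolding GQ by (simp add: algebra_simps)
  then have "G * U * fps_deriv Q = W * G * Q - (fps_deriv G * U) * Q"
    by (simp add: algebra_simps)
  then have "G * U * fps_deriv Q = 0"
    unfolding G by simp
  moreover have "fps_nth (G * U) 0 \<noteq> 0"
    using nz by simp
  ultimately have "fps_deriv Q = 0"
    by (metis fps_zero_nth mult_eq_0_iff)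
  then have "Q = fps_const (fps_nth Q 0)"
    by (metis fps_deriv_eq_0_iff)
  moreover have "fps_nth Q 0 = 1"
    using nz by (simp add: Q_def)
  ultimately show ?thesis
    using GQ by simp
qed

lemma fps_binomial_compose_ODE:
  fixes c :: complex
  assumes "fps_nth u 0 = 0"
  shows "fps_deriv (fps_binomial c oo u) * (1 + u) = fps_const c * fps_deriv u * (fps_binomial c oo u)"
proof -
  have "fps_deriv (fps_binomial c) * (1 + fps_X) = fps_const c * fps_binomial c"
    using fps_binomial_ODE_unique[of "fps_binomial c" c]
    by (simp add: fps_divide_unit mult.assoc inverse_mult_eq_1)
  then have "(fps_deriv (fps_binomial c) * (1 + fps_X)) oo u = (fps_const c * fps_binomial c) oo u"
    by simp
  then have "(fps_deriv (fps_binomial c) oo u) * (1 + u) = fps_const c * (fps_binomial c oo u)"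
    by (simp add: fps_compose_mult_distrib[OF assms] fps_compose_add_distrib assms)
  then show ?thesis
    using fps_compose_deriv[OF assms, of "fps_binomial c"] by (simp add: algebra_simps)
qed

text \<open>The law (1 + u)^c (1 + v)^c = ((1 + u)(1 + v))^c for a complex exponent, as formal
  series: both sides solve the same linear equation with value 1 at 0.\<close>

lemma fps_binomial_compose_mult:
  fixes c :: complex
  assumes u: "fps_nth u 0 = 0" and v: "fps_nth v 0 = 0"
  shows "(fps_binomial c oo u) * (fps_binomial c oo v) = fps_binomial c oo (u + v + u * v)"
proof (rule fps_ODE_unique)
  let ?P = "fps_binomial c oo u" and ?Q = "fps_binomial c oo v"
  have w: "1 + (u + v + u * v) = (1 + u) * (1 + v)"
    by (simp add: algebra_simps)
  have "fps_deriv (?P * ?Q) * (1 + (u + v + u * v)) =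
      ?P * (1 + u) * (fps_deriv ?Q * (1 + v)) + (fps_deriv ?P * (1 + u)) * ?Q * (1 + v)"
    unfolding w by (simp add: algebra_simps)
  also have "\<dots> = fps_const c * fps_deriv (u + v + u * v) * (?P * ?Q)"
    unfolding fps_binomial_compose_ODE[OF u] fps_binomial_compose_ODE[OF v]
    by (simp add: algebra_simps)
  finally show "fps_deriv (?P * ?Q) * (1 + (u + v + u * v)) =
      fps_const c * fps_deriv (u + v + u * v) * (?P * ?Q)" .
  show "fps_deriv (fps_binomial c oo (u + v + u * v)) * (1 + (u + v + u * v)) =
      fps_const c * fps_deriv (u + v + u * v) * (fps_binomial c oo (u + v + u * v))"
    using u v by (intro fps_binomial_compose_ODE) simp
qed (use u v in auto)

lemma pochhammer_minus_of_nat: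
  assumes "n \<le> b"
  shows "pochhammer (- of_nat b :: complex) n = (- 1) ^ n * fact b / fact (b - n)"
proof -
  have "of_nat (b choose n) = (- 1) ^ n * pochhammer (- of_nat b :: complex) n / fact n"
    unfolding binomial_gbinomial gbinomial_pochhammer ..
  moreover have "of_nat (b choose n) = (fact b / (fact n * fact (b - n)) :: complex)"
    by (rule binomial_fact[OF assms])
  ultimately have "(- 1) ^ n * ((- 1) ^ n * pochhammer (- of_nat b :: complex) n) = (- 1) ^ n * (fact b / fact (b - n))"
    by (simp add: field_simps)
  then show ?thesis
    by (simp add: power_mult_distrib[symmetric] flip: mult.assoc)
qed

text \<open>Substituting \<open>t / (1 + t)\<close> for \<open>t\<close> turns \<open>(1 + t)\<^sup>\<beta> (1 - t)\<^sup>A (1 + t)\<^sup>B\<close> with \<open>A + B = \<beta>\<close> into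
  \<open>(1 + 2 t)\<^sup>B\<close>.\<close>

lemma Cay_convolution:
  assumes "M \<le> \<beta>"
  shows "(\<Sum>n\<le>M. (- 1) ^ n * (Cay n a (of_nat \<beta>) / fact n) * of_nat ((\<beta> - n) choose (M - n))) =
    2 ^ M * ((of_nat \<beta> - a) / 2 gchoose M)"
proof -
  define A B where AB: "A = (of_nat \<beta> + a) / 2" "B = (of_nat \<beta> - a) / 2"
  have sum: "A + B = of_nat \<beta>"
    by (simp add: AB field_simps)
  \<comment> \<open>The generating function of the Cayley continuants at -t, which accounts for the
    alternating signs in the sum.\<close>
  define H where "H = (fps_binomial A oo - fps_X) * fps_binomial B"
  define w where "w = fps_X * inverse (1 + fps_X :: complex fps)"
  have inv: "(1 + fps_X) * inverse (1 + fps_X :: complex fps) = 1"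
    by (rule inverse_mult_eq_1') simp
  have w: "(1 + fps_X) * w = fps_X"
    unfolding w_def using inv by (simp add: mult.left_commute)
  have w0: "fps_nth w 0 = 0" "fps_nth (- w) 0 = 0"
    by (simp_all add: w_def)
  have Hn: "fps_nth H n = (- 1) ^ n * (Cay n a (of_nat \<beta>) / fact n)" for n
  proof -
    have "fps_binomial A * (fps_binomial B oo - fps_X) = H oo - fps_X"
      unfolding H_def
      by (subst fps_compose_mult_distrib) (simp_all add: fps_compose_uminus' fps_binomial_def fps_eq_iff flip: mult.assoc power_mult_distrib)
    then have "Cay n a (of_nat \<beta>) / fact n = fps_nth (H oo - fps_X) n"
      by (simp add: Cay_def AB)
    then show ?thesis
      by (simp add: fps_compose_uminus' flip: mult.assoc power_mult_distrib)
  qed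
  define K where "K = (1 + fps_X) ^ \<beta> * (H oo w)"
  have "K = (fps_binomial A * fps_binomial B) * ((fps_binomial A oo - w) * (fps_binomial B oo w))"
  proof -
    have "H oo w = ((fps_binomial A oo - fps_X) oo w) * (fps_binomial B oo w)"
      unfolding H_def by (rule fps_compose_mult_distrib[OF w0(1)])
    also have "(fps_binomial A oo - fps_X) oo w = fps_binomial A oo (- fps_X oo w)"
      by (rule fps_compose_assoc[symmetric]) (simp_all add: w0)
    also have "- fps_X oo w = - w"
      by (simp add: fps_compose_uminus w0)
    finally show ?thesis
      unfolding K_def fps_binomial_of_nat[symmetric] sum[symmetric] fps_binomial_add_mult by simp
  qed
  also have "\<dots> = ((fps_binomial A oo fps_X) * (fps_binomial A oo - w)) *
      ((fps_binomial B oo fps_X) * (fps_binomial B oo w))"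
    by (simp add: mult_ac)
  also have "(fps_binomial A oo fps_X) * (fps_binomial A oo - w) = fps_binomial A oo (fps_X - (1 + fps_X) * w)"
    by (subst fps_binomial_compose_mult) (simp_all add: w0 algebra_simps)
  also have "\<dots> = 1"
    by (simp add: w)
  also have "(fps_binomial B oo fps_X) * (fps_binomial B oo w) = fps_binomial B oo (fps_X + (1 + fps_X) * w)"
    by (subst fps_binomial_compose_mult) (simp_all add: w0 algebra_simps)
  also have "fps_X + (1 + fps_X) * w = fps_const 2 * fps_X"
    unfolding w numeral_fps_const[symmetric] by (rule mult_2[symmetric])
  finally have "fps_nth K M = 2 ^ M * (B gchoose M)"
    by simp
  moreover have "fps_nth K M = (\<Sum>n\<le>M. fps_nth H n * of_nat ((\<beta> - n) choose (M - n)))"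
  proof -
    have "fps_nth (H oo w) k = (\<Sum>i\<le>M. fps_nth H i * fps_nth (w ^ i) k)" if "k \<le> M" for k
      unfolding fps_compose_nth atLeast0AtMost
      by (rule sum.mono_neutral_left)
         (use that startsby_zero_power_prefix[OF w0(1)] in \<open>auto\<close>)
    then have "fps_nth K M = (\<Sum>j\<le>M. fps_nth ((1 + fps_X) ^ \<beta>) j * (\<Sum>i\<le>M. fps_nth H i * fps_nth (w ^ i) (M - j)))"
      unfolding K_def by (simp add: fps_mult_nth atLeast0AtMost)
    also have "\<dots> = (\<Sum>i\<le>M. fps_nth H i * (\<Sum>j\<le>M. fps_nth ((1 + fps_X) ^ \<beta>) j * fps_nth (w ^ i) (M - j)))"
      unfolding sum_distrib_left by (subst sum.swap) (simp add: mult.left_commute)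
    also have "\<dots> = (\<Sum>i\<le>M. fps_nth H i * fps_nth ((1 + fps_X) ^ \<beta> * w ^ i) M)"
      by (simp add: fps_mult_nth atLeast0AtMost)
    also have "\<dots> = (\<Sum>i\<le>M. fps_nth H i * of_nat ((\<beta> - i) choose (M - i)))"
    proof (rule sum.cong[OF refl])
      fix i assume "i \<in> {..M}"
      then have i: "i \<le> M" "i \<le> \<beta>" using assms by auto
      \<comment> \<open>With w = t / (1 + t) and i <= \<beta> the powers combine to (1 + t)^(\<beta>
        - i) t^i; its coefficients are the binomials of the claim.\<close>
      have "(1 + fps_X) ^ \<beta> * w ^ i = (1 + fps_X) ^ (\<beta> - i) * ((1 + fps_X) * w) ^ i"
        using i by (simp add: power_mult_distrib flip: power_add mult.assoc)
      also have "\<dots> = fps_binomial (of_nat (\<beta> - i)) * fps_X ^ i"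
        unfolding w fps_binomial_of_nat ..
      finally show "fps_nth H i * fps_nth ((1 + fps_X) ^ \<beta> * w ^ i) M =
          fps_nth H i * of_nat ((\<beta> - i) choose (M - i))"
        using i by (simp add: fps_X_power_mult_right_nth binomial_gbinomial)
    qed
    finally show ?thesis .
  qed
  ultimately show ?thesis
    unfolding Hn AB by simp
qed

text \<open>The left side is the coefficient of the \<open>M\<close>-th ordered monomial after Weyl
  ordering all symmetrized terms. The factorials depending on the summation index cancel between
  \<open>pochhammer\<close> and \<open>weyl\<close>, and \<open>Cay_convolution\<close> evaluates
  the rest.\<close>

lemma p_poly_weyl:
  assumes "M \<le> \<beta>1" "M \<le> \<beta>2"
  shows "(\<Sum>n\<le>M. fps_nth (p_poly \<beta>1 \<beta>2 a) n * weyl (\<beta>1 - n) (\<beta>2 - n) (M - n)) =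
    fps_nth (hyp2F0 (- of_nat \<beta>1) (- ((of_nat \<beta>2 - a) / 2))) M"
proof -
  have "fps_nth (p_poly \<beta>1 \<beta>2 a) n * weyl (\<beta>1 - n) (\<beta>2 - n) (M - n) =
      fact \<beta>1 / (fact (\<beta>1 - M) * 2 ^ M) *
      ((- 1) ^ n * (Cay n a (of_nat \<beta>2) / fact n) * of_nat ((\<beta>2 - n) choose (M - n)))" if "n \<le> M" for n
  proof -
    have 1: "pochhammer (- of_nat \<beta>1 :: complex) n = (- 1) ^ n * fact \<beta>1 / fact (\<beta>1 - n)"
      using that assms by (intro pochhammer_minus_of_nat) simp
    have "\<beta>1 - n - (M - n) = \<beta>1 - M"
      using that by simp
    then have 2: "of_nat ((\<beta>1 - n) choose (M - n)) = (fact (\<beta>1 - n) / (fact (M - n) * fact (\<beta>1 - M)) :: complex)"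
      using that assms by (subst binomial_fact) simp_all
    have 3: "(2 :: complex) ^ M = 2 ^ n * 2 ^ (M - n)"
      using that by (simp flip: power_add)
    have "fps_nth (p_poly \<beta>1 \<beta>2 a) n = pochhammer (- of_nat \<beta>1) n / (2 ^ n * fact n) * Cay n a (of_nat \<beta>2)"
      using that assms by (simp add: p_poly_def)
    then show ?thesis
      unfolding weyl_def 1 2 3 by (simp add: field_simps)
  qed
  then have "(\<Sum>n\<le>M. fps_nth (p_poly \<beta>1 \<beta>2 a) n * weyl (\<beta>1 - n) (\<beta>2 - n) (M - n)) =
      fact \<beta>1 / (fact (\<beta>1 - M) * 2 ^ M) *
      (\<Sum>n\<le>M. (- 1) ^ n * (Cay n a (of_nat \<beta>2) / fact n) * of_nat ((\<beta>2 - n) choose (M - n)))"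
    by (simp add: sum_distrib_left)
  also have "\<dots> = fact \<beta>1 / fact (\<beta>1 - M) * ((of_nat \<beta>2 - a) / 2 gchoose M)"
    unfolding Cay_convolution[OF assms(2)] by simp
  also have "\<dots> = fps_nth (hyp2F0 (- of_nat \<beta>1) (- ((of_nat \<beta>2 - a) / 2))) M"
    unfolding gbinomial_pochhammer hyp2F0_def
    by (simp add: pochhammer_minus_of_nat[OF assms(1)])
  finally show ?thesis .
qed

section \<open>The operators on the Heisenberg group\<close>

lemma Csmooth_UNIV: "f \<in> Csmooth UNIV \<longleftrightarrow> smooth_on UNIV f"
  by (simp add: Csmooth_def)

definition d1_field :: "real^3 \<Rightarrow> real^3" where
  "d1_field x = axis 1 1 + (x$2 / 2) *\<^sub>R axis 3 1"

definition d2_field :: "real^3 \<Rightarrow> real^3" where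
  "d2_field x = axis 2 1 - (x$1 / 2) *\<^sub>R axis 3 1"

lemma has_derivative_d1_field: "(d1_field has_derivative (\<lambda>v. (v$2 / 2) *\<^sub>R axis 3 1)) (at x)"
  unfolding d1_field_def[abs_def]
  by (auto intro!: derivative_eq_intros bounded_linear.has_derivative[OF bounded_linear_vec_nth])

lemma has_derivative_d2_field: "(d2_field has_derivative (\<lambda>v. - ((v$1 / 2) *\<^sub>R axis 3 1))) (at x)"
  unfolding d2_field_def[abs_def]
  by (auto intro!: derivative_eq_intros bounded_linear.has_derivative[OF bounded_linear_vec_nth])

lemma partial_vfield: "partial j F = vfield UNIV (\<lambda>_. axis j 1) F"
  by (simp add: partial_def vfield_def dderiv_def)

lemma D1_vfield:
  assumes "F \<in> Csmooth UNIV"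
  shows "D1 F = vfield UNIV d1_field F"
proof -
  have l: "linear (\<lambda>v. dderiv v F x)" for x
    by (rule linear_dderiv[OF Csmooth_differentiable[OF assms UNIV_I]])
  show ?thesis
    by (simp add: D1_def d1_field_def vfield_def partial_def fun_eq_iff
        linear_add[OF l] linear_scale[OF l] scaleR_conv_of_real[where 'a = complex])
qed

lemma D2_vfield:
  assumes "F \<in> Csmooth UNIV"
  shows "D2 F = vfield UNIV d2_field F"
proof -
  have l: "linear (\<lambda>v. dderiv v F x)" for x
    by (rule linear_dderiv[OF Csmooth_differentiable[OF assms UNIV_I]])
  show ?thesis
    by (simp add: D2_def d2_field_def vfield_def partial_def fun_eq_iff
        linear_diff[OF l] linear_scale[OF l] scaleR_conv_of_real[where 'a = complex])
qed

lemma D3_vfield: "D3 F = vfield UNIV (\<lambda>_. axis 3 1) F"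
  by (simp add: D3_def partial_vfield)

lemma (in function_space) linear_op_on_cong:
  assumes "linear_op_on V X" "\<And>f. f \<in> V \<Longrightarrow> Y f = X f"
  shows "linear_op_on V Y"
  unfolding linear_op_on_def using assms by (simp add: op_mem op_add op_cmult)

text \<open>The bracket of the two fields is the constant field e_3, one half coming from each.
  \<open>D1\<close> and \<open>D2\<close> agree with \<open>vfield\<close> operators on smooth
  functions only, hence the congruence for their linearity.\<close>

interpretation DH: heisenberg "Csmooth UNIV" D1 D2 D3
proof -
  interpret function_space "Csmooth (UNIV :: (real^3) set)"
    by (rule function_space_Csmooth) simp
  have lin: "linear_op_on (Csmooth UNIV) (vfield UNIV d1_field)"
    "linear_op_on (Csmooth UNIV) (vfield UNIV d2_field)"
    "linear_op_on (Csmooth UNIV) D3"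
    using linear_op_on_vfield[OF open_UNIV has_derivative_d1_field]
      linear_op_on_vfield[OF open_UNIV has_derivative_d2_field]
      linear_op_on_vfield[OF open_UNIV has_derivative_const[of "axis 3 1 :: real^3"]]
    by (simp_all add: D3_vfield[abs_def])
  show "heisenberg (Csmooth UNIV) D1 D2 D3"
  proof
    show "linear_op_on (Csmooth UNIV) D1"
      by (rule linear_op_on_cong[OF lin(1) D1_vfield])
    show "linear_op_on (Csmooth UNIV) D2"
      by (rule linear_op_on_cong[OF lin(2) D2_vfield])
    show "linear_op_on (Csmooth UNIV) D3"
      by (rule lin(3))
    fix f :: "real^3 \<Rightarrow> complex" assume f: "f \<in> Csmooth UNIV"
    have m: "vfield UNIV d1_field f \<in> Csmooth UNIV" "vfield UNIV d2_field f \<in> Csmooth UNIV" "D3 f \<in> Csmooth UNIV"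
      using f lin op_mem by auto
    have c: "vfield UNIV a (vfield UNIV b f) = (\<lambda>x. vfield UNIV b (vfield UNIV a f) x + dderiv v f x)"
      if "\<And>x. (a has_derivative A) (at x)" "\<And>x. (b has_derivative B) (at x)" "\<And>x. B (a x) - A (b x) = v"
      for a b A B v
      by (rule vfield_commutator[OF open_UNIV that(1,2) f, THEN trans]) (simp add: vfield_def[of _ _ f] that(3))
    show "D2 (D1 f) = (\<lambda>x. D1 (D2 f) x + D3 f x)"
      unfolding D1_vfield[OF f] D2_vfield[OF f] D1_vfield[OF m(2)] D2_vfield[OF m(1)] D3_def partial_def
      by (rule c[OF has_derivative_d2_field has_derivative_d1_field])
         (simp add: d1_field_def d2_field_def axis_def flip: scaleR_add_left)
    have z: "dderiv 0 f x = 0" for x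
      using linear_0[OF linear_dderiv[OF Csmooth_differentiable[OF f]]] by simp
    show "D3 (D1 f) = D1 (D3 f)"
      unfolding D1_vfield[OF f] D1_vfield[OF m(3)] unfolding D3_vfield
      by (rule c[where v = 0, OF has_derivative_const has_derivative_d1_field, THEN trans])
         (simp_all add: axis_def z)
    show "D3 (D2 f) = D2 (D3 f)"
      unfolding D2_vfield[OF f] D2_vfield[OF m(3)] unfolding D3_vfield
      by (rule c[where v = 0, OF has_derivative_const has_derivative_d2_field, THEN trans])
         (simp_all add: axis_def z)
  qed
qed

lemma sym_op_sym_mon:
  assumes F: "F \<in> Csmooth UNIV"
  shows "sym_op (replicate p D1 @ replicate q D2 @ replicate r D3) F x = DH.sym_mon p q r F x"
proof -
  define ys :: "nat list" where "ys = replicate p 0 @ replicate q 1 @ replicate r 2"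
  have m: "map DH.tag_op ys = replicate p D1 @ replicate q D2 @ replicate r D3"
    by (simp add: ys_def DH.tag_op_def)
  have "set ys \<subseteq> {0, 1, 2}" "count (mset ys) 0 = p" "count (mset ys) 1 = q" "count (mset ys) 2 = r"
    by (auto simp: ys_def)
  with DH.sum_permuted_words[of ys F x, OF _ F] show ?thesis
    unfolding sym_op_def m[symmetric] length_map by (simp del: map_append)
qed

text \<open>Weyl ordering the n-th symmetrized term with k contractions gives the ordered monomial
  of index M = n + k; the double sum is collected by M.\<close>

lemma T_sym_eq_T_ord:
  assumes F: "F \<in> Csmooth UNIV"
    and coeff: "\<And>M. M \<le> min a b \<Longrightarrow> (\<Sum>n\<le>M. fps_nth p n * weyl (a - n) (b - n) (M - n)) = fps_nth h M"
  shows "T_sym (a, b) p F = T_ord (a, b) h F"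
proof
  fix x
  define m where "m = min a b"
  have "T_sym (a, b) p F x = (\<Sum>n\<le>m. \<Sum>k\<le>m - n. fps_nth p n * weyl (a - n) (b - n) k * DH.mon (a - n - k) (b - n - k) (n + k) F x)"
    unfolding T_sym_def sym_op_sym_mon[OF F] m_def fst_conv snd_conv
  proof (rule sum.cong[OF refl])
    fix n
    show "fps_nth p n * DH.sym_mon (a - n) (b - n) n F x = (\<Sum>k\<le>min a b - n. fps_nth p n *
        weyl (a - n) (b - n) k * DH.mon (a - n - k) (b - n - k) (n + k) F x)"
      by (subst DH.sym_mon_alt[where N = "min a b - n"]) (auto simp: sum_distrib_left mult.assoc)
  qed
  also have "\<dots> = (\<Sum>n\<le>m. \<Sum>M=n..m. fps_nth p n * weyl (a - n) (b - n) (M - n) * DH.mon (a - M) (b - M) M F x)"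
  proof (rule sum.cong[OF refl])
    fix n assume "n \<in> {..m}"
    then show "(\<Sum>k\<le>m - n. fps_nth p n * weyl (a - n) (b - n) k * DH.mon (a - n - k) (b - n - k) (n + k) F x) =
       (\<Sum>M=n..m. fps_nth p n * weyl (a - n) (b - n) (M - n) * DH.mon (a - M) (b - M) M F x)"
      by (intro sum.reindex_bij_witness[of _ "\<lambda>M. M - n" "\<lambda>k. n + k"]) auto
  qed
  also have "\<dots> = (\<Sum>M\<le>m. \<Sum>n\<le>M. fps_nth p n * weyl (a - n) (b - n) (M - n) * DH.mon (a - M) (b - M) M F x)"
    unfolding sum.Sigma[OF finite_atMost ballI[OF finite_atLeastAtMost]] sum.Sigma[OF finite_atMost ballI[OF finite_atMost]]
    by (intro sum.reindex_bij_witness[of _ "\<lambda>(M, n). (n, M)" "\<lambda>(n, M). (M, n)"]) auto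
  also have "\<dots> = (\<Sum>M\<le>m. fps_nth h M * DH.mon (a - M) (b - M) M F x)"
    by (intro sum.cong refl) (simp add: coeff[symmetric] m_def sum_distrib_right)
  also have "\<dots> = T_ord (a, b) h F x"
    by (simp add: T_ord_def DH.mon_def m_def)
  finally show "T_sym (a, b) p F x = T_ord (a, b) h F x" .
qed

lemma T_ord_mon_sum: "T_ord (a, b) h F = DH.mon_sum a b (fps_nth h) F"
  by (simp add: T_ord_def DH.mon_sum_def DH.mon_def fun_eq_iff)

lemma weyl_commute: "weyl p q k = weyl q p k"
  by (simp add: weyl_def)

lemma nat_of_of_nat [simp]: "nat_of (of_nat n) = n"
  unfolding nat_of_def by (rule the_equality) auto

lemma DD_sym_eq_mon_sum:
  assumes F: "smooth_on UNIV F"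
    and i: "i = 1 \<longrightarrow> \<nu>$1 - lam$1 = of_nat a \<and> \<nu>$1 + \<nu>$2 - lam$1 - lam$2 = of_nat b"
      "i \<noteq> 1 \<longrightarrow> lam$2 + lam$3 - \<nu>$1 - \<nu>$2 = of_nat a \<and> lam$3 - \<nu>$2 = of_nat b"
  shows "DD_sym i lam \<nu> F = DD_ord i lam \<nu> F"
    and "DD_ord i lam \<nu> F = Rest i (DH.mon_sum a b (fps_nth
      (if i = 1 then hyp2F0 (- of_nat a) (lam$1 - \<nu>$2 - 1) else hyp2F0 (- of_nat b) (\<nu>$2 - lam$2 + 1))) F)"
proof -
  have F': "F \<in> Csmooth UNIV"
    using F by (simp add: Csmooth_UNIV)
  show "DD_sym i lam \<nu> F = DD_ord i lam \<nu> F"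
  proof (cases "i = 1")
    case True
    then have e: "\<nu>$1 - lam$1 = of_nat a" "\<nu>$1 + \<nu>$2 - lam$1 - lam$2 = of_nat b"
      using i by auto
    \<comment> \<open>The parameter of the continuant is such that half its difference from
      \<open>b\<close> is \<open>\<nu>$2 - lam$1 + 1\<close>, the negative of the second
      hypergeometric parameter.\<close>
    have p: "lam$1 - \<nu>$1 = - of_nat a"
      "lam$1 - \<nu>$2 - 1 = - ((of_nat b - (lam$1 + \<nu>$1 - lam$2 - \<nu>$2 - 2)) / 2)"
      unfolding e[symmetric] by (simp_all add: field_simps)
    have "T_sym (a, b) (p_poly a b (lam$1 + \<nu>$1 - lam$2 - \<nu>$2 - 2)) F =
        T_ord (a, b) (hyp2F0 (lam$1 - \<nu>$1) (lam$1 - \<nu>$2 - 1)) F"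
      unfolding p by (intro T_sym_eq_T_ord F' p_poly_weyl) auto
    then show ?thesis
      using True unfolding DD_sym_def DD_ord_def e by simp
  next
    case False
    then have e: "lam$2 + lam$3 - \<nu>$1 - \<nu>$2 = of_nat a" "lam$3 - \<nu>$2 = of_nat b"
      using i by auto
    have p: "\<nu>$2 - lam$3 = - of_nat b"
      "\<nu>$2 - lam$2 + 1 = - ((of_nat a - (lam$3 + \<nu>$2 - lam$2 - \<nu>$1 + 2)) / 2)"
      unfolding e[symmetric] by (simp_all add: field_simps)
    have "T_sym (a, b) (p_poly b a (lam$3 + \<nu>$2 - lam$2 - \<nu>$1 + 2)) F =
        T_ord (a, b) (hyp2F0 (\<nu>$2 - lam$3) (\<nu>$2 - lam$2 + 1)) F"
      \<comment> \<open>For i = 2 the two degrees of \<open>p_poly\<close> are interchanged; the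
        symmetry of \<open>weyl\<close> absorbs this.\<close>
      unfolding p by (intro T_sym_eq_T_ord F', subst weyl_commute) (auto intro!: p_poly_weyl)
    then show ?thesis
      using False unfolding DD_sym_def DD_ord_def e by simp
  qed
  show "DD_ord i lam \<nu> F = Rest i (DH.mon_sum a b (fps_nth
      (if i = 1 then hyp2F0 (- of_nat a) (lam$1 - \<nu>$2 - 1) else hyp2F0 (- of_nat b) (\<nu>$2 - lam$2 + 1))) F)"
  proof (cases "i = 1")
    case True
    then have e: "\<nu>$1 - lam$1 = of_nat a" "\<nu>$1 + \<nu>$2 - lam$1 - lam$2 = of_nat b"
      using i by auto
    have "lam$1 - \<nu>$1 = - of_nat a"
      unfolding e[symmetric] by simp
    with True show ?thesis
      unfolding DD_ord_def e by (simp add: T_ord_mon_sum)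
  next
    case False
    then have e: "lam$2 + lam$3 - \<nu>$1 - \<nu>$2 = of_nat a" "lam$3 - \<nu>$2 = of_nat b"
      using i by auto
    have "\<nu>$2 - lam$3 = - of_nat b"
      unfolding e[symmetric] by simp
    with False show ?thesis
      unfolding DD_ord_def e by (simp add: T_ord_mon_sum Rest_def axis_pt_def)
  qed
qed

section \<open>Expansion of differential operators in a family\<close>

text \<open>The module over the smooth functions generated by \<open>B\<close>, with operators
  identified if they agree on smooth functions. Used both ways: partial derivatives in Heisenberg
  monomials for the classification, and monomials in partial derivatives to see that
  \<open>mon_sum\<close> is a differential operator.\<close>

inductive expands ::
  "('k \<Rightarrow> (real^3 \<Rightarrow> complex) \<Rightarrow> real^3 \<Rightarrow> complex) \<Rightarrow> ((real^3 \<Rightarrow> complex) \<Rightarrow> real^3 \<Rightarrow> complex) \<Rightarrow> bool"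
  for B where
  base: "expands B (B k)"
| add: "expands B D \<Longrightarrow> expands B D' \<Longrightarrow> expands B (\<lambda>F x. D F x + D' F x)"
| mult: "smooth_on UNIV a \<Longrightarrow> expands B D \<Longrightarrow> expands B (\<lambda>F x. a x * D F x)"
| cong: "expands B D \<Longrightarrow> (\<And>F. F \<in> Csmooth UNIV \<Longrightarrow> D' F = D F) \<Longrightarrow> expands B D'"

lemma expands_zero: "expands B (\<lambda>F x. 0)"
  using expands.mult[OF smooth_on_const[where c = 0] expands.base] by simp

lemma expands_sum:
  "finite I \<Longrightarrow> (\<And>i. i \<in> I \<Longrightarrow> expands B (D i)) \<Longrightarrow> expands B (\<lambda>F x. \<Sum>i\<in>I. D i F x)"
  by (induction I rule: finite_induct) (auto intro: expands_zero expands.add)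

lemma expands_finite_sum:
  assumes "expands B D"
  shows "\<exists>K a. finite K \<and> (\<forall>k. smooth_on UNIV (a k)) \<and>
    (\<forall>F\<in>Csmooth UNIV. \<forall>x. D F x = (\<Sum>k\<in>K. a k x * B k F x))"
  using assms
proof induction
  case (base k)
  show ?case
    by (rule exI[of _ "{k}"], rule exI[of _ "\<lambda>_ _. 1"]) simp
next
  case (add D D')
  from add.IH(1) obtain K a where K: "finite K" "\<And>k. smooth_on UNIV (a k)"
      "\<And>F x. F \<in> Csmooth UNIV \<Longrightarrow> D F x = (\<Sum>k\<in>K. a k x * B k F x)"
    by blast
  from add.IH(2) obtain K' a' where K': "finite K'" "\<And>k. smooth_on UNIV (a' k)"
      "\<And>F x. F \<in> Csmooth UNIV \<Longrightarrow> D' F x = (\<Sum>k\<in>K'. a' k x * B k F x)"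
    by blast
  \<comment> \<open>Each coefficient family is cut to 0 off its own index set, so that both sums can
    run over the union.\<close>
  define b where "b k x = (if k \<in> K then a k x else 0) + (if k \<in> K' then a' k x else 0)" for k x
  have "smooth_on UNIV (b k)" for k
    unfolding b_def[abs_def] using K(2)[of k] K'(2)[of k]
    by (cases "k \<in> K"; cases "k \<in> K'") (simp_all add: smooth_on_add)
  moreover have "D F x + D' F x = (\<Sum>k\<in>K \<union> K'. b k x * B k F x)" if "F \<in> Csmooth UNIV" for F x
  proof -
    have "(\<Sum>k\<in>K. a k x * B k F x) = (\<Sum>k\<in>K \<union> K'. (if k \<in> K then a k x else 0) * B k F x)"
      using K(1) K'(1) by (intro sum.mono_neutral_cong_left) auto
    moreover have "(\<Sum>k\<in>K'. a' k x * B k F x) = (\<Sum>k\<in>K \<union> K'. (if k \<in> K' then a' k x else 0) * B k F x)"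
      using K(1) K'(1) by (intro sum.mono_neutral_cong_left) auto
    ultimately show ?thesis
      using that by (simp only: K(3) K'(3) b_def distrib_right sum.distrib)
  qed
  ultimately show ?case
    using K(1) K'(1) by (intro exI[of _ "K \<union> K'"] exI[of _ b]) auto
next
  case (mult a D)
  then obtain K b where K: "finite K" "\<And>k. smooth_on UNIV (b k)"
      "\<And>F x. F \<in> Csmooth UNIV \<Longrightarrow> D F x = (\<Sum>k\<in>K. b k x * B k F x)"
    by blast
  then show ?case
    using mult.hyps(1)
    by (intro exI[of _ K] exI[of _ "\<lambda>k x. a x * b k x"])
       (auto intro!: smooth_on_mult simp: sum_distrib_left mult.assoc)
next
  case (cong D D')
  then show ?case by metis
qed

text \<open>The Leibniz rule reduces the claim to members of \<open>B\<close>. Preservation of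
  smoothness is carried along in the induction, because additivity and the product rule for
  \<open>\<delta>\<close> hold on smooth functions only.\<close>

lemma expands_derivation:
  fixes v :: "real^3 \<Rightarrow> real^3"
  assumes v: "\<And>x. (v has_derivative v') (at x)"
    and \<delta>: "\<And>F. F \<in> Csmooth UNIV \<Longrightarrow> \<delta> F = vfield UNIV v F"
    and B: "\<And>k F. F \<in> Csmooth UNIV \<Longrightarrow> B k F \<in> Csmooth UNIV"
    and \<delta>B: "\<And>k. expands B (\<lambda>F. \<delta> (B k F))"
    and D: "expands B D"
  shows "expands B (\<lambda>F. \<delta> (D F)) \<and> (\<forall>F\<in>Csmooth UNIV. D F \<in> Csmooth UNIV)"
  using D
proof induction
  case (base k)
  then show ?case using \<delta>B B by auto
next
  case (add D D')
  have "\<delta> (\<lambda>x. D F x + D' F x) = (\<lambda>x. \<delta> (D F) x + \<delta> (D' F) x)" if "F \<in> Csmooth UNIV" for F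
    using that add.IH by (simp add: \<delta> vfield_add Csmooth_add)
  with add.IH show ?case
    by (auto intro: expands.cong[OF expands.add] simp: Csmooth_add)
next
  case (mult a D)
  have a: "a \<in> Csmooth UNIV" using mult.hyps(1) by (simp add: Csmooth_UNIV)
  have da: "smooth_on UNIV (vfield UNIV v a)"
    using vfield_Csmooth[OF open_UNIV v a] by (simp add: Csmooth_UNIV)
  have eq: "\<delta> (\<lambda>x. a x * D F x) = (\<lambda>x. a x * \<delta> (D F) x + vfield UNIV v a x * D F x)" if "F \<in> Csmooth UNIV" for F
    using that mult.IH a by (simp add: \<delta> vfield_mult Csmooth_mult)
  have "expands B (\<lambda>F. \<delta> (\<lambda>x. a x * D F x))"
    by (rule expands.cong[OF expands.add[OF expands.mult[OF mult.hyps(1) conjunct1[OF mult.IH]]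
            expands.mult[OF da mult.hyps(2)]] eq])
  then show ?case
    using mult.IH a by (simp add: Csmooth_mult)
next
  case (cong D D')
  have "expands B (\<lambda>F. \<delta> (D' F))"
    by (rule expands.cong[OF conjunct1[OF cong.IH]]) (simp only: cong.hyps(2))
  with cong.IH cong.hyps(2) show ?case by metis
qed

lemma smooth_on_component: "smooth_on UNIV (\<lambda>x::real^3. complex_of_real (x$i / 2))"
proof -
  have "linear (\<lambda>x::real^3. complex_of_real (x$i / 2))"
    by (rule linearI) (simp_all add: add_divide_distrib scaleR_conv_of_real[where 'a = complex])
  then show ?thesis
    by (intro smooth_on_bounded_linear) (simp add: linear_conv_bounded_linear)
qed

lemma partial_mem: "F \<in> Csmooth UNIV \<Longrightarrow> partial j F \<in> Csmooth UNIV"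
  by (auto simp: Csmooth_UNIV partial_def intro: smooth_on_dderiv)

lemma foldr_partial_mem: "F \<in> Csmooth UNIV \<Longrightarrow> foldr partial js F \<in> Csmooth UNIV"
  by (induction js) (auto intro: partial_mem)

definition heis_mon :: "nat \<times> nat \<times> nat \<Rightarrow> (real^3 \<Rightarrow> complex) \<Rightarrow> real^3 \<Rightarrow> complex" where
  "heis_mon k = DH.mon (fst k) (fst (snd k)) (snd (snd k))"

text \<open>Solving for the partial derivatives: d_1 = \<open>D1\<close> - (x_2 / 2)
  \<open>D3\<close>, d_2 = \<open>D2\<close> + (x_1 / 2) \<open>D3\<close>, d_3 = \<open>D3\<close>;
  and each of the three operators sends monomials to combinations of monomials.\<close>

lemma expands_partial_heis_mon: "expands heis_mon (\<lambda>F. partial j (heis_mon k F))"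
proof -
  obtain p q r where k: "k = (p, q, r)" by (cases k)
  have e: "expands heis_mon (DH.mon p q r)" for p q r
    using expands.base[of heis_mon "(p, q, r)"] by (simp add: heis_mon_def)
  have 3: "expands heis_mon (\<lambda>F. D3 (DH.mon p q r F))"
    by (rule expands.cong[OF e[of p q "Suc r"]]) (simp add: DH.Z_mon)
  have 1: "expands heis_mon (\<lambda>F. D1 (DH.mon p q r F))"
    by (rule expands.cong[OF e[of "Suc p" q r]]) (simp add: DH.X_mon)
  have 2: "expands heis_mon (\<lambda>F. D2 (DH.mon p q r F))"
    by (rule expands.cong[OF expands.add[OF e[of p "Suc q" r]
          expands.mult[OF smooth_on_const[of _ "of_nat p"] e[of "p - 1" q "Suc r"]]]])
       (simp add: DH.Y_mon)
  consider "j = 1" | "j = 2" | "j = 3" using exhaust_3 by blast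
  then show ?thesis
  proof cases
    case 1
    show ?thesis
      by (rule expands.cong[OF expands.add[OF \<open>expands heis_mon (\<lambda>F. D1 (DH.mon p q r F))\<close>
            expands.mult[OF smooth_on_minus[OF open_UNIV smooth_on_component[of 2]] 3]]])
         (simp add: k heis_mon_def D1_def D3_def 1)
  next
    case 2
    show ?thesis
      by (rule expands.cong[OF expands.add[OF \<open>expands heis_mon (\<lambda>F. D2 (DH.mon p q r F))\<close>
            expands.mult[OF smooth_on_component[of 1] 3]]])
         (simp add: k heis_mon_def D2_def D3_def 2)
  next
    case j: 3
    show ?thesis
      using 3 by (simp add: k heis_mon_def D3_def j)
  qed
qed

lemma expands_partials_heis_mon: "expands heis_mon (foldr partial js)"
proof (induction js)
  case Nil
  show ?case
    by (rule expands.cong[OF expands.base[of heis_mon "(0, 0, 0)"]]) (simp add: heis_mon_def DH.mon_def)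
next
  case (Cons j js)
  have "expands heis_mon (\<lambda>F. partial j (foldr partial js F))"
    by (rule expands_derivation[THEN conjunct1, OF has_derivative_const partial_vfield _
          expands_partial_heis_mon Cons]) (simp add: heis_mon_def)
  then show ?case
    by (rule expands.cong) simp
qed

lemma expands_derivation_partials:
  assumes "expands (foldr partial) D"
  shows "expands (foldr partial) (\<lambda>F. D1 (D F))" "expands (foldr partial) (\<lambda>F. D2 (D F))"
    "expands (foldr partial) (\<lambda>F. D3 (D F))"
proof -
  have e: "expands (foldr partial) (\<lambda>F. partial j (foldr partial js F))" for j js
    by (rule expands.cong[OF expands.base[of "foldr partial" "j # js"]]) simp
  show "expands (foldr partial) (\<lambda>F. D3 (D F))"
    using expands_derivation[OF has_derivative_const partial_vfield foldr_partial_mem e assms]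
    by (simp add: D3_def)
  have "expands (foldr partial) (\<lambda>F. D1 (foldr partial js F))" for js
    by (rule expands.cong[OF expands.add[OF e[of 1 js] expands.mult[OF smooth_on_component[of 2] e[of 3 js]]]])
       (simp add: D1_def)
  from expands_derivation[OF has_derivative_d1_field D1_vfield foldr_partial_mem this assms]
  show "expands (foldr partial) (\<lambda>F. D1 (D F))" by simp
  have "expands (foldr partial) (\<lambda>F. D2 (foldr partial js F))" for js
    by (rule expands.cong[OF expands.add[OF e[of 2 js]
          expands.mult[OF smooth_on_minus[OF open_UNIV smooth_on_component[of 1]] e[of 3 js]]]])
       (simp add: D2_def)
  from expands_derivation[OF has_derivative_d2_field D2_vfield foldr_partial_mem this assms]
  show "expands (foldr partial) (\<lambda>F. D2 (D F))" by simp
qed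

lemma expands_mon_sum_partials: "expands (foldr partial) (DH.mon_sum a b c)"
proof -
  have Z: "expands (foldr partial) (\<lambda>F. (D3 ^^ r) F)" for r
  proof (induction r)
    case 0
    show ?case
      by (rule expands.cong[OF expands.base[of "foldr partial" "[]"]]) simp
  qed (use expands_derivation_partials in auto)
  have Y: "expands (foldr partial) (\<lambda>F. (D2 ^^ q) ((D3 ^^ r) F))" for q r
    by (induction q) (use expands_derivation_partials Z in auto)
  have "expands (foldr partial) (\<lambda>F. (D1 ^^ p) ((D2 ^^ q) ((D3 ^^ r) F)))" for p q r
    by (induction p) (use expands_derivation_partials Y in auto)
  then have "expands (foldr partial) (\<lambda>F x. \<Sum>n\<le>min a b. c n * DH.mon (a - n) (b - n) n F x)"
    by (intro expands_sum expands.mult) (simp_all add: DH.mon_def[abs_def])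
  then show ?thesis
    by (simp add: DH.mon_sum_def[abs_def])
qed

section \<open>Matrices\<close>

lemma matrix_mult_add_left: "(A + B) ** C = A ** C + (B ** C :: real^'n::finite^'m::finite)"
  by (simp add: matrix_matrix_mult_def vec_eq_iff sum.distrib algebra_simps)

lemma linear_matrix_mult_right: "linear (\<lambda>g::real^'n::finite^'n. g ** X)"
  by (rule linearI) (simp_all add: matrix_mult_add_left scalar_matrix_assoc)

lemma linear_matrix_mult_left: "linear (\<lambda>g::real^'n::finite^'n. X ** g)"
  by (rule linearI) (simp_all add: matrix_add_ldistrib matrix_scalar_ac scalar_matrix_assoc)

lemma has_derivative_matrix_mult_right:
  "((\<lambda>g::real^'n::finite^'n. g ** X) has_derivative (\<lambda>v. v ** X)) (at g)"
  using linear_matrix_mult_right linear_conv_bounded_linear bounded_linear_imp_has_derivative by blast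

lemma has_derivative_matrix_mult_left:
  "((\<lambda>g::real^'n::finite^'n. X ** g) has_derivative (\<lambda>v. X ** v)) (at g)"
  using linear_matrix_mult_left linear_conv_bounded_linear bounded_linear_imp_has_derivative by blast

lemma GL_iff_det: "g \<in> GL \<longleftrightarrow> det (g::real^'n::finite^'n) \<noteq> 0"
  by (simp add: GL_def invertible_det_nz)

lemma GL_mult [intro]: "g \<in> GL \<Longrightarrow> h \<in> GL \<Longrightarrow> g ** h \<in> GL"
  by (simp add: GL_iff_det det_mul)

lemma GL_mult_iff: "g ** h \<in> GL \<longleftrightarrow> g \<in> GL \<and> h \<in> GL"
  by (simp add: GL_iff_det det_mul)

lemma GL_one [simp]: "mat 1 \<in> GL"
  by (simp add: GL_iff_det)

lemma open_GL: "open (GL :: (real^'n::finite^'n) set)"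
proof -
  have "continuous_on UNIV (det :: real^'n^'n \<Rightarrow> real)"
    unfolding det_def[abs_def]
    by (intro continuous_intros continuous_on_prod continuous_on_component)
  then have "open (det -` (- {0}) :: (real^'n^'n) set)"
    by (rule open_vimage[rotated]) auto
  moreover have "det -` (- {0}) = (GL :: (real^'n^'n) set)"
    by (auto simp: GL_iff_det)
  ultimately show ?thesis by simp
qed

lemma matrix_inv_GL:
  assumes "g \<in> GL"
  shows "g ** matrix_inv g = mat 1" "matrix_inv g ** g = mat 1" "matrix_inv g \<in> GL"
proof -
  have "g ** matrix_inv g = mat 1 \<and> matrix_inv g ** g = mat 1"
    using assms unfolding GL_def invertible_def matrix_inv_def mem_Collect_eq by (rule someI_ex)
  then show "g ** matrix_inv g = mat 1" "matrix_inv g ** g = mat 1"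
    by auto
  then show "matrix_inv g \<in> GL"
    by (metis GL_one GL_mult_iff)
qed

lemma matrix_inv_eqI:
  fixes g h :: "real^'n::finite^'n"
  assumes "g ** h = mat 1"
  shows "matrix_inv g = h"
proof -
  have "g \<in> GL" using assms by (metis GL_one GL_mult_iff)
  then show ?thesis
    using matrix_inv_GL(2)[of g] assms by (metis matrix_mul_assoc matrix_mul_lid matrix_mul_rid)
qed

lemma elem_mat_mult_left: "(elem_mat i j ** A) $ r $ c = (if r = i then A $ j $ c else 0)"
  by (simp add: elem_mat_def matrix_matrix_mult_def mult_delta_left)

lemma diag_mat_mult_left: "(diag_mat d ** A) $ r $ c = d $ r * A $ r $ c"
  by (simp add: diag_mat_def matrix_matrix_mult_def mult_delta_left)

lemma diag_mat_mult_right: "(A ** diag_mat d) $ r $ c = A $ r $ c * d $ c"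
  by (simp add: diag_mat_def matrix_matrix_mult_def mult_delta_right)

lemma elem_mat_mult: "elem_mat i j ** elem_mat k l = (if j = k then elem_mat i l else 0)"
  by (auto simp: vec_eq_iff elem_mat_mult_left) (auto simp: elem_mat_def)

lemma diag_mat_elem: "diag_mat d ** elem_mat i j = d $ i *\<^sub>R elem_mat i j"
  by (auto simp: vec_eq_iff diag_mat_mult_left elem_mat_def)

lemma elem_diag_mat: "elem_mat i j ** diag_mat d = d $ j *\<^sub>R elem_mat i j"
  by (auto simp: vec_eq_iff diag_mat_mult_right elem_mat_def)

lemma diag_mat_mult: "diag_mat a ** diag_mat b = diag_mat (\<chi> j. a $ j * b $ j)"
  by (auto simp: vec_eq_iff diag_mat_mult_left) (auto simp: diag_mat_def)

lemma det_diag_mat: "det (diag_mat d) = (\<Prod>j\<in>UNIV. d $ j)"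
  by (subst det_diagonal) (auto simp: diag_mat_def)

lemma mat_exp_nilpotent:
  fixes X :: "real^'n::finite^'n"
  assumes "X ** X ** X = 0"
  shows "mat_exp X = mat 1 + X + (1 / 2) *\<^sub>R (X ** X)"
proof -
  have 0: "(((**) X ^^ k) (mat 1)) = 0" if "k \<ge> 3" for k
    using that
  proof (induction k rule: dec_induct)
    case base
    then show ?case
      using assms by (simp add: numeral_3_eq_3 matrix_mul_assoc)
  next
    case (step k)
    then show ?case by simp
  qed
  have "mat_exp X = (\<Sum>k<3. (1 / fact k) *\<^sub>R (((**) X ^^ k) (mat 1)))"
    unfolding mat_exp_def by (rule suminf_finite) (use 0 in \<open>auto simp: not_less\<close>)
  also have "\<dots> = mat 1 + X + (1 / 2) *\<^sub>R (X ** X)"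
    by (simp add: numeral_3_eq_3)
  finally show ?thesis .
qed

text \<open>The extra x_1 x_2 / 2 is the quadratic term of the exponential, from E_32 E_21 =
  E_31.\<close>

lemma cell3_eq:
  "cell3 x = mat 1 + x$1 *\<^sub>R elem_mat 2 1 + x$2 *\<^sub>R elem_mat 3 2 + (x$3 + x$1 * x$2 / 2) *\<^sub>R elem_mat 3 1"
proof -
  define X :: "real^3^3" where "X = x$1 *\<^sub>R elem_mat 2 1 + x$2 *\<^sub>R elem_mat 3 2 + x$3 *\<^sub>R elem_mat 3 1"
  have X2: "X ** X = (x$1 * x$2) *\<^sub>R elem_mat 3 1"
    by (simp add: X_def matrix_add_ldistrib matrix_mult_add_left matrix_scalar_ac elem_mat_mult
        flip: scalar_matrix_assoc)
  then have "X ** X ** X = 0"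
    by (simp add: X_def matrix_add_ldistrib matrix_scalar_ac elem_mat_mult flip: scalar_matrix_assoc)
  from mat_exp_nilpotent[OF this] show ?thesis
    unfolding cell3_def X_def[symmetric] X2 by (simp add: X_def scaleR_add_left)
qed

lemma cell2_eq: "cell2 t = mat 1 + t *\<^sub>R elem_mat 2 1"
proof -
  have "(t *\<^sub>R elem_mat 2 1) ** (t *\<^sub>R elem_mat 2 1 :: real^2^2) = 0"
    by (simp add: matrix_scalar_ac elem_mat_mult flip: scalar_matrix_assoc)
  with mat_exp_nilpotent[of "t *\<^sub>R elem_mat 2 1 :: real^2^2"] show ?thesis
    by (simp add: cell2_def)
qed

lemma det_cell3: "det (cell3 x) = 1"
  by (simp add: cell3_eq det_3 elem_mat_def mat_def)

lemma cell3_GL: "cell3 x \<in> GL"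
  by (simp add: GL_iff_det det_cell3)

lemma cell3_0: "cell3 0 = mat 1"
  by (simp add: cell3_eq)

lemma cell2_0: "cell2 0 = mat 1"
  by (simp add: cell2_eq)

lemma det_cell2: "det (cell2 t) = 1"
  by (simp add: cell2_eq det_2 elem_mat_def mat_def)

lemma cell2_GL: "cell2 t \<in> GL"
  by (simp add: GL_iff_det det_cell2)

lemma iota_mult: "iota i (g ** h) = iota i g ** iota i h"
  by (simp add: iota_def vec_eq_iff forall_3 matrix_matrix_mult_def sum_3 sum_2)

lemma iota_one: "iota i (mat 1) = mat 1"
  by (simp add: iota_def vec_eq_iff forall_3 mat_def)

lemma det_iota: "det (iota i g) = det g"
  by (simp add: iota_def det_3 det_2)

lemma iota_GL: "iota i g \<in> GL \<longleftrightarrow> g \<in> GL"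
  by (simp add: GL_iff_det det_iota)

lemma iota_cell2: "iota i (cell2 t) = cell3 (axis_pt i t)"
  by (auto simp: iota_def cell2_eq cell3_eq vec_eq_iff forall_3 mat_def elem_mat_def axis_pt_def axis_def)

lemma matrix_inv_iota: "h \<in> GL \<Longrightarrow> matrix_inv (iota i h) = iota i (matrix_inv h)"
  by (rule matrix_inv_eqI) (simp add: matrix_inv_GL(1) iota_one flip: iota_mult)

definition diag_ext :: "nat \<Rightarrow> real^2 \<Rightarrow> real^3" where
  "diag_ext i v = (if i = 1 then vector [v$1, v$2, 1] else vector [1, v$1, v$2])"

lemma iota_diag_mat: "iota i (diag_mat v) = diag_mat (diag_ext i v)"
  by (simp add: iota_def diag_ext_def vec_eq_iff forall_3 diag_mat_def)

text \<open>Generator of the Lie algebra of the unipotent part of the embedded P'.\<close>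

definition raise_mat :: "nat \<Rightarrow> real^3^3" where
  "raise_mat i = (if i = 1 then elem_mat 1 2 else elem_mat 2 3)"

lemma iota_unip2: "u \<in> unip2 \<Longrightarrow> iota i u = mat 1 + u$1$2 *\<^sub>R raise_mat i"
  by (simp add: iota_def raise_mat_def vec_eq_iff forall_3 mat_def elem_mat_def unip2_def)

lemma unip3_raise: "mat 1 + s *\<^sub>R raise_mat i \<in> unip3"
  by (simp add: raise_mat_def mat_def elem_mat_def unip3_def)

lemma raise_mat_square: "raise_mat i ** raise_mat i = 0"
  by (simp add: raise_mat_def elem_mat_mult)

lemma unip3_one: "mat 1 \<in> unip3"
  using unip3_raise[of 0] by simp

lemma det_unip3: "u \<in> unip3 \<Longrightarrow> det u = 1"
  by (simp add: unip3_def det_3)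

text \<open>\<open>iota i\<close> is affine but not linear because of its fixed entry 1; hence the
  subtraction of \<open>iota i 0\<close>.\<close>

lemma has_derivative_iota: "(iota i has_derivative (\<lambda>v. iota i v - iota i 0)) (at g)"
proof -
  have "linear (\<lambda>v. iota i v - iota i 0)"
    by (rule linearI) (simp_all add: iota_def vec_eq_iff forall_3)
  then have "bounded_linear (\<lambda>v. iota i v - iota i 0)"
    by (simp add: linear_conv_bounded_linear)
  from has_derivative_add[OF bounded_linear_imp_has_derivative[OF this] has_derivative_const[of "iota i 0"]]
  show ?thesis by simp
qed

section \<open>Left-invariant vector fields on the general linear group\<close>

text \<open>The left-invariant vector field of \<open>X\<close>: the derivative of f(g exp(sX)) at s
  = 0, with tangent vector g X.\<close>

definition right_deriv ::
  "real^'n::finite^'n \<Rightarrow> (real^'n^'n \<Rightarrow> complex) \<Rightarrow> real^'n^'n \<Rightarrow> complex" where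
  "right_deriv X = vfield GL (\<lambda>g. g ** X)"

lemma right_deriv_eq: "g \<in> GL \<Longrightarrow> right_deriv X f g = dderiv (g ** X) f g"
  by (simp add: right_deriv_def vfield_def)

lemma right_deriv_outside: "g \<notin> GL \<Longrightarrow> right_deriv X f g = 0"
  by (simp add: right_deriv_def vfield_def)

lemma linear_op_on_right_deriv: "linear_op_on (Csmooth GL) (right_deriv X)"
  unfolding right_deriv_def by (rule linear_op_on_vfield[OF open_GL has_derivative_matrix_mult_right])

lemma right_deriv_mem: "f \<in> Csmooth GL \<Longrightarrow> right_deriv X f \<in> Csmooth GL"
  unfolding right_deriv_def by (rule vfield_Csmooth[OF open_GL has_derivative_matrix_mult_right])

text \<open>For left-invariant fields the bracket at g is (g X) Y - (g Y) X, so commutators of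
  operators follow matrix commutators without a sign.\<close>

lemma right_deriv_commutator:
  fixes f :: "real^'n::finite^'n \<Rightarrow> complex"
  assumes "f \<in> Csmooth GL" "X ** Y - Y ** X = W"
  shows "right_deriv X (right_deriv Y f) = (\<lambda>g. right_deriv Y (right_deriv X f) g + right_deriv W f g)"
proof -
  have "(g ** X) ** Y - (g ** Y) ** X = g ** W" for g :: "real^'n^'n"
    by (simp add: assms(2)[symmetric] linear_diff[OF linear_matrix_mult_left] matrix_mul_assoc)
  with vfield_commutator[OF open_GL has_derivative_matrix_mult_right[of X] has_derivative_matrix_mult_right[of Y] assms(1)]
  show ?thesis
    unfolding right_deriv_def by (simp only:)
qed

lemma right_deriv_scale:
  assumes "f \<in> Csmooth GL"
  shows "right_deriv (c *\<^sub>R X) f = (\<lambda>g. complex_of_real c * right_deriv X f g)"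
proof
  fix g
  show "right_deriv (c *\<^sub>R X) f g = complex_of_real c * right_deriv X f g"
    using linear_scale[OF linear_dderiv[OF Csmooth_differentiable[OF assms]]]
    by (cases "g \<in> GL")
       (simp_all add: right_deriv_eq right_deriv_outside matrix_scalar_ac scaleR_conv_of_real[where 'a = complex]
         flip: scalar_matrix_assoc)
qed

lemma right_deriv_zero: "f \<in> Csmooth GL \<Longrightarrow> right_deriv 0 f = (\<lambda>g. 0)"
  using right_deriv_scale[of f 0 0] by simp

lemma right_deriv_commute:
  assumes "f \<in> Csmooth GL" "X ** Y = Y ** X"
  shows "right_deriv X (right_deriv Y f) = right_deriv Y (right_deriv X f)"
  using right_deriv_commutator[OF assms(1), of X Y 0] assms by (simp add: right_deriv_zero)

lemma right_deriv_diag_commutator: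
  assumes "f \<in> Csmooth GL"
  shows "right_deriv (diag_mat h) (right_deriv (elem_mat i j) f) =
    (\<lambda>g. right_deriv (elem_mat i j) (right_deriv (diag_mat h) f) g
       + complex_of_real (h$i - h$j) * right_deriv (elem_mat i j) f g)"
proof -
  have "diag_mat h ** elem_mat i j - elem_mat i j ** diag_mat h = (h$i - h$j) *\<^sub>R elem_mat i j"
    by (simp add: diag_mat_elem elem_diag_mat scaleR_diff_left)
  from right_deriv_commutator[OF assms this] show ?thesis
    by (simp only: right_deriv_scale[OF assms])
qed

interpretation GH: heisenberg "Csmooth GL" "right_deriv (elem_mat 2 1)" "right_deriv (elem_mat 3 2)"
  "right_deriv (elem_mat 3 1 :: real^3^3)"
proof -
  interpret function_space "Csmooth (GL :: (real^3^3) set)"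
    by (rule function_space_Csmooth[OF open_GL])
  show "heisenberg (Csmooth GL) (right_deriv (elem_mat 2 1)) (right_deriv (elem_mat 3 2))
    (right_deriv (elem_mat 3 1 :: real^3^3))"
    by unfold_locales
       (auto intro: linear_op_on_right_deriv right_deriv_commute right_deriv_commutator simp: elem_mat_mult)
qed

section \<open>Left translation, pullback to the open cell, and the adjoint action of the
  torus\<close>

lemma left_translation_mem:
  fixes f :: "real^'n::finite^'n \<Rightarrow> complex"
  assumes "h \<in> GL" "f \<in> Csmooth GL"
  shows "(\<lambda>g. f (h ** g)) \<in> Csmooth GL"
proof -
  have "smooth_on GL (\<lambda>g. f (h ** g))"
    by (rule smooth_on_compose_affine[OF open_GL open_GL _ has_derivative_matrix_mult_left CsmoothD(1)[OF assms(2)]])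
       (use assms(1) in auto)
  then show ?thesis
    using assms by (auto simp: Csmooth_def GL_mult_iff)
qed

lemma right_deriv_left_translation:
  fixes f :: "real^'n::finite^'n \<Rightarrow> complex"
  assumes "h \<in> GL" "f \<in> Csmooth GL"
  shows "right_deriv X (\<lambda>g. f (h ** g)) = (\<lambda>g. right_deriv X f (h ** g))"
proof
  fix g
  show "right_deriv X (\<lambda>g. f (h ** g)) g = right_deriv X f (h ** g)"
  proof (cases "g \<in> GL")
    case True
    with assms have "f differentiable (at (h ** g))"
      by (intro Csmooth_differentiable[OF assms(2)]) auto
    from dderiv_compose[OF has_derivative_matrix_mult_left this] show ?thesis
      using True assms by (simp add: right_deriv_eq GL_mult_iff matrix_mul_assoc)
  qed (simp add: right_deriv_outside GL_mult_iff)
qed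

lemma mon_left_translation:
  assumes h: "h \<in> GL" and f: "f \<in> Csmooth GL"
  shows "GH.mon p q r (\<lambda>g. f (h ** g)) = (\<lambda>g. GH.mon p q r f (h ** g))"
proof -
  have pow: "(right_deriv X ^^ n) (\<lambda>g. f (h ** g)) = (\<lambda>g. (right_deriv X ^^ n) f (h ** g))
      \<and> (right_deriv X ^^ n) f \<in> Csmooth GL"
    if "f \<in> Csmooth GL" for X :: "real^3^3" and n f
    by (induction n) (use that in \<open>auto simp: right_deriv_left_translation[OF h] right_deriv_mem\<close>)
  show ?thesis
    unfolding GH.mon_def using f pow by simp
qed

lemma mon_sum_left_translation:
  "h \<in> GL \<Longrightarrow> f \<in> Csmooth GL \<Longrightarrow>
    GH.mon_sum a b c (\<lambda>g. f (h ** g)) = (\<lambda>g. GH.mon_sum a b c f (h ** g))"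
  by (simp add: GH.mon_sum_def mon_left_translation)

lemma has_derivative_cell3:
  "(cell3 has_derivative (\<lambda>v. v$1 *\<^sub>R elem_mat 2 1 + v$2 *\<^sub>R elem_mat 3 2 +
     (v$3 + (v$1 * x$2 + x$1 * v$2) / 2) *\<^sub>R elem_mat 3 1)) (at x)"
  unfolding cell3_eq[abs_def]
  by (auto intro!: derivative_eq_intros bounded_linear.has_derivative[OF bounded_linear_vec_nth]
      simp: algebra_simps)

lemma cell3_mult:
  "cell3 x ** elem_mat 2 1 = elem_mat 2 1 + x$2 *\<^sub>R elem_mat 3 1"
  "cell3 x ** elem_mat 3 2 = elem_mat 3 2"
  "cell3 x ** elem_mat 3 1 = elem_mat 3 1"
  by (simp_all add: cell3_eq matrix_mult_add_left elem_mat_mult flip: scalar_matrix_assoc)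

lemma cell3_pullback_mem:
  assumes "f \<in> Csmooth GL"
  shows "(\<lambda>x. f (cell3 x)) \<in> Csmooth UNIV"
proof -
  have c: "smooth_on UNIV (\<lambda>x::real^3. complex_of_real (x$i))" for i
    using smooth_on_cmult[OF open_UNIV smooth_on_component[of i], of 2] by simp
  have e: "(\<lambda>x. complex_of_real (cell3 x \<bullet> b)) = (\<lambda>x. complex_of_real (mat 1 \<bullet> b)
      + complex_of_real (x$1) * complex_of_real (elem_mat 2 1 \<bullet> b)
      + complex_of_real (x$2) * complex_of_real (elem_mat 3 2 \<bullet> b)
      + (complex_of_real (x$3) + complex_of_real (x$1) * complex_of_real (x$2 / 2)) * complex_of_real (elem_mat 3 1 \<bullet> b))" for b
    by (simp add: cell3_eq inner_add_left fun_eq_iff)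
  have "smooth_on UNIV (\<lambda>x. f (cell3 x))"
  proof (rule smooth_on_compose[OF open_UNIV open_GL _ _ CsmoothD(1)[OF assms]])
    show "smooth_on UNIV (\<lambda>x. complex_of_real (cell3 x \<bullet> b))" for b
      unfolding e by (intro smooth_on_add smooth_on_mult c smooth_on_component smooth_on_const open_UNIV)
  qed (auto simp: cell3_GL)
  then show ?thesis by (simp add: Csmooth_UNIV)
qed

text \<open>The differential of \<open>cell3\<close> carries the fields of \<open>D1\<close>,
  \<open>D2\<close>, \<open>D3\<close> to the left-invariant fields; their terms x_2 / 2 and - x_1 /
  2 compensate the quadratic term of the exponential.\<close>

lemma cell3_pullback:
  assumes "f \<in> Csmooth GL"
  shows "D1 (\<lambda>x. f (cell3 x)) = (\<lambda>x. right_deriv (elem_mat 2 1) f (cell3 x))"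
    "D2 (\<lambda>x. f (cell3 x)) = (\<lambda>x. right_deriv (elem_mat 3 2) f (cell3 x))"
    "D3 (\<lambda>x. f (cell3 x)) = (\<lambda>x. right_deriv (elem_mat 3 1) f (cell3 x))"
proof -
  have d: "dderiv v (\<lambda>x. f (cell3 x)) x = dderiv (v$1 *\<^sub>R elem_mat 2 1 + v$2 *\<^sub>R elem_mat 3 2 +
     (v$3 + (v$1 * x$2 + x$1 * v$2) / 2) *\<^sub>R elem_mat 3 1) f (cell3 x)" for v x
    by (rule dderiv_compose[OF has_derivative_cell3 Csmooth_differentiable[OF assms cell3_GL]])
  note m = cell3_pullback_mem[OF assms]
  show "D1 (\<lambda>x. f (cell3 x)) = (\<lambda>x. right_deriv (elem_mat 2 1) f (cell3 x))"
    "D2 (\<lambda>x. f (cell3 x)) = (\<lambda>x. right_deriv (elem_mat 3 2) f (cell3 x))"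
    "D3 (\<lambda>x. f (cell3 x)) = (\<lambda>x. right_deriv (elem_mat 3 1) f (cell3 x))"
    unfolding D1_vfield[OF m] D2_vfield[OF m] D3_vfield
    by (simp_all add: vfield_def d right_deriv_eq[OF cell3_GL] cell3_mult d1_field_def d2_field_def axis_def)
qed

lemma mon_cell3_pullback:
  assumes f: "f \<in> Csmooth GL"
  shows "DH.mon p q r (\<lambda>x. f (cell3 x)) = (\<lambda>x. GH.mon p q r f (cell3 x))"
proof -
  have Z: "(D3 ^^ n) (\<lambda>x. f (cell3 x)) = (\<lambda>x. (right_deriv (elem_mat 3 1) ^^ n) f (cell3 x))"
    if "f \<in> Csmooth GL" for f n
    by (induction n) (use that in \<open>auto simp: cell3_pullback\<close>)
  have Y: "(D2 ^^ n) (\<lambda>x. f (cell3 x)) = (\<lambda>x. (right_deriv (elem_mat 3 2) ^^ n) f (cell3 x))"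
    if "f \<in> Csmooth GL" for f n
    by (induction n) (use that in \<open>auto simp: cell3_pullback\<close>)
  have X: "(D1 ^^ n) (\<lambda>x. f (cell3 x)) = (\<lambda>x. (right_deriv (elem_mat 2 1) ^^ n) f (cell3 x))"
    if "f \<in> Csmooth GL" for f n
    by (induction n) (use that in \<open>auto simp: cell3_pullback\<close>)
  show ?thesis
    unfolding DH.mon_def GH.mon_def using f by (simp add: X Y Z)
qed

lemma mon_sum_cell3_pullback:
  "f \<in> Csmooth GL \<Longrightarrow> DH.mon_sum a b c (\<lambda>x. f (cell3 x)) = (\<lambda>x. GH.mon_sum a b c f (cell3 x))"
  by (simp add: DH.mon_sum_def GH.mon_sum_def mon_cell3_pullback)

text \<open>f(g d exp(sE)) = f(g exp(s d E d^-1) d), and conjugation by d multiplies E_ij by d_i /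
  d_j. The entries may be negative, so the sign group M is covered as well.\<close>

lemma right_deriv_torus:
  assumes d: "\<And>j. d$j \<noteq> (0::real)" and f: "f \<in> Csmooth GL"
    and \<kappa>: "\<And>g. g \<in> GL \<Longrightarrow> f (g ** diag_mat d) = \<kappa> * f g" and g: "g \<in> GL"
  shows "right_deriv (elem_mat i j) f (g ** diag_mat d) =
    complex_of_real (d$i / d$j) * \<kappa> * right_deriv (elem_mat i j) f g"
proof -
  have dGL: "diag_mat d \<in> GL"
    by (simp add: GL_iff_det det_diag_mat d)
  have fd: "f differentiable (at (g ** diag_mat d))"
    using g dGL by (intro Csmooth_differentiable[OF f]) auto
  have "dderiv (g ** elem_mat i j) (\<lambda>g. f (g ** diag_mat d)) g = dderiv (g ** elem_mat i j) (\<lambda>g. \<kappa> * f g) g"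
    by (rule dderiv_cong_open[OF open_GL g \<kappa>])
  also have "\<dots> = \<kappa> * right_deriv (elem_mat i j) f g"
    using g by (simp add: dderiv_cmult Csmooth_differentiable[OF f] right_deriv_eq)
  also have "dderiv (g ** elem_mat i j) (\<lambda>g. f (g ** diag_mat d)) g =
      dderiv (g ** elem_mat i j ** diag_mat d) f (g ** diag_mat d)"
    by (rule dderiv_compose[OF has_derivative_matrix_mult_right fd])
  also have "g ** elem_mat i j ** diag_mat d = (d$j / d$i) *\<^sub>R (g ** diag_mat d ** elem_mat i j)"
    using d by (simp add: matrix_scalar_ac diag_mat_elem elem_diag_mat flip: matrix_mul_assoc scalar_matrix_assoc)
  also have "dderiv \<dots> f (g ** diag_mat d) = complex_of_real (d$j / d$i) * right_deriv (elem_mat i j) f (g ** diag_mat d)"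
    using linear_scale[OF linear_dderiv[OF fd]] g dGL
    by (simp add: right_deriv_eq GL_mult_iff scaleR_conv_of_real[where 'a = complex])
  finally show ?thesis
    using d[of i] d[of j] by (simp add: field_simps)
qed

lemma mon_torus:
  assumes d: "\<And>j. d$j \<noteq> (0::real)" and f: "f \<in> Csmooth GL"
    and \<kappa>: "\<And>g. g \<in> GL \<Longrightarrow> f (g ** diag_mat d) = \<kappa> * f g" and g: "g \<in> GL"
  shows "GH.mon p q r f (g ** diag_mat d) =
    complex_of_real ((d$2 / d$1) ^ p * (d$3 / d$2) ^ q * (d$3 / d$1) ^ r) * \<kappa> * GH.mon p q r f g"
proof -
  have pow: "(right_deriv (elem_mat i j) ^^ n) f \<in> Csmooth GL \<and>
    (\<forall>g\<in>GL. (right_deriv (elem_mat i j) ^^ n) f (g ** diag_mat d) =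
      (complex_of_real ((d$i / d$j) ^ n) * \<kappa>) * (right_deriv (elem_mat i j) ^^ n) f g)"
    if "f \<in> Csmooth GL" "\<And>g. g \<in> GL \<Longrightarrow> f (g ** diag_mat d) = \<kappa> * f g" for f i j n \<kappa>
  proof (induction n)
    case 0
    then show ?case using that by simp
  next
    case (Suc n)
    show ?case
      using right_deriv_torus[OF d conjunct1[OF Suc] conjunct2[OF Suc, THEN bspec]]
        right_deriv_mem[OF conjunct1[OF Suc]]
      by (simp add: mult_ac)
  qed
  note Z = pow[OF f \<kappa>, where i = 3 and j = 1 and n = r]
  note Y = pow[OF conjunct1[OF Z] conjunct2[OF Z, THEN bspec], where i = 3 and j = 2 and n = q]
  note X = pow[OF conjunct1[OF Y] conjunct2[OF Y, THEN bspec], where i = 2 and j = 1 and n = p]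
  show ?thesis
    using X g unfolding GH.mon_def by (simp add: mult_ac)
qed

section \<open>Infinitesimal properties of the principal series\<close>

lemma dderiv_curve:
  assumes "(\<gamma> has_vector_derivative v) (at s)" "f differentiable (at (\<gamma> s))"
  shows "((\<lambda>t. f (\<gamma> t)) has_vector_derivative dderiv v f (\<gamma> s)) (at s)"
proof -
  have "((\<lambda>t. f (\<gamma> t)) has_derivative (\<lambda>h. dderiv (h *\<^sub>R v) f (\<gamma> s))) (at s)"
    using has_derivative_compose[OF assms(1)[unfolded has_vector_derivative_def] has_derivative_dderiv[OF assms(2)]] .
  then show ?thesis
    by (simp add: has_vector_derivative_def linear_scale[OF linear_dderiv[OF assms(2)]])
qed

lemma I_series_Csmooth: "f \<in> I_series \<xi> lam \<Longrightarrow> f \<in> Csmooth GL"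
  by (simp add: I_series_def principal_series_def Csmooth_def)

lemma diag_mat_sum: "diag_mat d = (\<Sum>j\<in>UNIV. d$j *\<^sub>R elem_mat j j)"
proof -
  have "(\<Sum>j\<in>UNIV. d$j *\<^sub>R elem_mat j j) $ r $ c = (\<Sum>j\<in>UNIV. if j = r then (if r = c then d$r else 0) else 0)" for r c
    unfolding sum_component by (rule sum.cong) (auto simp: elem_mat_def)
  then show ?thesis
    by (simp add: vec_eq_iff diag_mat_def)
qed

lemma diag_mat_one: "diag_mat (\<chi> j. 1) = mat 1"
  by (simp add: diag_mat_def mat_def vec_eq_iff)

lemma I_series_torus:
  assumes "f \<in> I_series \<xi> lam" "g \<in> GL" "\<forall>j. m$j \<in> {1, -1}" "\<forall>j. a$j > 0"
  shows "f (g ** diag_mat (\<chi> j. m$j * a$j)) = (\<Prod>j\<in>UNIV. sign_pow (\<xi>$j) (m$j)) *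
    (\<Prod>j\<in>UNIV. complex_of_real (a$j) powr (- (lam$j))) * f g"
proof -
  have "f (g ** diag_mat m ** diag_mat a ** mat 1) = (\<Prod>j\<in>UNIV. sign_pow (\<xi>$j) (m$j)) *
      (\<Prod>j\<in>UNIV. complex_of_real (a$j) powr (- (lam$j))) * f g"
    using assms unip3_one unfolding I_series_def principal_series_def by blast
  then show ?thesis
    by (simp add: diag_mat_mult flip: matrix_mul_assoc)
qed

lemma sign_pow_one [simp]: "sign_pow e 1 = 1"
  by (simp add: sign_pow_def)

lemma I_series_unipotent:
  assumes "f \<in> I_series \<xi> lam" "g \<in> GL" "u \<in> unip3"
  shows "f (g ** u) = f g"
proof -
  have "f (g ** diag_mat (\<chi> j. 1) ** diag_mat (\<chi> j. 1) ** u) = (\<Prod>j\<in>UNIV. sign_pow (\<xi>$j) ((\<chi> j. 1) $ j)) *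
      (\<Prod>j\<in>UNIV. complex_of_real ((\<chi> j. 1) $ j) powr (- (lam$j))) * f g"
    using assms unfolding I_series_def principal_series_def by fastforce
  then show ?thesis
    by (simp add: diag_mat_one)
qed

lemma I_series_left_translation:
  assumes f: "f \<in> I_series \<xi> lam" and h: "h \<in> GL"
  shows "(\<lambda>g. f (h ** g)) \<in> I_series \<xi> lam"
proof -
  have "(\<lambda>g. f (h ** g)) \<in> Csmooth GL"
    by (rule left_translation_mem[OF h I_series_Csmooth[OF f]])
  moreover have "f (h ** (g ** diag_mat m ** diag_mat a ** n)) = (\<Prod>j\<in>UNIV. sign_pow (\<xi>$j) (m$j)) *
      (\<Prod>j\<in>UNIV. complex_of_real (a$j) powr (- (lam$j))) * f (h ** g)"
    if "g \<in> GL" "n \<in> unip3" "\<forall>j. m$j \<in> {1, -1}" "\<forall>j. a$j > 0" for g m a n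
  proof -
    have "h ** g \<in> GL" using h that by auto
    then have "f (h ** g ** diag_mat m ** diag_mat a ** n) = (\<Prod>j\<in>UNIV. sign_pow (\<xi>$j) (m$j)) *
        (\<Prod>j\<in>UNIV. complex_of_real (a$j) powr (- (lam$j))) * f (h ** g)"
      using f that unfolding I_series_def principal_series_def by blast
    then show ?thesis
      by (simp add: matrix_mul_assoc)
  qed
  ultimately show ?thesis
    unfolding I_series_def principal_series_def Csmooth_def by blast
qed

lemma powr_exp: "complex_of_real (exp t) powr z = exp (z * complex_of_real t)"
  by (simp add: powr_def Ln_of_real)

lemma right_deriv_raise:
  assumes f: "f \<in> I_series \<xi> lam"
  shows "right_deriv (raise_mat i) f = (\<lambda>g. 0)"
proof
  fix g
  show "right_deriv (raise_mat i) f g = 0"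
  proof (cases "g \<in> GL")
    case True
    define \<gamma> where "\<gamma> s = g + s *\<^sub>R (g ** raise_mat i)" for s
    have \<gamma>: "\<gamma> s = g ** (mat 1 + s *\<^sub>R raise_mat i)" for s
      by (simp add: \<gamma>_def matrix_add_ldistrib matrix_scalar_ac flip: scalar_matrix_assoc)
    have "(\<gamma> has_vector_derivative g ** raise_mat i) (at 0)"
      unfolding \<gamma>_def[abs_def] by (auto intro!: derivative_eq_intros simp: has_vector_derivative_def)
    moreover have "\<gamma> 0 = g" by (simp add: \<gamma>_def)
    ultimately have "((\<lambda>t. f (\<gamma> t)) has_vector_derivative dderiv (g ** raise_mat i) f g) (at 0)"
      using dderiv_curve[of \<gamma> _ 0 f] Csmooth_differentiable[OF I_series_Csmooth[OF f] True] by simp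
    moreover have "(\<lambda>t. f (\<gamma> t)) = (\<lambda>t. f g)"
      unfolding \<gamma> using I_series_unipotent[OF f True unip3_raise] by simp
    ultimately have "dderiv (g ** raise_mat i) f g = 0"
      using vector_derivative_unique_at has_vector_derivative_const by metis
    then show ?thesis
      using True by (simp add: right_deriv_eq)
  qed (simp add: right_deriv_outside)
qed

text \<open>Along g exp(sh) the function is f(g) exp(- s L), since only positive diagonal matrices
  occur; the minus sign is that of the exponents in the principal series.\<close>

lemma right_deriv_diag:
  assumes f: "f \<in> I_series \<xi> lam"
  shows "right_deriv (diag_mat h) f = (\<lambda>g. - (\<Sum>j\<in>UNIV. complex_of_real (h$j) * lam$j) * f g)"
proof
  fix g
  define L where "L = (\<Sum>j\<in>UNIV. complex_of_real (h$j) * lam$j)"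
  have "right_deriv (diag_mat h) f g = - L * f g"
  proof (cases "g \<in> GL")
    case True
    define \<gamma> where "\<gamma> s = g ** diag_mat (\<chi> j. exp (s * h$j))" for s
    have "((\<lambda>s. diag_mat (\<chi> j. exp (s * h$j))) has_vector_derivative diag_mat h) (at 0)"
      unfolding diag_mat_sum
      by (rule has_vector_derivative_sum) (auto intro!: derivative_eq_intros simp: has_vector_derivative_def)
    then have "(\<gamma> has_vector_derivative g ** diag_mat h) (at 0)"
      unfolding \<gamma>_def[abs_def] has_vector_derivative_def
      using has_derivative_compose[OF _ has_derivative_matrix_mult_left[of g]]
      by (fastforce simp: matrix_scalar_ac simp flip: scalar_matrix_assoc)
    moreover have "\<gamma> 0 = g"
      by (simp add: \<gamma>_def diag_mat_one)
    ultimately have "((\<lambda>t. f (\<gamma> t)) has_vector_derivative dderiv (g ** diag_mat h) f g) (at 0)"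
      using dderiv_curve[of \<gamma> _ 0 f] Csmooth_differentiable[OF I_series_Csmooth[OF f] True] by simp
    moreover have "f (\<gamma> t) = exp (complex_of_real t * (- L)) * f g" for t
    proof -
      have "f (\<gamma> t) = (\<Prod>j\<in>UNIV. complex_of_real (exp (t * h$j)) powr (- (lam$j))) * f g"
        using I_series_torus[OF f True, of "\<chi> j. 1" "\<chi> j. exp (t * h$j)"]
        by (simp add: \<gamma>_def)
      also have "(\<Prod>j\<in>UNIV. complex_of_real (exp (t * h$j)) powr (- (lam$j))) = exp (complex_of_real t * (- L))"
        unfolding powr_exp L_def sum_negf[symmetric] sum_distrib_left
        by (subst exp_sum) (simp_all add: algebra_simps)
      finally show ?thesis .
    qed
    moreover have "((\<lambda>t. exp (complex_of_real t * (- L)) * f g) has_vector_derivative - L * f g) (at 0)"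
      by (rule has_vector_derivative_real_field) (auto intro!: derivative_eq_intros)
    ultimately have "dderiv (g ** diag_mat h) f g = - L * f g"
      using vector_derivative_unique_at by (metis (no_types, lifting) ext)
    then show ?thesis
      using True by (simp add: right_deriv_eq)
  qed (use CsmoothD(2)[OF I_series_Csmooth[OF f]] in \<open>simp add: right_deriv_outside\<close>)
  then show "right_deriv (diag_mat h) f g = - (\<Sum>j\<in>UNIV. complex_of_real (h$j) * lam$j) * f g"
    by (simp add: L_def)
qed

text \<open>With \<open>par_B\<close>, the two numerator parameters of the series in
  \<open>DD_ord\<close>; this one is already rewritten through \<open>weights\<close> as a
  nonpositive integer.\<close>

definition par_A :: "nat \<Rightarrow> nat \<Rightarrow> nat \<Rightarrow> complex" where
  "par_A i a b = (if i = 1 then - of_nat a else - of_nat b)"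

definition par_B :: "nat \<Rightarrow> complex^3 \<Rightarrow> complex^2 \<Rightarrow> complex" where
  "par_B i lam \<nu> = (if i = 1 then lam$1 - \<nu>$2 - 1 else \<nu>$2 - lam$2 + 1)"

text \<open>\<open>a\<close> and \<open>b\<close> are the entries of the multi-index of the
  operator: p + r and q + r for each of its monomials.\<close>

definition weights :: "nat \<Rightarrow> complex^3 \<Rightarrow> complex^2 \<Rightarrow> nat \<Rightarrow> nat \<Rightarrow> bool" where
  "weights i lam \<nu> a b \<longleftrightarrow>
     (if i = 1 then \<nu>$1 - lam$1 = of_nat a \<and> \<nu>$1 + \<nu>$2 - lam$1 - lam$2 = of_nat b
      else lam$2 + lam$3 - \<nu>$1 - \<nu>$2 = of_nat a \<and> lam$3 - \<nu>$2 = of_nat b)"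

text \<open>At \<open>n = min a b\<close> the truncated subtractions below may clip, but then the coefficient is \<open>0\<close>.\<close>

lemma right_deriv_raise_mon_sum:
  assumes f: "f \<in> I_series \<xi> lam" and w: "weights i lam \<nu> a b" and c: "c (Suc (min a b)) = 0"
  shows "right_deriv (raise_mat i) (GH.mon_sum a b c f) = (\<lambda>g. (if i = 1 then 1 else - 1) * (\<Sum>n\<le>min a b.
    ((par_A i a b + of_nat n) * (par_B i lam \<nu> + of_nat n) * c n - of_nat (Suc n) * c (Suc n)) *
    (if i = 1 then GH.mon (a - n - 1) (b - n) n f g else GH.mon (a - n) (b - n - 1) n f g)))"
proof (cases "i = 1")
  case True
  define H :: "real^3^3" where "H = diag_mat (vector [1, -1, 0])"
  have E: "raise_mat i = elem_mat 1 2"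
    using True by (simp add: raise_mat_def)
  have H: "elem_mat 1 2 ** elem_mat 2 1 - elem_mat 2 1 ** elem_mat 1 2 = H"
    unfolding elem_mat_mult H_def by (simp add: vec_eq_iff forall_3 diag_mat_def elem_mat_def)
  have m: "f \<in> Csmooth GL" by (rule I_series_Csmooth[OF f])
  \<comment> \<open>H = E_11 - E_22 has weight - (lam_1 - lam_2) on the principal series; this is
    the only place where the inducing parameter enters the raising computation.\<close>
  have Hf: "right_deriv H f = (\<lambda>g. (lam$2 - lam$1) * f g)"
    using right_deriv_diag[OF f, of "vector [1, -1, 0]"] by (simp add: H_def sum_3)
  have raise: "right_deriv (elem_mat 1 2) (GH.mon p q r f) = (\<lambda>g.
      of_nat p * ((lam$2 - lam$1) + of_nat q - of_nat r - of_nat p + 1) * GH.mon (p - 1) q r f g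
      - of_nat r * GH.mon p (Suc q) (r - 1) f g)" for p q r
  proof (rule GH.raise_mon_X[where H = "right_deriv H"])
    fix f :: "real^3^3 \<Rightarrow> complex" assume m: "f \<in> Csmooth GL"
    show "right_deriv (elem_mat 1 2) (right_deriv (elem_mat 2 1) f) =
        (\<lambda>x. right_deriv (elem_mat 2 1) (right_deriv (elem_mat 1 2) f) x + right_deriv H f x)"
      by (rule right_deriv_commutator[OF m H])
    show "right_deriv (elem_mat 1 2) (right_deriv (elem_mat 3 2) f) =
        right_deriv (elem_mat 3 2) (right_deriv (elem_mat 1 2) f)"
      by (rule right_deriv_commute[OF m]) (simp add: elem_mat_mult)
    show "right_deriv (elem_mat 1 2) (right_deriv (elem_mat 3 1) f) =
        (\<lambda>x. right_deriv (elem_mat 3 1) (right_deriv (elem_mat 1 2) f) x + - 1 * right_deriv (elem_mat 3 2) f x)"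
      using right_deriv_commutator[OF m, of "elem_mat 1 2" "elem_mat 3 1" "(- 1) *\<^sub>R elem_mat 3 2"]
      by (simp add: elem_mat_mult right_deriv_scale[OF m, of "- 1", simplified])
    show "right_deriv H (right_deriv (elem_mat 2 1) f) =
        (\<lambda>x. right_deriv (elem_mat 2 1) (right_deriv H f) x + - 2 * right_deriv (elem_mat 2 1) f x)"
      "right_deriv H (right_deriv (elem_mat 3 2) f) =
        (\<lambda>x. right_deriv (elem_mat 3 2) (right_deriv H f) x + 1 * right_deriv (elem_mat 3 2) f x)"
      "right_deriv H (right_deriv (elem_mat 3 1) f) =
        (\<lambda>x. right_deriv (elem_mat 3 1) (right_deriv H f) x + - 1 * right_deriv (elem_mat 3 1) f x)"
      unfolding H_def by (simp_all add: right_deriv_diag_commutator[OF m])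
  qed (use m Hf right_deriv_raise[OF f, of i] in \<open>simp_all add: linear_op_on_right_deriv E\<close>)
  have B: "of_nat a - of_nat b - (lam$2 - lam$1) - 1 = lam$1 - \<nu>$2 - 1"
  proof -
    have "of_nat a = \<nu>$1 - lam$1" "of_nat b = \<nu>$1 + \<nu>$2 - lam$1 - lam$2"
      using w True by (simp_all add: weights_def)
    then show ?thesis by simp
  qed
  show ?thesis
    using GH.raise_mon_sum_X[where a = a and b = b and c = c and f = f and \<mu> = "lam$2 - lam$1"
        and E = "right_deriv (elem_mat 1 2)", OF linear_op_on_right_deriv raise m c] True
    unfolding B E by (simp add: par_A_def par_B_def)
next
  case False
  define H :: "real^3^3" where "H = diag_mat (vector [0, 1, -1])"
  have E: "raise_mat i = elem_mat 2 3"
    using False by (simp add: raise_mat_def)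
  have H: "elem_mat 2 3 ** elem_mat 3 2 - elem_mat 3 2 ** elem_mat 2 3 = H"
    unfolding elem_mat_mult H_def by (simp add: vec_eq_iff forall_3 diag_mat_def elem_mat_def)
  have m: "f \<in> Csmooth GL" by (rule I_series_Csmooth[OF f])
  have Hf: "right_deriv H f = (\<lambda>g. (lam$3 - lam$2) * f g)"
    using right_deriv_diag[OF f, of "vector [0, 1, -1]"] by (simp add: H_def sum_3)
  have raise: "right_deriv (elem_mat 2 3) (GH.mon p q r f) = (\<lambda>g.
      of_nat q * ((lam$3 - lam$2) - of_nat q + 1) * GH.mon p (q - 1) r f g
      + of_nat r * GH.mon (Suc p) q (r - 1) f g)" for p q r
  proof (rule GH.raise_mon_Y[where H = "right_deriv H"])
    fix f :: "real^3^3 \<Rightarrow> complex" assume m: "f \<in> Csmooth GL"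
    show "right_deriv (elem_mat 2 3) (right_deriv (elem_mat 3 2) f) =
        (\<lambda>x. right_deriv (elem_mat 3 2) (right_deriv (elem_mat 2 3) f) x + right_deriv H f x)"
      by (rule right_deriv_commutator[OF m H])
    show "right_deriv (elem_mat 2 3) (right_deriv (elem_mat 2 1) f) =
        right_deriv (elem_mat 2 1) (right_deriv (elem_mat 2 3) f)"
      by (rule right_deriv_commute[OF m]) (simp add: elem_mat_mult)
    show "right_deriv (elem_mat 2 3) (right_deriv (elem_mat 3 1) f) =
        (\<lambda>x. right_deriv (elem_mat 3 1) (right_deriv (elem_mat 2 3) f) x + 1 * right_deriv (elem_mat 2 1) f x)"
      using right_deriv_commutator[OF m, of "elem_mat 2 3" "elem_mat 3 1" "elem_mat 2 1"]
      by (simp add: elem_mat_mult)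
    show "right_deriv H (right_deriv (elem_mat 3 2) f) =
        (\<lambda>x. right_deriv (elem_mat 3 2) (right_deriv H f) x + - 2 * right_deriv (elem_mat 3 2) f x)"
      "right_deriv H (right_deriv (elem_mat 3 1) f) =
        (\<lambda>x. right_deriv (elem_mat 3 1) (right_deriv H f) x + - 1 * right_deriv (elem_mat 3 1) f x)"
      unfolding H_def by (simp_all add: right_deriv_diag_commutator[OF m])
  qed (use m Hf right_deriv_raise[OF f, of i] in \<open>simp_all add: linear_op_on_right_deriv E\<close>)
  have B: "(lam$3 - lam$2) - of_nat b + 1 = \<nu>$2 - lam$2 + 1"
  proof -
    have "of_nat b = lam$3 - \<nu>$2"
      using w False by (simp add: weights_def)
    then show ?thesis by simp
  qed
  show ?thesis
    using GH.raise_mon_sum_Y[where a = a and b = b and c = c and f = f and \<mu> = "lam$3 - lam$2"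
        and E = "right_deriv (elem_mat 2 3)", OF linear_op_on_right_deriv raise m c] False
    unfolding B E by (simp add: par_A_def par_B_def)
qed

section \<open>Separating jets at a point by derivations\<close>

text \<open>Three functions vanishing at \<open>x0\<close> that are dual there, to first order, to
  three affine fields. The fields need not commute.\<close>

locale local_coordinates =
  fixes S :: "'a::euclidean_space set" and x0 :: 'a
    and a :: "nat \<Rightarrow> 'a \<Rightarrow> 'a" and A :: "nat \<Rightarrow> 'a \<Rightarrow> 'a" and u :: "nat \<Rightarrow> 'a \<Rightarrow> complex"
  assumes S: "open S" "x0 \<in> S" and a: "\<And>j x. (a j has_derivative A j) (at x)"
    and u: "\<And>k. u k \<in> Csmooth S" and u0: "\<And>k. u k x0 = 0"
    and du: "\<And>j k. j < 3 \<Longrightarrow> k < 3 \<Longrightarrow> vfield S (a j) (u k) x0 = (if j = k then 1 else 0)"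
begin

definition word :: "nat list \<Rightarrow> ('a \<Rightarrow> complex) \<Rightarrow> 'a \<Rightarrow> complex" where
  "word js = foldr (\<lambda>j. vfield S (a j)) js"

definition test :: "('a \<Rightarrow> complex) \<Rightarrow> nat \<Rightarrow> nat \<Rightarrow> nat \<Rightarrow> 'a \<Rightarrow> complex" where
  "test w p q r = (\<lambda>x. w x * u 0 x ^ p * u 1 x ^ q * u 2 x ^ r)"

lemma vf_mem: "f \<in> Csmooth S \<Longrightarrow> vfield S (a j) f \<in> Csmooth S"
  by (rule vfield_Csmooth[OF S(1) a])

lemma mult_pow_mem: "w \<in> Csmooth S \<Longrightarrow> (\<lambda>x. w x * u k x ^ n) \<in> Csmooth S"
proof (induction n)
  case (Suc n)
  have "(\<lambda>x. (w x * u k x ^ n) * u k x) \<in> Csmooth S"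
    by (rule Csmooth_mult[OF S(1) Suc.IH[OF Suc.prems] u])
  then show ?case by (simp add: mult_ac)
qed simp

lemma test_mem: "w \<in> Csmooth S \<Longrightarrow> test w p q r \<in> Csmooth S"
  unfolding test_def by (intro mult_pow_mem)

lemma vfield_mult_pow:
  assumes "w \<in> Csmooth S"
  shows "vfield S (a j) (\<lambda>x. w x * u k x ^ n) = (\<lambda>x. vfield S (a j) w x * u k x ^ n
    + of_nat n * (w x * vfield S (a j) (u k) x * u k x ^ (n - 1)))"
proof (induction n)
  case (Suc n)
  have "vfield S (a j) (\<lambda>x. (w x * u k x ^ n) * u k x) =
      (\<lambda>x. (w x * u k x ^ n) * vfield S (a j) (u k) x + vfield S (a j) (\<lambda>x. w x * u k x ^ n) x * u k x)"
    by (rule vfield_mult[OF mult_pow_mem[OF assms] u])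
  with Suc show ?case
    by (cases n) (auto simp: fun_eq_iff algebra_simps)
qed simp

lemma vfield_test:
  assumes w: "w \<in> Csmooth S"
  shows "vfield S (a j) (test w p q r) = (\<lambda>x. test (vfield S (a j) w) p q r x
    + of_nat p * test (\<lambda>x. w x * vfield S (a j) (u 0) x) (p - 1) q r x
    + of_nat q * test (\<lambda>x. w x * vfield S (a j) (u 1) x) p (q - 1) r x
    + of_nat r * test (\<lambda>x. w x * vfield S (a j) (u 2) x) p q (r - 1) x)"
  unfolding test_def vfield_mult_pow[OF mult_pow_mem[OF mult_pow_mem[OF w]]]
    vfield_mult_pow[OF mult_pow_mem[OF w]] vfield_mult_pow[OF w]
  by (simp add: fun_eq_iff algebra_simps)

lemma word_sum:
  assumes "f1 \<in> Csmooth S" "f2 \<in> Csmooth S" "f3 \<in> Csmooth S" "f4 \<in> Csmooth S"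
  shows "word js (\<lambda>x. f1 x + c2 * f2 x + c3 * f3 x + c4 * f4 x) =
    (\<lambda>x. word js f1 x + c2 * word js f2 x + c3 * word js f3 x + c4 * word js f4 x)
    \<and> word js f1 \<in> Csmooth S \<and> word js f2 \<in> Csmooth S \<and> word js f3 \<in> Csmooth S \<and> word js f4 \<in> Csmooth S"
proof (induction js)
  case (Cons j js)
  then show ?case
    by (simp add: word_def vfield_add vfield_cmult Csmooth_add Csmooth_cmult vf_mem S(1))
qed (use assms in \<open>simp add: word_def\<close>)

text \<open>At \<open>x0\<close> every factor \<open>u k\<close> must be differentiated, and a word
  of length at most p + q + r can do this only by spending each letter on a factor of its own index.
  Hence only letter counts matter, not their order.\<close>

lemma word_test:
  assumes "w \<in> Csmooth S" "set js \<subseteq> {0, 1, 2}" "length js \<le> p + q + r"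
  shows "word js (test w p q r) x0 =
    (if count (mset js) 0 = p \<and> count (mset js) 1 = q \<and> count (mset js) 2 = r
     then w x0 * fact p * fact q * fact r else 0)"
  using assms
proof (induction js arbitrary: w p q r rule: rev_induct)
  case Nil
  then show ?case
    by (auto simp: word_def test_def u0)
next
  case (snoc j js)
  define w' where "w' k x = w x * vfield S (a j) (u k) x" for k x
  have w': "w' k \<in> Csmooth S" for k
    unfolding w'_def[abs_def] by (intro Csmooth_mult S(1) snoc.prems vf_mem u)
  have dw: "vfield S (a j) w \<in> Csmooth S"
    by (rule vf_mem[OF snoc.prems(1)])
  have j: "j < 3" and js: "set js \<subseteq> {0, 1, 2}" and len: "Suc (length js) \<le> p + q + r"
    using snoc.prems by auto
  have w'0: "w' k x0 = (if j = k then w x0 else 0)" if "k < 3" for k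
    using du[OF j that] by (simp add: w'_def)
  have cnt: "count (mset js) 0 + count (mset js) 1 + count (mset js) 2 = length js"
  proof -
    have "(\<Sum>b<length js. (\<lambda>_. 1 :: complex) (js ! b)) = of_nat (count (mset js) 0) * 1
        + of_nat (count (mset js) 1) * 1 + of_nat (count (mset js) 2) * 1"
      by (rule sum_tags[OF js])
    then have "of_nat (count (mset js) 0 + count (mset js) 1 + count (mset js) 2) = (of_nat (length js) :: complex)"
      by simp
    then show ?thesis unfolding of_nat_eq_iff .
  qed
  have "word (js @ [j]) (test w p q r) x0 = word js (vfield S (a j) (test w p q r)) x0"
    by (simp add: word_def)
  also have "\<dots> = word js (test (vfield S (a j) w) p q r) x0
      + of_nat p * word js (test (w' 0) (p - 1) q r) x0
      + of_nat q * word js (test (w' 1) p (q - 1) r) x0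
      + of_nat r * word js (test (w' 2) p q (r - 1)) x0"
    unfolding vfield_test[OF snoc.prems(1)] w'_def[symmetric]
    by (simp add: word_sum[THEN conjunct1] test_mem w' dw)
  \<comment> \<open>A derivative falling on \<open>w\<close> leaves fewer letters than factors, so
    the counts cannot match.\<close>
  also have "word js (test (vfield S (a j) w) p q r) x0 = 0"
    using snoc.IH[OF dw js, of p q r] len cnt by auto
  also have "of_nat p * word js (test (w' 0) (p - 1) q r) x0 =
      (if j = 0 \<and> Suc (count (mset js) 0) = p \<and> count (mset js) 1 = q \<and> count (mset js) 2 = r
       then w x0 * fact p * fact q * fact r else 0)"
    using snoc.IH[OF w' js, of "p - 1" q r 0] len w'0[of 0]
    by (cases p) (auto simp: algebra_simps)
  also have "of_nat q * word js (test (w' 1) p (q - 1) r) x0 =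
      (if j = 1 \<and> count (mset js) 0 = p \<and> Suc (count (mset js) 1) = q \<and> count (mset js) 2 = r
       then w x0 * fact p * fact q * fact r else 0)"
    using snoc.IH[OF w' js, of p "q - 1" r 1] len w'0[of 1]
    by (cases q) (auto simp: algebra_simps)
  also have "of_nat r * word js (test (w' 2) p q (r - 1)) x0 =
      (if j = 2 \<and> count (mset js) 0 = p \<and> count (mset js) 1 = q \<and> Suc (count (mset js) 2) = r
       then w x0 * fact p * fact q * fact r else 0)"
    using snoc.IH[OF w' js, of p q "r - 1" 2] len w'0[of 2]
    by (cases r) (auto simp: algebra_simps)
  finally show ?case
    using snoc.prems(2) by auto
qed

end

section \<open>Sections of the principal series with prescribed jets\<close>

definition minor :: "3 \<Rightarrow> 3 \<Rightarrow> real^3^3 \<Rightarrow> real" where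
  "minor r s g = g$r$1 * g$s$2 - g$s$1 * g$r$2"

text \<open>With \<open>norm2\<close>, the squared length of the first column and of the wedge of
  the first two columns: positive on GL, and rescaled by squares under right multiplication by upper
  triangular matrices.\<close>

definition norm1 :: "real^3^3 \<Rightarrow> real" where
  "norm1 g = (g$1$1)\<^sup>2 + (g$2$1)\<^sup>2 + (g$3$1)\<^sup>2"

definition norm2 :: "real^3^3 \<Rightarrow> real" where
  "norm2 g = (minor 1 2 g)\<^sup>2 + (minor 1 3 g)\<^sup>2 + (minor 2 3 g)\<^sup>2"

lemma norm1_pos: "g \<in> GL \<Longrightarrow> norm1 g > 0"
proof (rule ccontr)
  assume g: "g \<in> GL" and "\<not> norm1 g > 0"
  then have "(g$1$1)\<^sup>2 + (g$2$1)\<^sup>2 + (g$3$1)\<^sup>2 = 0"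
    unfolding norm1_def by (smt (verit) zero_le_power2)
  then have "g$1$1 = 0 \<and> g$2$1 = 0 \<and> g$3$1 = 0"
    by (smt (verit) zero_le_power2 zero_eq_power2)
  then show False
    using g by (simp add: GL_iff_det det_3)
qed

lemma norm2_pos: "g \<in> GL \<Longrightarrow> norm2 g > 0"
proof (rule ccontr)
  assume g: "g \<in> GL" and "\<not> norm2 g > 0"
  then have "(minor 1 2 g)\<^sup>2 + (minor 1 3 g)\<^sup>2 + (minor 2 3 g)\<^sup>2 = 0"
    unfolding norm2_def by (smt (verit) zero_le_power2)
  then have "minor 1 2 g = 0 \<and> minor 1 3 g = 0 \<and> minor 2 3 g = 0"
    by (smt (verit) zero_le_power2 zero_eq_power2)
  \<comment> \<open>Laplace expansion along the third column.\<close>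
  moreover have "det g = g$1$3 * minor 2 3 g - g$2$3 * minor 1 3 g + g$3$3 * minor 1 2 g"
    by (simp add: det_3 minor_def algebra_simps)
  ultimately show False
    using g by (simp add: GL_iff_det)
qed

lemma smooth_on_entry: "smooth_on S (\<lambda>g::real^3^3. complex_of_real (g$r$c))"
proof -
  have "linear (\<lambda>g::real^3^3. complex_of_real (g$r$c))"
    by (rule linearI) (simp_all add: scaleR_conv_of_real[where 'a = complex])
  then show ?thesis
    by (intro smooth_on_bounded_linear) (simp add: linear_conv_bounded_linear)
qed

lemmas smooth_on_poly = smooth_on_add smooth_on_diff smooth_on_mult smooth_on_power smooth_on_entry open_GL

lemma smooth_on_minor: "smooth_on GL (\<lambda>g. complex_of_real (minor r s g))"
  unfolding minor_def of_real_diff of_real_mult by (intro smooth_on_poly)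

lemma smooth_on_norm1: "smooth_on GL (\<lambda>g. complex_of_real (norm1 g))"
  unfolding norm1_def of_real_add of_real_power by (intro smooth_on_poly)

lemma smooth_on_norm2: "smooth_on GL (\<lambda>g. complex_of_real (norm2 g))"
  unfolding norm2_def of_real_add of_real_power by (intro smooth_on_poly smooth_on_minor)

lemma smooth_on_det: "smooth_on GL (\<lambda>g::real^3^3. complex_of_real (det g))"
  unfolding det_3 of_real_diff of_real_add of_real_mult by (intro smooth_on_poly)

lemma smooth_on_det_sq: "smooth_on GL (\<lambda>g::real^3^3. complex_of_real ((det g)\<^sup>2))"
  unfolding of_real_power by (intro smooth_on_poly smooth_on_det)

lemma prod_UNIV_3: "prod f (UNIV :: 3 set) = f 1 * f 2 * f 3"
  unfolding UNIV_3 by (simp add: mult.assoc)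

text \<open>The span of the first k columns is preserved, so the wedge of these columns is only
  multiplied by the first k diagonal entries.\<close>

lemma upper_triangular_action:
  fixes g n :: "real^3^3"
  assumes n: "n \<in> unip3" and d: "\<And>j. d$j = m$j * a$j"
  defines "g' \<equiv> g ** diag_mat m ** diag_mat a ** n"
  shows "g'$r$1 = d$1 * g$r$1" "minor r s g' = d$1 * d$2 * minor r s g" "det g' = d$1 * d$2 * d$3 * det g"
proof -
  have g': "g' = g ** diag_mat d ** n"
  proof -
    have "(\<chi> j. m$j * a$j) = d"
      by (simp add: vec_eq_iff d)
    then show ?thesis
      unfolding g'_def by (simp add: diag_mat_mult flip: matrix_mul_assoc)
  qed
  have 1: "g'$r$1 = d$1 * g$r$1" for r
    using n by (simp add: g' matrix_matrix_mult_def[of _ n] sum_3 diag_mat_mult_right unip3_def)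
  then show "g'$r$1 = d$1 * g$r$1" .
  have 2: "g'$r$2 = d$2 * g$r$2 + n$1$2 * (d$1 * g$r$1)" for r
    using n by (simp add: g' matrix_matrix_mult_def[of _ n] sum_3 diag_mat_mult_right unip3_def)
  show "minor r s g' = d$1 * d$2 * minor r s g"
    by (simp add: minor_def 1 2 algebra_simps)
  have "det (diag_mat d) = d$1 * d$2 * d$3"
    by (simp add: det_diag_mat prod_UNIV_3)
  then show "det g' = d$1 * d$2 * d$3 * det g"
    using n by (simp add: g' det_mul det_unip3)
qed

text \<open>Homogeneous of complex degree \<open>y\<close> under P -> t P, \<rho> -> t^2 \<rho>,
  with parity \<open>e\<close> in the sign of P. The natural power of P keeps it smooth where P
  vanishes; the positive \<rho> carries the rest of the degree.\<close>

definition block :: "complex \<Rightarrow> nat \<Rightarrow> real \<Rightarrow> real \<Rightarrow> complex" where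
  "block y e P \<rho> = complex_of_real P ^ e * complex_of_real \<rho> powr ((y - of_nat e) / 2)"

lemma block_scale:
  assumes "t > 0" "\<rho> > 0"
  shows "block y e (s * t * P) (t\<^sup>2 * \<rho>) = complex_of_real s ^ e * complex_of_real t powr y * block y e P \<rho>"
proof -
  have t: "complex_of_real t = exp (complex_of_real (ln t))"
    using assms by (metis exp_ln exp_of_real)
  have "t\<^sup>2 * \<rho> > 0" using assms by simp
  have "ln (t\<^sup>2 * \<rho>) = 2 * ln t + ln \<rho>"
    using assms by (simp add: ln_mult ln_realpow)
  then have L: "Ln (complex_of_real (t\<^sup>2 * \<rho>)) = 2 * complex_of_real (ln t) + complex_of_real (ln \<rho>)"
    unfolding Ln_of_real[OF \<open>t\<^sup>2 * \<rho> > 0\<close>] by simp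
  have "complex_of_real (t\<^sup>2 * \<rho>) powr z = exp (z * (2 * complex_of_real (ln t))) * complex_of_real \<rho> powr z" for z
  proof -
    have "complex_of_real (t\<^sup>2 * \<rho>) powr z = exp (z * Ln (complex_of_real (t\<^sup>2 * \<rho>)))"
      using \<open>t\<^sup>2 * \<rho> > 0\<close> unfolding powr_def by auto
    then show ?thesis
      using assms unfolding L by (simp add: powr_def Ln_of_real exp_add[symmetric] algebra_simps)
  qed
  moreover have "complex_of_real t powr y = exp ((y - of_nat e) / 2 * (2 * complex_of_real (ln t))) * complex_of_real t ^ e"
  proof -
    have "complex_of_real t ^ e = exp (of_nat e * complex_of_real (ln t))"
      by (subst t) (simp add: exp_of_nat_mult)
    then show ?thesis
      using assms by (simp add: powr_def Ln_of_real exp_add[symmetric] field_simps)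
  qed
  ultimately show ?thesis
    by (simp add: block_def power_mult_distrib)
qed

definition bit_nat :: "bit \<Rightarrow> nat" where
  "bit_nat e = (if e = 0 then 0 else 1)"

text \<open>The three blocks are rescaled by d_1, d_1 d_2, d_1 d_2 d_3. The degrees telescope to the
  exponents - lam_j and the parities telescope modulo 2 to \<xi>_j. The value at the identity is
  1.\<close>

definition base_section :: "bit^3 \<Rightarrow> complex^3 \<Rightarrow> real^3^3 \<Rightarrow> complex" where
  "base_section \<xi> lam g = (if g \<in> GL then
     block (lam$2 - lam$1) (bit_nat (\<xi>$1) + bit_nat (\<xi>$2)) (g$1$1) (norm1 g) *
     block (lam$3 - lam$2) (bit_nat (\<xi>$2) + bit_nat (\<xi>$3)) (minor 1 2 g) (norm2 g) *
     block (- (lam$3)) (bit_nat (\<xi>$3)) (det g) ((det g)\<^sup>2) else 0)"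

text \<open>The flag coordinates g_21 / g_11, minor 13 / minor 12 and g_31 / g_11 have poles.
  Multiplying numerator by denominator and dividing by \<open>norm1\<close> or \<open>norm2\<close>
  gives functions smooth on GL, still invariant on the right, with the same first jet at the
  identity.\<close>

definition coord_num :: "nat \<Rightarrow> real^3^3 \<Rightarrow> real" where
  "coord_num k g = (if k = 0 then g$2$1 * g$1$1 else if k = 1 then minor 1 2 g * minor 1 3 g
     else g$3$1 * g$1$1)"

definition coord_den :: "nat \<Rightarrow> real^3^3 \<Rightarrow> real" where
  "coord_den k g = (if k = 1 then norm2 g else norm1 g)"

definition coord :: "nat \<Rightarrow> real^3^3 \<Rightarrow> complex" where
  "coord k g = (if g \<in> GL
     then complex_of_real (coord_num k g) * complex_of_real (coord_den k g) powr (- 1) else 0)"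

lemma cut_Csmooth:
  "smooth_on GL f \<Longrightarrow> (\<lambda>g. if g \<in> GL then f g else 0) \<in> Csmooth GL"
  by (auto simp: Csmooth_def intro: smooth_on_cong[OF open_GL])

lemma pos_not_nonpos: "x > 0 \<Longrightarrow> complex_of_real x \<notin> \<real>\<^sub>\<le>\<^sub>0"
  by (auto simp: complex_nonpos_Reals_iff)

lemma base_section_mem: "base_section \<xi> lam \<in> Csmooth GL"
  unfolding base_section_def[abs_def] block_def
  by (intro cut_Csmooth smooth_on_mult smooth_on_power smooth_on_powr smooth_on_entry smooth_on_minor
      smooth_on_det smooth_on_det_sq smooth_on_norm1 smooth_on_norm2 open_GL pos_not_nonpos norm1_pos norm2_pos)
     (simp_all add: GL_iff_det)

lemma smooth_on_coord_num: "smooth_on GL (\<lambda>g. complex_of_real (coord_num k g))"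
proof -
  have "smooth_on GL (\<lambda>g::real^3^3. complex_of_real (g$r$1 * g$1$1))" for r
    unfolding of_real_mult by (intro smooth_on_poly)
  moreover have "smooth_on GL (\<lambda>g. complex_of_real (minor 1 2 g * minor 1 3 g))"
    unfolding of_real_mult by (intro smooth_on_mult smooth_on_minor open_GL)
  ultimately show ?thesis
    unfolding coord_num_def by (cases "k = 0"; cases "k = 1") (simp_all del: of_real_mult)
qed

lemma coord_den_pos: "g \<in> GL \<Longrightarrow> coord_den k g > 0"
  by (simp add: coord_den_def norm1_pos norm2_pos)

lemma smooth_on_coord_den: "smooth_on GL (\<lambda>g. complex_of_real (coord_den k g) powr (- 1))"
proof -
  have "smooth_on GL (\<lambda>g. complex_of_real (coord_den k g))"
    unfolding coord_den_def using smooth_on_norm1 smooth_on_norm2 by (cases "k = 1") simp_all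
  then show ?thesis
    by (intro smooth_on_powr open_GL pos_not_nonpos coord_den_pos)
qed

lemma coord_mem: "coord k \<in> Csmooth GL"
  unfolding coord_def[abs_def]
  by (intro cut_Csmooth smooth_on_mult smooth_on_coord_num smooth_on_coord_den open_GL)

lemma sign_pow_power: "m \<in> {1, -1} \<Longrightarrow> complex_of_real m ^ (bit_nat e + 2 * k) = sign_pow e m"
  by (auto simp: bit_nat_def sign_pow_def power_add power_mult)

lemma coord_action:
  assumes g: "g \<in> GL" and n: "n \<in> unip3" and m: "\<forall>j. m$j \<in> {1, -1}" and a: "\<forall>j. a$j > (0::real)"
  shows "coord k (g ** diag_mat m ** diag_mat a ** n) = coord k g"
    and "base_section \<xi> lam (g ** diag_mat m ** diag_mat a ** n) = (\<Prod>j\<in>UNIV. sign_pow (\<xi>$j) (m$j)) *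
      (\<Prod>j\<in>UNIV. complex_of_real (a$j) powr (- (lam$j))) * base_section \<xi> lam g"
proof -
  define g' where "g' = g ** diag_mat m ** diag_mat a ** n"
  define d where "d = (\<chi> j. m$j * a$j)"
  have d: "d$j = m$j * a$j" for j by (simp add: d_def)
  note act = upper_triangular_action[OF n d, where g = g, folded g'_def]
  have m2: "(m$j)\<^sup>2 = 1" for j
    using m[rule_format, of j] by auto
  have ap: "a$j > 0" for j using a by simp
  have n1: "norm1 g' = (a$1)\<^sup>2 * norm1 g"
    by (simp add: norm1_def act d power_mult_distrib m2 algebra_simps)
  have n2: "norm2 g' = (a$1 * a$2)\<^sup>2 * norm2 g"
    by (simp add: norm2_def act d power_mult_distrib m2 algebra_simps)
  have n3: "(det g')\<^sup>2 = (a$1 * a$2 * a$3)\<^sup>2 * (det g)\<^sup>2"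
    by (simp add: act d power_mult_distrib m2 algebra_simps)
  have "det g' \<noteq> 0"
    using g ap m by (simp add: act d GL_iff_det) (metis insert_iff less_numeral_extra(3) neg_equal_0_iff_equal singletonD zero_neq_one)
  then have g': "g' \<in> GL" by (simp add: GL_iff_det)
  have inv: "complex_of_real (t\<^sup>2 * \<rho>) powr (- 1) = complex_of_real (1 / t\<^sup>2) * complex_of_real \<rho> powr (- 1)"
    if "t > 0" "\<rho> > 0" for t \<rho> :: real
    using that by (simp add: powr_minus powr_one inverse_eq_divide)
  have e1: "g'$r$1 * g'$1$1 = (a$1)\<^sup>2 * (g$r$1 * g$1$1)" for r
    using m2[of 1] by (simp add: act d power2_eq_square algebra_simps)
  have e2: "minor 1 2 g' * minor 1 3 g' = (a$1 * a$2)\<^sup>2 * (minor 1 2 g * minor 1 3 g)"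
    using m2[of 1] m2[of 2] by (simp add: act d power2_eq_square algebra_simps)
  have c: "complex_of_real (t\<^sup>2 * z) * (complex_of_real (1 / t\<^sup>2) * y) = complex_of_real z * y"
    if "t > 0" for t z :: real and y
    using that by simp
  show "coord k (g ** diag_mat m ** diag_mat a ** n) = coord k g"
  proof -
    have s: "\<exists>t>0. coord_num k g' = t\<^sup>2 * coord_num k g \<and> coord_den k g' = t\<^sup>2 * coord_den k g"
      using ap[of 1] ap[of 2] unfolding coord_num_def coord_den_def e1 e2 n1 n2
      by (intro exI[of _ "if k = 1 then a$1 * a$2 else a$1"]) simp
    then show ?thesis
      unfolding g'_def[symmetric] coord_def if_P[OF g] if_P[OF g']
      using coord_den_pos[OF g, of k] by (auto simp only: inv c)
  qed
  have P1: "g'$1$1 = m$1 * a$1 * g$1$1"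
    by (simp add: act d)
  have P2: "minor 1 2 g' = (m$1 * m$2) * (a$1 * a$2) * minor 1 2 g"
    by (simp add: act d)
  have P3: "det g' = (m$1 * m$2 * m$3) * (a$1 * a$2 * a$3) * det g"
    by (simp add: act d)
  define k1 k2 k3 where "k1 = bit_nat (\<xi>$1)" "k2 = bit_nat (\<xi>$2)" "k3 = bit_nat (\<xi>$3)"
  define M where "M j = complex_of_real (m$j)" for j
  define p where "p j y = complex_of_real (a$j) powr y" for j y
  have "det g \<noteq> 0" using g by (simp add: GL_iff_det)
  have b1: "block y e (m$1 * a$1 * P) ((a$1)\<^sup>2 * norm1 g) =
      M 1 ^ e * complex_of_real (a$1) powr y * block y e P (norm1 g)" for y e P
    unfolding M_def by (rule block_scale) (use ap norm1_pos[OF g] in auto)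
  have b2: "block y e ((m$1 * m$2) * (a$1 * a$2) * P) ((a$1 * a$2)\<^sup>2 * norm2 g) =
      (M 1 * M 2) ^ e * complex_of_real (a$1 * a$2) powr y * block y e P (norm2 g)" for y e P
    unfolding M_def of_real_mult[symmetric] by (rule block_scale) (use ap norm2_pos[OF g] in auto)
  have b3: "block y e ((m$1 * m$2 * m$3) * (a$1 * a$2 * a$3) * P) ((a$1 * a$2 * a$3)\<^sup>2 * (det g)\<^sup>2) =
      (M 1 * M 2 * M 3) ^ e * complex_of_real (a$1 * a$2 * a$3) powr y * block y e P ((det g)\<^sup>2)" for y e P
    unfolding M_def of_real_mult[symmetric] by (rule block_scale) (use ap \<open>det g \<noteq> 0\<close> in auto)
  have "base_section \<xi> lam g' =
      (M 1 ^ (k1 + k2) * complex_of_real (a$1) powr (lam$2 - lam$1)) *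
      ((M 1 * M 2) ^ (k2 + k3) * complex_of_real (a$1 * a$2) powr (lam$3 - lam$2)) *
      ((M 1 * M 2 * M 3) ^ k3 * complex_of_real (a$1 * a$2 * a$3) powr (- (lam$3))) * base_section \<xi> lam g"
    unfolding base_section_def if_P[OF g] if_P[OF g'] n3 unfolding P1 n1 P2 n2 P3 b1 b2 b3
    by (simp only: k1_k2_k3_def mult_ac)
  also have "complex_of_real (a$1 * a$2 * a$3) powr (- (lam$3)) = p 1 (- (lam$3)) * p 2 (- (lam$3)) * p 3 (- (lam$3))"
    using ap[of 1] ap[of 2] ap[of 3] by (simp add: p_def powr_times_real)
  also have "complex_of_real (a$1 * a$2) powr (lam$3 - lam$2) = p 1 (lam$3 - lam$2) * p 2 (lam$3 - lam$2)"
    using ap[of 1] ap[of 2] by (simp add: p_def powr_times_real)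
  \<comment> \<open>The surplus sign exponents are even and are dropped by
    \<open>sign_pow_power\<close>; the real powers of each a_j are collected for
    telescoping.\<close>
  also have "(M 1 ^ (k1 + k2) * complex_of_real (a$1) powr (lam$2 - lam$1)) *
      ((M 1 * M 2) ^ (k2 + k3) * (p 1 (lam$3 - lam$2) * p 2 (lam$3 - lam$2))) *
      ((M 1 * M 2 * M 3) ^ k3 * (p 1 (- (lam$3)) * p 2 (- (lam$3)) * p 3 (- (lam$3)))) =
      (M 1 ^ (k1 + 2 * (k2 + k3)) * M 2 ^ (k2 + 2 * k3) * M 3 ^ (k3 + 2 * 0)) *
      ((p 1 (lam$2 - lam$1) * p 1 (lam$3 - lam$2) * p 1 (- (lam$3))) * (p 2 (lam$3 - lam$2) * p 2 (- (lam$3))) * p 3 (- (lam$3)))"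
    unfolding mult_2 p_def by (simp only: power_mult_distrib power_add power_0 mult_1_left mult_1_right mult_ac)
  also have "p 1 (lam$2 - lam$1) * p 1 (lam$3 - lam$2) * p 1 (- (lam$3)) = p 1 (- (lam$1))"
    by (simp add: p_def flip: powr_add)
  also have "p 2 (lam$3 - lam$2) * p 2 (- (lam$3)) = p 2 (- (lam$2))"
    by (simp add: p_def flip: powr_add)
  also have "M 1 ^ (k1 + 2 * (k2 + k3)) * M 2 ^ (k2 + 2 * k3) * M 3 ^ (k3 + 2 * 0) =
      (\<Prod>j\<in>UNIV. sign_pow (\<xi>$j) (m$j))"
    unfolding M_def k1_k2_k3_def using m by (simp only: sign_pow_power prod_UNIV_3)
  finally show "base_section \<xi> lam (g ** diag_mat m ** diag_mat a ** n) = (\<Prod>j\<in>UNIV. sign_pow (\<xi>$j) (m$j)) *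
      (\<Prod>j\<in>UNIV. complex_of_real (a$j) powr (- (lam$j))) * base_section \<xi> lam g"
    unfolding g'_def[symmetric] p_def by (simp only: prod_UNIV_3 mult_ac)
qed

section \<open>Sections dual to the ordered monomials at the identity\<close>

definition low_mat :: "nat \<Rightarrow> real^3^3" where
  "low_mat j = (if j = 0 then elem_mat 2 1 else if j = 1 then elem_mat 3 2 else elem_mat 3 1)"

lemma mat_one_entries [simp]: "(mat 1 :: real^'n::finite^'n) $ r $ c = (if r = c then 1 else 0)"
  by (simp add: mat_def)

text \<open>The numerator vanishes at the identity and the denominator is 1 there, so only the
  derivative of the numerator contributes.\<close>

lemma coord_deriv:
  assumes "j < 3" "k < 3"
  shows "right_deriv (low_mat j) (coord k) (mat 1) = (if j = k then 1 else 0)"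
proof -
  define P R where "P = coord_num k" "R = coord_den k"
  have P: "smooth_on GL (\<lambda>g. complex_of_real (P g))"
    and R: "smooth_on GL (\<lambda>g. complex_of_real (R g) powr (- 1))"
    unfolding P_R_def by (rule smooth_on_coord_num smooth_on_coord_den)+
  have P0: "P (mat 1) = 0"
    by (simp add: P_R_def coord_num_def minor_def)
  have R0: "complex_of_real (R (mat 1)) powr (- 1) = 1"
    by (simp add: P_R_def coord_den_def norm1_def norm2_def minor_def)
  \<comment> \<open>On this line every numerator is exactly \<open>s\<close> or 0, so its derivative
    is read off without expanding it.\<close>
  have curve: "P (mat 1 + s *\<^sub>R low_mat j) = (if j = k then s else 0)" for s
    using assms by (auto simp: P_R_def coord_num_def low_mat_def minor_def elem_mat_def)
  have "((\<lambda>s. complex_of_real (P (mat 1 + s *\<^sub>R low_mat j))) has_vector_derivative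
      dderiv (low_mat j) (\<lambda>g. complex_of_real (P g)) (mat 1)) (at 0)"
  proof -
    have "((\<lambda>s. mat 1 + s *\<^sub>R low_mat j) has_vector_derivative low_mat j) (at 0)"
      by (auto intro!: derivative_eq_intros simp: has_vector_derivative_def)
    from dderiv_curve[OF this, of "\<lambda>g. complex_of_real (P g)"] show ?thesis
      using smooth_on_differentiable[OF P GL_one] by simp
  qed
  moreover have "((\<lambda>s. complex_of_real (P (mat 1 + s *\<^sub>R low_mat j))) has_vector_derivative
      (if j = k then 1 else 0)) (at 0)"
    unfolding curve by (cases "j = k") (auto intro!: derivative_eq_intros has_vector_derivative_real_field)
  ultimately have dP: "dderiv (low_mat j) (\<lambda>g. complex_of_real (P g)) (mat 1) = (if j = k then 1 else 0)"
    using vector_derivative_unique_at by blast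
  have "dderiv (low_mat j) (coord k) (mat 1) =
      dderiv (low_mat j) (\<lambda>g. complex_of_real (P g) * complex_of_real (R g) powr (- 1)) (mat 1)"
    by (rule dderiv_cong_open[OF open_GL GL_one]) (simp add: coord_def P_R_def)
  also have "\<dots> = (if j = k then 1 else 0)"
    using smooth_on_differentiable[OF P GL_one] smooth_on_differentiable[OF R GL_one]
    by (subst dderiv_mult) (simp_all add: P0 R0 dP)
  finally show ?thesis
    by (simp add: right_deriv_eq)
qed

interpretation jets: local_coordinates GL "mat 1" "\<lambda>j g. g ** low_mat j" "\<lambda>j v. v ** low_mat j" coord
proof
  show "coord k (mat 1) = 0" for k
    by (simp add: coord_def coord_num_def minor_def)
  show "vfield GL (\<lambda>g. g ** low_mat j) (coord k) (mat 1) = (if j = k then 1 else 0)" if "j < 3" "k < 3" for j k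
    using coord_deriv[OF that] by (simp add: right_deriv_def)
qed (auto intro: open_GL coord_mem has_derivative_matrix_mult_right)

lemma test_I_series: "jets.test (base_section \<xi> lam) p q r \<in> I_series \<xi> lam"
proof -
  have "jets.test (base_section \<xi> lam) p q r \<in> Csmooth GL"
    by (rule jets.test_mem[OF base_section_mem])
  then show ?thesis
    unfolding I_series_def principal_series_def Csmooth_def
    by (auto simp: jets.test_def coord_action)
qed

lemma base_section_one: "base_section \<xi> lam (mat 1) = 1"
  by (simp add: base_section_def block_def norm1_def norm2_def minor_def)

lemma mon_word: "GH.mon p q r = jets.word (replicate p 0 @ replicate q 1 @ replicate r 2)"
proof
  have foldr_replicate: "foldr (\<lambda>j. F j) (replicate n j) x = (F j ^^ n) x" for F :: "nat \<Rightarrow> 'b \<Rightarrow> 'b" and n j x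
    by (induction n) auto
  fix f :: "real^3^3 \<Rightarrow> complex"
  show "GH.mon p q r f = jets.word (replicate p 0 @ replicate q 1 @ replicate r 2) f"
    unfolding GH.mon_def jets.word_def foldr_append foldr_replicate
    by (simp add: low_mat_def right_deriv_def)
qed

text \<open>A monomial \<open>l\<close> of maximal degree among those with nonzero coefficient is
  tested on the section dual to it. All other monomials present are words of at most that length
  with different letter counts and vanish there by \<open>word_test\<close>.\<close>

lemma mon_nondegenerate:
  fixes b :: "nat \<times> nat \<times> nat \<Rightarrow> complex"
  assumes K: "finite K"
    and zero: "\<And>f. f \<in> I_series \<xi> lam \<Longrightarrow> (\<Sum>(p, q, r)\<in>K. b (p, q, r) * GH.mon p q r f (mat 1)) = 0"
    and k: "k \<in> K"
  shows "b k = 0"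
proof (rule ccontr)
  assume "b k \<noteq> 0"
  define deg where "deg = (\<lambda>(p, q, r). p + q + r :: nat)"
  define K' where "K' = {k \<in> K. b k \<noteq> 0}"
  have "finite K'" "k \<in> K'"
    using K k \<open>b k \<noteq> 0\<close> by (auto simp: K'_def)
  then obtain l where l: "l \<in> K'" "\<And>k. k \<in> K' \<Longrightarrow> deg k \<le> deg l"
    using Max_in[of "deg ` K'"] Max_ge[of "deg ` K'"] by fastforce
  obtain p q r where pqr: "l = (p, q, r)" by (cases l)
  define f where "f = jets.test (base_section \<xi> lam) p q r"
  have "b (p', q', r') * GH.mon p' q' r' f (mat 1) =
      (if (p', q', r') = l then b l * (fact p * fact q * fact r) else 0)" if "(p', q', r') \<in> K" for p' q' r'
  proof (cases "b (p', q', r') = 0")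
    case True
    then show ?thesis
      using l by (auto simp: K'_def)
  next
    case False
    then have "deg (p', q', r') \<le> deg l"
      using that by (intro l) (simp add: K'_def)
    then have "GH.mon p' q' r' f (mat 1) = (if p' = p \<and> q' = q \<and> r' = r
        then base_section \<xi> lam (mat 1) * fact p * fact q * fact r else 0)"
      unfolding mon_word f_def
      by (subst jets.word_test[OF base_section_mem]) (auto simp: deg_def pqr)
    then show ?thesis
      by (auto simp: pqr base_section_one)
  qed
  then have "(\<Sum>(p, q, r)\<in>K. b (p, q, r) * GH.mon p q r f (mat 1)) =
      (\<Sum>k\<in>K. if k = l then b l * (fact p * fact q * fact r) else 0)"
    by (intro sum.cong) auto
  also have "\<dots> = b l * (fact p * fact q * fact r)"
    using K l by (simp add: K'_def)
  finally have "b l * (fact p * fact q * fact r) = 0"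
    using zero[OF test_I_series] by (simp add: f_def)
  then show False
    using l by (simp add: K'_def)
qed

section \<open>Characters of the diagonal subgroup\<close>

lemma of_int_bit: "(of_int k :: bit) = (if even k then 0 else 1)"
proof -
  have "(of_int (2 * j) :: bit) = 0" for j
    unfolding of_int_mult of_int_numeral by (simp only: bit_2_eq_0 mult_zero_left)
  moreover have "odd k \<Longrightarrow> \<exists>j. k = 2 * j + 1" by (auto elim: oddE)
  ultimately show ?thesis
    by (auto elim!: evenE simp del: of_int_mult add_bit_eq_xor)
qed

lemma prod_UNIV_2: "prod f (UNIV :: 2 set) = f 1 * f 2"
  unfolding UNIV_2 by simp

text \<open>The character of the multiplicative group of the reals by which one diagonal entry m t
  acts, split into sign and absolute value.\<close>

definition torus_char :: "bit \<Rightarrow> complex \<Rightarrow> real \<Rightarrow> real \<Rightarrow> complex" where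
  "torus_char x l m t = sign_pow x m * complex_of_real t powr (- l)"

lemma sign_shift_iff:
  "sign_pow x (- 1) * (if even k then 1 else - 1) = sign_pow y (- 1) \<longleftrightarrow> x + y = of_int k"
  unfolding of_int_bit by (cases "x = 0"; cases "y = 0") (auto simp: sign_pow_def)

lemma power_int_sign:
  assumes "m \<in> {1, -1}" "t > 0"
  shows "complex_of_real ((m * t) powi k) =
    (if m = 1 \<or> even k then 1 else - 1) * complex_of_real t powr of_int k"
proof -
  have t: "complex_of_real t powr of_int k = complex_of_real (t powi k)"
    using assms(2) by (simp add: complex_powr_of_int of_real_power_int)
  show ?thesis
    unfolding t using assms(1) by (auto simp: power_int_minus_left)
qed

lemma torus_char_shift:
  assumes m: "m \<in> {1, -1}" and t: "t > 0" and xy: "x + y = of_int k"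
  shows "complex_of_real ((m * t) powi k) * torus_char x l m t = torus_char y (l - of_int k) m t"
proof -
  have "complex_of_real t powr of_int k * complex_of_real t powr (- l) = complex_of_real t powr (- (l - of_int k))"
    by (simp flip: powr_add)
  moreover have "(if m = 1 \<or> even k then 1 else - 1) * sign_pow x m = sign_pow y m"
    using m sign_shift_iff[of x k y] xy by (auto simp: mult.commute)
  ultimately show ?thesis
    unfolding power_int_sign[OF m t] torus_char_def by (metis mult.assoc mult.left_commute)
qed

text \<open>With t = exp s, differentiating at s = 0 recovers the exponent; a single value of t
  would determine it only up to a period.\<close>

lemma powr_real_inject:
  assumes "\<And>t. t > 0 \<Longrightarrow> complex_of_real t powr z = complex_of_real t powr w"
  shows "z = w"
proof -
  have d: "((\<lambda>s. exp (u * complex_of_real s)) has_vector_derivative u) (at 0)" for u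
    by (rule has_vector_derivative_real_field) (auto intro!: derivative_eq_intros)
  have "(\<lambda>s. exp (z * complex_of_real s)) = (\<lambda>s. exp (w * complex_of_real s))"
    using assms[OF exp_gt_zero] by (simp add: powr_exp)
  with d[of z] d[of w] show ?thesis
    using vector_derivative_unique_at by metis
qed

lemma torus_char_unique:
  assumes "\<And>m t. m \<in> {1, -1} \<Longrightarrow> t > 0 \<Longrightarrow>
    complex_of_real ((m * t) powi k) * torus_char x l m t = torus_char y v m t"
  shows "v = l - of_int k" "x + y = of_int k"
proof -
  have "complex_of_real t powr (of_int k - l) = complex_of_real t powr (- v)" if "t > 0" for t
  proof -
    have "complex_of_real t powr of_int k * complex_of_real t powr (- l) = complex_of_real t powr (- v)"
      using assms[of 1 t] that power_int_sign[of 1 t k] by (simp add: torus_char_def)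
    then show ?thesis by (simp flip: powr_add)
  qed
  from powr_real_inject[OF this] show "v = l - of_int k"
    by (metis minus_diff_eq minus_equation_iff)
  \<comment> \<open>The point m = -1, t = 1 isolates the parity, after m = 1 has given the
    exponent.\<close>
  have "sign_pow x (- 1) * (if even k then 1 else - 1) = sign_pow y (- 1)"
    using assms[of "-1" 1] power_int_sign[of "-1" 1 k] by (auto simp: torus_char_def)
  then show "x + y = of_int k"
    by (simp only: sign_shift_iff)
qed

text \<open>The rows occupied by \<open>iota i\<close>, and the exponents with which the two diagonal entries act on
  the monomial with exponents \<open>p\<close>, \<open>q\<close>, \<open>r\<close>.\<close>

definition idx1 :: "nat \<Rightarrow> 3" where "idx1 i = (if i = 1 then 1 else 2)"

definition idx2 :: "nat \<Rightarrow> 3" where "idx2 i = (if i = 1 then 2 else 3)"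

definition shift1 :: "nat \<Rightarrow> nat \<Rightarrow> nat \<Rightarrow> nat \<Rightarrow> int" where
  "shift1 i p q r = (if i = 1 then - int (p + r) else int p - int q)"

definition shift2 :: "nat \<Rightarrow> nat \<Rightarrow> nat \<Rightarrow> nat \<Rightarrow> int" where
  "shift2 i p q r = (if i = 1 then int p - int q else int (q + r))"

lemma diag_ext_nonzero: "(\<And>j. e$j \<noteq> 0) \<Longrightarrow> diag_ext i e $ j \<noteq> 0"
  using exhaust_3[of j] by (auto simp: diag_ext_def)

lemma diag_ext_factor:
  assumes "\<And>j. e$j \<noteq> 0"
  shows "(diag_ext i e $ 2 / diag_ext i e $ 1) ^ p * (diag_ext i e $ 3 / diag_ext i e $ 2) ^ q *
    (diag_ext i e $ 3 / diag_ext i e $ 1) ^ r = e$1 powi shift1 i p q r * e$2 powi shift2 i p q r"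
proof -
  have d: "x powi (int k - int l) = x ^ k / x ^ l" if "x \<noteq> 0" for x :: real and k l
    using that by (simp add: power_int_diff power_int_of_nat)
  have n: "x powi (- int k) = 1 / x ^ k" for x :: real and k
    by (simp add: power_int_minus power_int_of_nat inverse_eq_divide)
  have p: "x powi int k = x ^ k" for x :: real and k
    by (rule power_int_of_nat)
  show ?thesis
  proof (cases "i = 1")
    case True
    then have v: "diag_ext i e $ 1 = e$1" "diag_ext i e $ 2 = e$2" "diag_ext i e $ 3 = 1"
      by (simp_all add: diag_ext_def)
    have "(e$2 / e$1) ^ p * (1 / e$2) ^ q * (1 / e$1) ^ r = 1 / e$1 ^ (p + r) * (e$2 ^ p / e$2 ^ q)"
      by (simp add: power_divide power_add)
    then show ?thesis
      unfolding v shift1_def shift2_def if_P[OF True] n d[OF assms] .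
  next
    case False
    then have v: "diag_ext i e $ 1 = 1" "diag_ext i e $ 2 = e$1" "diag_ext i e $ 3 = e$2"
      by (simp_all add: diag_ext_def)
    have "(e$1 / 1) ^ p * (e$2 / e$1) ^ q * (e$2 / 1) ^ r = (e$1 ^ p / e$1 ^ q) * e$2 ^ (q + r)"
      by (simp add: power_divide power_add)
    then show ?thesis
      unfolding v shift1_def shift2_def if_not_P[OF False] p d[OF assms] .
  qed
qed

lemma I_series_torus_ext:
  assumes f: "f \<in> I_series \<xi> lam" and g: "g \<in> GL" and m: "\<forall>j. m$j \<in> {1, -1}" and a: "\<forall>j. a$j > 0"
  shows "f (g ** diag_mat (diag_ext i (\<chi> j. m$j * a$j))) =
    torus_char (\<xi> $ idx1 i) (lam $ idx1 i) (m$1) (a$1) * torus_char (\<xi> $ idx2 i) (lam $ idx2 i) (m$2) (a$2) * f g"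
proof -
  have eq: "(\<chi> j. diag_ext i m $ j * diag_ext i a $ j) = diag_ext i (\<chi> j. m$j * a$j)"
    by (simp add: vec_eq_iff forall_3 diag_ext_def)
  have ma: "\<forall>j. diag_ext i m $ j \<in> {1, -1}" "\<forall>j. diag_ext i a $ j > 0"
    using m a by (auto simp: forall_3 forall_2 diag_ext_def)
  have "f (g ** diag_mat (diag_ext i (\<chi> j. m$j * a$j))) = (\<Prod>j\<in>UNIV. sign_pow (\<xi>$j) (diag_ext i m $ j)) *
      (\<Prod>j\<in>UNIV. complex_of_real (diag_ext i a $ j) powr (- (lam$j))) * f g"
    using I_series_torus[OF f g ma] unfolding eq .
  then show ?thesis
    by (simp add: prod_UNIV_3 torus_char_def diag_ext_def idx1_def idx2_def mult_ac)
qed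

lemma mon_torus_ext:
  assumes f: "f \<in> I_series \<xi> lam" and g: "g \<in> GL" and m: "\<forall>j. m$j \<in> {1, -1}" and a: "\<forall>j. a$j > 0"
  shows "GH.mon p q r f (g ** diag_mat (diag_ext i (\<chi> j. m$j * a$j))) =
    (complex_of_real ((m$1 * a$1) powi shift1 i p q r) * torus_char (\<xi> $ idx1 i) (lam $ idx1 i) (m$1) (a$1)) *
    (complex_of_real ((m$2 * a$2) powi shift2 i p q r) * torus_char (\<xi> $ idx2 i) (lam $ idx2 i) (m$2) (a$2)) *
    GH.mon p q r f g"
proof -
  have nz: "(\<chi> j. m$j * a$j) $ j \<noteq> 0" for j
    using m[rule_format, of j] a[rule_format, of j] by auto
  show ?thesis
    using mon_torus[OF diag_ext_nonzero[OF nz, where i = i] I_series_Csmooth[OF f]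
        I_series_torus_ext[OF f _ m a, where i = i] g, where p = p and q = q and r = r]
    unfolding diag_ext_factor[OF nz] by (simp add: mult_ac)
qed

section \<open>Symmetry breaking operators\<close>

text \<open>Taken at r = 0 because both shifts are constant along the monomials of one sum, by
  \<open>shift_invariant\<close>.\<close>

definition parity :: "nat \<Rightarrow> bit^3 \<Rightarrow> bit^2 \<Rightarrow> nat \<Rightarrow> nat \<Rightarrow> bool" where
  "parity i \<xi> \<eta> a b \<longleftrightarrow> \<xi> $ idx1 i + \<eta>$1 = of_int (shift1 i a b 0) \<and> \<xi> $ idx2 i + \<eta>$2 = of_int (shift2 i a b 0)"

text \<open>The value 0 at index min(a, b) + 1 makes the last instance of the recurrence the closing
  condition on the parameters.\<close>

definition hyp_recurrence :: "nat \<Rightarrow> complex^3 \<Rightarrow> complex^2 \<Rightarrow> nat \<Rightarrow> nat \<Rightarrow> (nat \<Rightarrow> complex) \<Rightarrow> bool" where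
  "hyp_recurrence i lam \<nu> a b c \<longleftrightarrow> c (Suc (min a b)) = 0 \<and>
     (\<forall>n\<le>min a b. (par_A i a b + of_nat n) * (par_B i lam \<nu> + of_nat n) * c n = of_nat (Suc n) * c (Suc n))"

lemma shift_invariant:
  assumes "n \<le> min a b"
  shows "shift1 i (a - n) (b - n) n = shift1 i a b 0" "shift2 i (a - n) (b - n) n = shift2 i a b 0"
  using assms by (auto simp: shift1_def shift2_def)

lemma weights_iff_shift:
  assumes "i \<in> {1, 2}"
  shows "weights i lam \<nu> a b \<longleftrightarrow>
    \<nu>$1 = lam $ idx1 i - of_int (shift1 i a b 0) \<and> \<nu>$2 = lam $ idx2 i - of_int (shift2 i a b 0)"
proof (cases "i = 1")
  case True
  then show ?thesis
    by (auto simp: weights_def idx1_def idx2_def shift1_def shift2_def algebra_simps)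
next
  case False
  have "\<nu>$1 = lam$2 - (x - y) \<and> \<nu>$2 = lam$3 - y \<longleftrightarrow> lam$2 + lam$3 - \<nu>$1 - \<nu>$2 = x \<and> lam$3 - \<nu>$2 = y" for x y
  proof
    assume xy: "lam$2 + lam$3 - \<nu>$1 - \<nu>$2 = x \<and> lam$3 - \<nu>$2 = y"
    have "\<nu>$1 = lam$2 - ((lam$2 + lam$3 - \<nu>$1 - \<nu>$2) - (lam$3 - \<nu>$2))" "\<nu>$2 = lam$3 - (lam$3 - \<nu>$2)"
      by simp_all
    then show "\<nu>$1 = lam$2 - (x - y) \<and> \<nu>$2 = lam$3 - y"
      unfolding conjunct1[OF xy] conjunct2[OF xy] by blast
  qed auto
  then show ?thesis
    using False by (simp add: weights_def idx1_def idx2_def shift1_def shift2_def)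
qed

definition diff_op ::
  "nat \<Rightarrow> bit^3 \<Rightarrow> complex^3 \<Rightarrow> nat \<Rightarrow> nat \<Rightarrow> (nat \<Rightarrow> complex) \<Rightarrow> (real^3^3 \<Rightarrow> complex) \<Rightarrow> real^2^2 \<Rightarrow> complex" where
  "diff_op i \<xi> lam a b c f h =
     (if f \<in> I_series \<xi> lam \<and> h \<in> GL then GH.mon_sum a b c f (iota i h) else 0)"

text \<open>Since \<open>raise_mat i\<close> has square 0, the line g (1 + s E) is an integral curve
  of the left-invariant field: its velocity g E equals (g (1 + s E)) E.\<close>

lemma right_unipotent_invariant:
  assumes F: "F \<in> Csmooth GL" and E: "right_deriv (raise_mat i) F = (\<lambda>g. 0)" and g: "g \<in> GL"
  shows "F (g ** (mat 1 + s *\<^sub>R raise_mat i)) = F g"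
proof -
  define \<gamma> where "\<gamma> s = g ** (mat 1 + s *\<^sub>R raise_mat i)" for s
  have \<gamma>: "\<gamma> s = g + s *\<^sub>R (g ** raise_mat i)" for s
    by (simp add: \<gamma>_def matrix_add_ldistrib matrix_scalar_ac flip: scalar_matrix_assoc)
  have GL: "\<gamma> s \<in> GL" for s
    using g det_unip3[OF unip3_raise[of s i]] by (simp add: \<gamma>_def GL_iff_det det_mul)
  have "\<gamma> s ** raise_mat i = g ** raise_mat i" for s
    by (simp add: \<gamma> matrix_mult_add_left raise_mat_square flip: scalar_matrix_assoc matrix_mul_assoc)
  have "((\<lambda>t. F (\<gamma> t)) has_vector_derivative 0) (at s)" for s
  proof -
    have "(\<gamma> has_vector_derivative g ** raise_mat i) (at s)"
      unfolding \<gamma>[abs_def] by (auto intro!: derivative_eq_intros simp: has_vector_derivative_def)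
    from dderiv_curve[OF this Csmooth_differentiable[OF F GL]] show ?thesis
      using fun_cong[OF E, of "\<gamma> s"] \<open>\<gamma> s ** raise_mat i = g ** raise_mat i\<close>
      by (simp add: right_deriv_eq[OF GL])
  qed
  then have "(\<lambda>t. F (\<gamma> t)) s = (\<lambda>t. F (\<gamma> t)) 0"
    by (intro has_derivative_zero_unique[of UNIV]) (auto simp: has_vector_derivative_def)
  then show ?thesis
    by (simp add: \<gamma>_def)
qed

text \<open>All monomials of the sum transform by one character, because their shifts agree;
  \<open>torus_char_shift\<close> identifies it with that of the target.\<close>

lemma mon_sum_torus:
  assumes i: "i \<in> {1, 2}" and f: "f \<in> I_series \<xi> lam" and g: "g \<in> GL"
    and w: "weights i lam \<nu> a b" and par: "parity i \<xi> \<eta> a b"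
    and m: "\<forall>j. m$j \<in> {1, -1}" and t: "\<forall>j. t$j > 0"
  shows "GH.mon_sum a b c f (g ** diag_mat (diag_ext i (\<chi> j. m$j * t$j))) =
    torus_char (\<eta>$1) (\<nu>$1) (m$1) (t$1) * torus_char (\<eta>$2) (\<nu>$2) (m$2) (t$2) * GH.mon_sum a b c f g"
proof -
  have "GH.mon (a - n) (b - n) n f (g ** diag_mat (diag_ext i (\<chi> j. m$j * t$j))) =
      torus_char (\<eta>$1) (\<nu>$1) (m$1) (t$1) * torus_char (\<eta>$2) (\<nu>$2) (m$2) (t$2) * GH.mon (a - n) (b - n) n f g"
    if n: "n \<le> min a b" for n
  proof -
    have "complex_of_real ((m$1 * t$1) powi shift1 i a b 0) * torus_char (\<xi> $ idx1 i) (lam $ idx1 i) (m$1) (t$1) =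
        torus_char (\<eta>$1) (\<nu>$1) (m$1) (t$1)"
      "complex_of_real ((m$2 * t$2) powi shift2 i a b 0) * torus_char (\<xi> $ idx2 i) (lam $ idx2 i) (m$2) (t$2) =
        torus_char (\<eta>$2) (\<nu>$2) (m$2) (t$2)"
      using w[unfolded weights_iff_shift[OF i]] par[unfolded parity_def] m t torus_char_shift by metis+
    then show ?thesis
      unfolding mon_torus_ext[OF f g m t] shift_invariant[OF n] by (simp only:)
  qed
  then show ?thesis
    unfolding GH.mon_sum_def sum_distrib_left by (intro sum.cong refl) (simp add: mult_ac)
qed

text \<open>P' is handled as its diagonal part, signs included, times its unipotent part; the latter
  is connected, so it is enough that the raising derivative vanishes, which the recurrence
  ensures.\<close>

lemma diff_op_J_series:
  assumes i: "i \<in> {1, 2}" and f: "f \<in> I_series \<xi> lam"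
    and w: "weights i lam \<nu> a b" and par: "parity i \<xi> \<eta> a b" and c: "hyp_recurrence i lam \<nu> a b c"
  shows "diff_op i \<xi> lam a b c f \<in> J_series \<eta> \<nu>"
proof -
  define F where "F = GH.mon_sum a b c f"
  have F: "F \<in> Csmooth GL"
    unfolding F_def by (rule GH.mon_sum_mem[OF I_series_Csmooth[OF f]])
  have E: "right_deriv (raise_mat i) F = (\<lambda>g. 0)"
    using right_deriv_raise_mon_sum[OF f w, of c] c by (simp add: hyp_recurrence_def F_def)
  have T: "diff_op i \<xi> lam a b c f h = (if h \<in> GL then F (iota i h) else 0)" for h
    using f by (simp add: diff_op_def F_def)
  have "smooth_on GL (\<lambda>h. F (iota i h))"
    by (rule smooth_on_compose_affine[OF open_GL open_GL _ has_derivative_iota CsmoothD(1)[OF F]])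
       (auto simp: iota_GL)
  then have "smooth_on GL (diff_op i \<xi> lam a b c f)"
    by (rule smooth_on_cong[OF open_GL]) (simp add: T)
  moreover have "diff_op i \<xi> lam a b c f (g ** diag_mat m ** diag_mat t ** n) =
      (\<Prod>j\<in>UNIV. sign_pow (\<eta>$j) (m$j)) * (\<Prod>j\<in>UNIV. complex_of_real (t$j) powr (- (\<nu>$j))) *
      diff_op i \<xi> lam a b c f g"
    if g: "g \<in> GL" and n: "n \<in> unip2" and m: "\<forall>j. m$j \<in> {1, -1}" and t: "\<forall>j. t$j > 0" for g n m t
  proof -
    have d: "diag_mat (\<chi> j. m$j * t$j) \<in> GL"
      using m[rule_format, of 1] m[rule_format, of 2] t[rule_format, of 1] t[rule_format, of 2]
      by (auto simp: GL_iff_det det_diag_mat prod_UNIV_2)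
    have "det n = 1"
      using n by (simp add: unip2_def det_2)
    then have nGL: "n \<in> GL"
      by (simp add: GL_iff_det)
    have e: "g ** diag_mat m ** diag_mat t ** n = g ** diag_mat (\<chi> j. m$j * t$j) ** n"
      by (simp add: diag_mat_mult flip: matrix_mul_assoc)
    have "F (iota i (g ** diag_mat (\<chi> j. m$j * t$j) ** n)) = F (iota i (g ** diag_mat (\<chi> j. m$j * t$j)))"
      unfolding iota_mult[of i _ n] iota_unip2[OF n]
      using g d by (intro right_unipotent_invariant[OF F E]) (simp add: iota_GL GL_mult_iff)
    also have "\<dots> = torus_char (\<eta>$1) (\<nu>$1) (m$1) (t$1) * torus_char (\<eta>$2) (\<nu>$2) (m$2) (t$2) * F (iota i g)"
      unfolding iota_mult iota_diag_mat F_def using g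
      by (intro mon_sum_torus[OF i f _ w par m t]) (simp add: iota_GL)
    finally show ?thesis
      using g d nGL unfolding e T by (simp add: GL_mult_iff prod_UNIV_2 torus_char_def mult_ac)
  qed
  ultimately show ?thesis
    unfolding J_series_def principal_series_def by (auto simp: T)
qed

lemma I_series_lincomb:
  assumes "f1 \<in> I_series \<xi> lam" "f2 \<in> I_series \<xi> lam"
  shows "(\<lambda>g. c1 * f1 g + c2 * f2 g) \<in> I_series \<xi> lam"
proof -
  have "(\<lambda>g. c1 * f1 g + c2 * f2 g) \<in> Csmooth GL"
    by (intro Csmooth_add Csmooth_cmult open_GL I_series_Csmooth[OF assms(1)] I_series_Csmooth[OF assms(2)])
  then show ?thesis
    using assms unfolding I_series_def principal_series_def Csmooth_def
    by (auto simp: distrib_left mult.left_commute mult.assoc)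
qed

lemma smooth_on_axis_pt:
  assumes "smooth_on UNIV p"
  shows "smooth_on UNIV (\<lambda>t. p (axis_pt i t) :: complex)"
proof (rule smooth_on_compose_affine[OF open_UNIV open_UNIV _ _ assms])
  have "axis_pt i = (\<lambda>t. t *\<^sub>R axis_pt i 1)"
    by (auto simp: axis_pt_def axis_def vec_eq_iff)
  then show "(axis_pt i has_derivative (\<lambda>t. t *\<^sub>R axis_pt i 1)) (at t)" for t
    by (metis bounded_linear_imp_has_derivative bounded_linear_scaleR_left)
qed simp

lemma diff_op_cells:
  assumes f: "f \<in> I_series \<xi> lam" and h: "h \<in> GL"
  shows "diff_op i \<xi> lam a b c f (h ** cell2 t) =
    DH.mon_sum a b c (\<lambda>x. f (iota i h ** cell3 x)) (axis_pt i t)"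
proof -
  have hG: "iota i h \<in> GL" using h by (simp add: iota_GL)
  note m = I_series_Csmooth[OF f]
  have "DH.mon_sum a b c (\<lambda>x. f (iota i h ** cell3 x)) (axis_pt i t) =
      GH.mon_sum a b c (\<lambda>g. f (iota i h ** g)) (cell3 (axis_pt i t))"
    using fun_cong[OF mon_sum_cell3_pullback[OF left_translation_mem[OF hG m]]] .
  also have "\<dots> = GH.mon_sum a b c f (iota i h ** cell3 (axis_pt i t))"
    by (simp add: mon_sum_left_translation[OF hG m])
  finally show ?thesis
    using f h by (simp add: diff_op_def iota_mult iota_cell2 GL_mult_iff cell2_GL)
qed

lemma diff_op_Diff:
  assumes i: "i \<in> {1, 2}"
    and w: "weights i lam \<nu> a b" and par: "parity i \<xi> \<eta> a b" and c: "hyp_recurrence i lam \<nu> a b c"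
  shows "diff_op i \<xi> lam a b c \<in> Diff i \<xi> lam \<eta> \<nu>"
proof -
  define T where "T = diff_op i \<xi> lam a b c"
  have "T f \<in> J_series \<eta> \<nu>" if "f \<in> I_series \<xi> lam" for f
    unfolding T_def by (rule diff_op_J_series[OF i that w par c])
  moreover have "T f = (\<lambda>g. 0)" if "f \<notin> I_series \<xi> lam" for f
    using that by (simp add: T_def diff_op_def fun_eq_iff)
  moreover have "T (\<lambda>g. c1 * f1 g + c2 * f2 g) = (\<lambda>g. c1 * T f1 g + c2 * T f2 g)"
    if "f1 \<in> I_series \<xi> lam" "f2 \<in> I_series \<xi> lam" for f1 f2 c1 c2
    using that I_series_lincomb[OF that]
      GH.op_add[OF GH.linear_op_on_mon_sum] GH.op_cmult[OF GH.linear_op_on_mon_sum]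
    by (simp add: T_def diff_op_def fun_eq_iff I_series_Csmooth)
  moreover have "T (left_translate (iota i h) f) = left_translate h (T f)"
    if h: "h \<in> GL" and f: "f \<in> I_series \<xi> lam" for h f
  proof
    fix g
    have k: "matrix_inv h \<in> GL" "iota i (matrix_inv h) \<in> GL"
      using matrix_inv_GL(3)[OF h] by (simp_all add: iota_GL)
    have e: "left_translate (iota i h) f = (\<lambda>g. f (iota i (matrix_inv h) ** g))"
      by (simp add: left_translate_def matrix_inv_iota[OF h])
    show "T (left_translate (iota i h) f) g = left_translate h (T f) g"
      using f k I_series_left_translation[OF f k(2)] mon_sum_left_translation[OF k(2) I_series_Csmooth[OF f]]
      unfolding e by (simp add: T_def diff_op_def left_translate_def GL_mult_iff iota_mult)
  qed
  moreover have "differential_operator i (I_series \<xi> lam) T"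
    unfolding differential_operator_def
  proof
    fix h :: "real^2^2" assume h: "h \<in> GL"
    \<comment> \<open>Left invariance makes the expression in the chart at \<open>h\<close> the same
      for every \<open>h\<close>, so one expansion in partial derivatives serves all charts, with
      \<open>U\<close> the whole line.\<close>
    obtain K p where K: "finite K" "\<And>js. smooth_on UNIV (p js)"
      "\<And>F x. F \<in> Csmooth UNIV \<Longrightarrow> DH.mon_sum a b c F x = (\<Sum>js\<in>K. p js x * foldr partial js F x)"
      using expands_finite_sum[OF expands_mon_sum_partials[of a b c]] by blast
    have "T f (h ** cell2 t) =
        (\<Sum>js\<in>K. p js (axis_pt i t) * foldr partial js (\<lambda>x. f (iota i h ** cell3 x)) (axis_pt i t))"
      if f: "f \<in> I_series \<xi> lam" for f t
    proof -
      have "(\<lambda>x. f (iota i h ** cell3 x)) \<in> Csmooth UNIV"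
        using cell3_pullback_mem[OF left_translation_mem[OF _ I_series_Csmooth[OF f]]] h iota_GL by blast
      from K(3)[OF this] show ?thesis
        unfolding T_def diff_op_cells[OF f h] .
    qed
    then show "\<exists>U js_set a. open U \<and> 0 \<in> U \<and> finite js_set \<and> (\<forall>js\<in>js_set. smooth_on U (a js)) \<and>
        (\<forall>f\<in>I_series \<xi> lam. \<forall>t\<in>U. T f (h ** cell2 t) =
           (\<Sum>js\<in>js_set. a js t * foldr partial js (\<lambda>x. f (iota i h ** cell3 x)) (axis_pt i t)))"
      using K(1) smooth_on_axis_pt[OF K(2)]
      by (intro exI[of _ UNIV] exI[of _ K] exI[of _ "\<lambda>js t. p js (axis_pt i t)"]) simp
  qed
  ultimately show ?thesis
    unfolding T_def[symmetric] Diff_def by blast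
qed

section \<open>Classification\<close>

text \<open>Only the chart at the identity is consulted. Equivariance carries the formula there to
  every \<open>h\<close>, which is why the coefficients are constants.\<close>

lemma Diff_expansion:
  assumes T: "T \<in> Diff i \<xi> lam \<eta> \<nu>"
  obtains K \<beta> where "finite K" "\<And>f h. f \<in> I_series \<xi> lam \<Longrightarrow> h \<in> GL \<Longrightarrow>
    T f h = (\<Sum>(p, q, r)\<in>K. \<beta> (p, q, r) * GH.mon p q r f (iota i h))"
proof -
  have one2: "(mat 1 :: real^2^2) \<in> GL" by (rule GL_one)
  have "differential_operator i (I_series \<xi> lam) T"
    using T by (simp add: Diff_def)
  then obtain U J a where U: "open U" "0 \<in> U" "finite J"
    "\<And>f t. f \<in> I_series \<xi> lam \<Longrightarrow> t \<in> U \<Longrightarrow> T f (mat 1 ** cell2 t) =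
       (\<Sum>js\<in>J. a js t * foldr partial js (\<lambda>x. f (iota i (mat 1) ** cell3 x)) (axis_pt i t))"
    unfolding differential_operator_def using one2 by meson
  \<comment> \<open>The coefficients are frozen at t = 0, since only the value at the identity is
    being expanded.\<close>
  have "expands heis_mon (\<lambda>F x. \<Sum>js\<in>J. a js 0 * foldr partial js F x)"
    by (intro expands_sum U expands.mult expands_partials_heis_mon smooth_on_const)
  from expands_finite_sum[OF this] obtain K p where K: "finite K"
    "\<And>F x. F \<in> Csmooth UNIV \<Longrightarrow> (\<Sum>js\<in>J. a js 0 * foldr partial js F x) = (\<Sum>k\<in>K. p k x * heis_mon k F x)"
    by blast
  have one: "T f (mat 1) = (\<Sum>(p', q, r)\<in>K. p (p', q, r) 0 * GH.mon p' q r f (mat 1))"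
    if f: "f \<in> I_series \<xi> lam" for f
  proof -
    have ax: "axis_pt i 0 = 0"
      by (simp add: axis_pt_def axis_def vec_eq_iff)
    have "T f (mat 1) = (\<Sum>js\<in>J. a js 0 * foldr partial js (\<lambda>x. f (cell3 x)) 0)"
      using U(4)[OF f U(2)] by (simp add: cell2_0 iota_one ax)
    also have "\<dots> = (\<Sum>k\<in>K. p k 0 * heis_mon k (\<lambda>x. f (cell3 x)) 0)"
      by (rule K(2)[OF cell3_pullback_mem[OF I_series_Csmooth[OF f]]])
    also have "\<dots> = (\<Sum>(p', q, r)\<in>K. p (p', q, r) 0 * GH.mon p' q r f (mat 1))"
      by (rule sum.cong) (auto simp: heis_mon_def mon_cell3_pullback[OF I_series_Csmooth[OF f]] cell3_0)
    finally show ?thesis .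
  qed
  have "T f h = (\<Sum>(p', q, r)\<in>K. p (p', q, r) 0 * GH.mon p' q r f (iota i h))"
    if f: "f \<in> I_series \<xi> lam" and h: "h \<in> GL" for f h
  proof -
    \<comment> \<open>Translating by the inverse of \<open>h\<close> moves the evaluation point
      \<open>h\<close> to the identity.\<close>
    define k where "k = matrix_inv h"
    have k: "k \<in> GL" "matrix_inv k = h" "iota i h \<in> GL"
      using matrix_inv_GL[OF h] matrix_inv_eqI[of k h] h by (simp_all add: k_def iota_GL)
    have e: "left_translate (iota i k) f = (\<lambda>g. f (iota i h ** g))"
      by (simp add: left_translate_def matrix_inv_iota[OF k(1)] k(2))
    have "T (left_translate (iota i k) f) = left_translate k (T f)"
      using T k(1) f by (simp add: Diff_def)
    then have "T f h = T (\<lambda>g. f (iota i h ** g)) (mat 1)"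
      unfolding e by (simp add: left_translate_def k(2))
    also have "\<dots> = (\<Sum>(p', q, r)\<in>K. p (p', q, r) 0 * GH.mon p' q r (\<lambda>g. f (iota i h ** g)) (mat 1))"
      by (rule one[OF I_series_left_translation[OF f k(3)]])
    finally show ?thesis
      by (simp add: mon_left_translation[OF k(3) I_series_Csmooth[OF f]])
  qed
  then show thesis
    using that[OF K(1), of "\<lambda>k. p k 0"] by simp
qed

lemma J_series_torus:
  assumes F: "F \<in> J_series \<eta> \<nu>" and m: "\<forall>j. m$j \<in> {1, -1}" and a: "\<forall>j. a$j > 0"
  shows "F (diag_mat (\<chi> j. m$j * a$j)) =
    torus_char (\<eta>$1) (\<nu>$1) (m$1) (a$1) * torus_char (\<eta>$2) (\<nu>$2) (m$2) (a$2) * F (mat 1)"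
proof -
  have "mat 1 \<in> unip2"
    by (simp add: unip2_def)
  then have "F (mat 1 ** diag_mat m ** diag_mat a ** mat 1) = (\<Prod>j\<in>UNIV. sign_pow (\<eta>$j) (m$j)) *
      (\<Prod>j\<in>UNIV. complex_of_real (a$j) powr (- (\<nu>$j))) * F (mat 1)"
    using F m a GL_one unfolding J_series_def principal_series_def by blast
  then show ?thesis
    by (simp add: diag_mat_mult prod_UNIV_2 torus_char_def mult_ac)
qed

lemma J_series_unipotent:
  assumes F: "F \<in> J_series \<eta> \<nu>" and u: "u \<in> unip2"
  shows "F u = F (mat 1)"
proof -
  have one2: "(mat 1 :: real^2^2) \<in> GL" by (rule GL_one)
  have "F (mat 1 ** diag_mat (\<chi> j. 1) ** diag_mat (\<chi> j. 1) ** u) = (\<Prod>j\<in>UNIV. sign_pow (\<eta>$j) ((\<chi> j. 1) $ j)) *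
      (\<Prod>j\<in>UNIV. complex_of_real ((\<chi> j. 1) $ j) powr (- (\<nu>$j))) * F (mat 1)"
    using F u one2 unfolding J_series_def principal_series_def by fastforce
  then show ?thesis
    by (simp add: diag_mat_one)
qed

text \<open>Evaluating \<open>T f\<close> at a diagonal matrix through the expansion and through the
  target character gives a linear relation between monomials at the identity; by
  \<open>mon_nondegenerate\<close> each nonzero coefficient forces equality of the two
  characters.\<close>

lemma Diff_weights:
  assumes i: "i \<in> {1, 2}" and T: "T \<in> Diff i \<xi> lam \<eta> \<nu>" and K: "finite K"
    and exp: "\<And>f h. f \<in> I_series \<xi> lam \<Longrightarrow> h \<in> GL \<Longrightarrow>
      T f h = (\<Sum>(p, q, r)\<in>K. \<beta> (p, q, r) * GH.mon p q r f (iota i h))"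
    and k: "(p, q, r) \<in> K" "\<beta> (p, q, r) \<noteq> 0"
  shows "weights i lam \<nu> (p + r) (q + r)" "parity i \<xi> \<eta> (p + r) (q + r)"
proof -
  have main: "(complex_of_real ((m$1 * a$1) powi shift1 i p q r) * torus_char (\<xi> $ idx1 i) (lam $ idx1 i) (m$1) (a$1)) *
      (complex_of_real ((m$2 * a$2) powi shift2 i p q r) * torus_char (\<xi> $ idx2 i) (lam $ idx2 i) (m$2) (a$2)) =
      torus_char (\<eta>$1) (\<nu>$1) (m$1) (a$1) * torus_char (\<eta>$2) (\<nu>$2) (m$2) (a$2)"
    if m: "\<forall>j. m$j \<in> {1, -1}" and a: "\<forall>j. a$j > 0" for m a :: "real^2"
  proof -
    define \<chi>J where "\<chi>J = torus_char (\<eta>$1) (\<nu>$1) (m$1) (a$1) * torus_char (\<eta>$2) (\<nu>$2) (m$2) (a$2)"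
    define \<chi>I where "\<chi>I = (\<lambda>(p, q, r). (complex_of_real ((m$1 * a$1) powi shift1 i p q r) * torus_char (\<xi> $ idx1 i) (lam $ idx1 i) (m$1) (a$1)) *
      (complex_of_real ((m$2 * a$2) powi shift2 i p q r) * torus_char (\<xi> $ idx2 i) (lam $ idx2 i) (m$2) (a$2)))"
    define d where "d = diag_mat (\<chi> j. m$j * a$j)"
    have d: "d \<in> GL"
      using m[rule_format, of 1] m[rule_format, of 2] a[rule_format, of 1] a[rule_format, of 2]
      by (auto simp: d_def GL_iff_det det_diag_mat prod_UNIV_2)
    have "\<beta> (p, q, r) * (\<chi>I (p, q, r) - \<chi>J) = 0"
    proof (rule mon_nondegenerate[OF K _ k(1), where b = "\<lambda>k. \<beta> k * (\<chi>I k - \<chi>J)"])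
      fix f assume f: "f \<in> I_series \<xi> lam"
      have "T f d = \<chi>J * T f (mat 1)"
        unfolding d_def \<chi>J_def using T f by (intro J_series_torus[OF _ m a]) (simp add: Diff_def)
      moreover have "T f d = (\<Sum>(p, q, r)\<in>K. \<beta> (p, q, r) * \<chi>I (p, q, r) * GH.mon p q r f (mat 1))"
        unfolding exp[OF f d]
      proof (rule sum.cong[OF refl], clarify)
        fix p q r
        have "GH.mon p q r f (iota i d) = \<chi>I (p, q, r) * GH.mon p q r f (mat 1)"
          using mon_torus_ext[OF f GL_one m a, of p q r i] by (simp add: d_def iota_diag_mat \<chi>I_def)
        then show "\<beta> (p, q, r) * GH.mon p q r f (iota i d) = \<beta> (p, q, r) * \<chi>I (p, q, r) * GH.mon p q r f (mat 1)"
          by simp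
      qed
      moreover have "T f (mat 1) = (\<Sum>(p, q, r)\<in>K. \<beta> (p, q, r) * GH.mon p q r f (mat 1))"
        unfolding exp[OF f GL_one] iota_one ..
      ultimately show "(\<Sum>(p, q, r)\<in>K. \<beta> (p, q, r) * (\<chi>I (p, q, r) - \<chi>J) * GH.mon p q r f (mat 1)) = 0"
        by (simp add: case_prod_unfold algebra_simps sum_subtractf sum_distrib_left)
    qed
    then show ?thesis
      using k(2) by (simp add: \<chi>I_def \<chi>J_def)
  qed
  have nz: "torus_char y v 1 1 = 1" for y v
    by (simp add: torus_char_def)
  \<comment> \<open>Setting one diagonal entry to 1 isolates the character in the other.\<close>
  have 1: "complex_of_real ((m * t) powi shift1 i p q r) * torus_char (\<xi> $ idx1 i) (lam $ idx1 i) m t = torus_char (\<eta>$1) (\<nu>$1) m t"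
    if "m \<in> {1, -1}" "t > 0" for m t
    using main[of "vector [m, 1]" "vector [t, 1]"] that by (simp add: forall_2 nz)
  have 2: "complex_of_real ((m * t) powi shift2 i p q r) * torus_char (\<xi> $ idx2 i) (lam $ idx2 i) m t = torus_char (\<eta>$2) (\<nu>$2) m t"
    if "m \<in> {1, -1}" "t > 0" for m t
    using main[of "vector [1, m]" "vector [1, t]"] that by (simp add: forall_2 nz)
  have s: "shift1 i p q r = shift1 i (p + r) (q + r) 0" "shift2 i p q r = shift2 i (p + r) (q + r) 0"
    using shift_invariant[of r "p + r" "q + r" i] by simp_all
  show "weights i lam \<nu> (p + r) (q + r)"
    unfolding weights_iff_shift[OF i] s[symmetric] using torus_char_unique(1)[OF 1] torus_char_unique(1)[OF 2] by simp
  show "parity i \<xi> \<eta> (p + r) (q + r)"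
    unfolding parity_def s[symmetric] using torus_char_unique(2)[OF 1] torus_char_unique(2)[OF 2] by simp
qed

lemma weights_unique: "weights i lam \<nu> a b \<Longrightarrow> weights i lam \<nu> a' b' \<Longrightarrow> a = a' \<and> b = b'"
  unfolding weights_def by (metis of_nat_eq_iff)

text \<open>One nonzero coefficient fixes \<open>a\<close> and \<open>b\<close>; by
  \<open>weights_unique\<close> all others lie on the same line of exponents, so \<open>T\<close> is
  a single \<open>mon_sum\<close>. Unipotent invariance then yields the recurrence.\<close>

lemma Diff_eq_diff_op:
  assumes i: "i \<in> {1, 2}" and T: "T \<in> Diff i \<xi> lam \<eta> \<nu>"
  shows "T = (\<lambda>f g. 0) \<or> (\<exists>a b c. weights i lam \<nu> a b \<and> parity i \<xi> \<eta> a b \<and>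
    hyp_recurrence i lam \<nu> a b c \<and> T = diff_op i \<xi> lam a b c \<and> (\<exists>n\<le>min a b. c n \<noteq> 0))"
proof (rule Diff_expansion[OF T])
  fix K \<beta>
  assume K: "finite K" and exp: "\<And>f h. f \<in> I_series \<xi> lam \<Longrightarrow> h \<in> GL \<Longrightarrow>
      T f h = (\<Sum>(p, q, r)\<in>K. \<beta> (p, q, r) * GH.mon p q r f (iota i h))"
  have outI: "T f = (\<lambda>g. 0)" if "f \<notin> I_series \<xi> lam" for f
    using T that by (simp add: Diff_def)
  have J: "T f \<in> J_series \<eta> \<nu>" if "f \<in> I_series \<xi> lam" for f
    using T that by (simp add: Diff_def)
  have outGL: "T f h = 0" if "f \<in> I_series \<xi> lam" "h \<notin> GL" for f h
    using J[OF that(1)] that(2) by (simp add: J_series_def principal_series_def)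
  show ?thesis
  proof (cases "\<exists>k\<in>K. \<beta> k \<noteq> 0")
    case False
    have "T f h = 0" for f h
    proof (cases "f \<in> I_series \<xi> lam \<and> h \<in> GL")
      case True
      then have "T f h = (\<Sum>(p, q, r)\<in>K. \<beta> (p, q, r) * GH.mon p q r f (iota i h))"
        using exp by simp
      also have "\<dots> = 0"
        using False by (intro sum.neutral) auto
      finally show ?thesis .
    qed (use outI outGL in metis)
    then show ?thesis by auto
  next
    case True
    then obtain p0 q0 r0 where k0: "(p0, q0, r0) \<in> K" "\<beta> (p0, q0, r0) \<noteq> 0" by auto
    define a b where "a = p0 + r0" "b = q0 + r0"
    have w: "weights i lam \<nu> a b" and par: "parity i \<xi> \<eta> a b"
      unfolding a_b_def using Diff_weights[OF i T K exp k0] by auto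
    define c where "c n = (if n \<le> min a b \<and> (a - n, b - n, n) \<in> K then \<beta> (a - n, b - n, n) else 0)" for n
    have Teq: "T f h = GH.mon_sum a b c f (iota i h)" if f: "f \<in> I_series \<xi> lam" and h: "h \<in> GL" for f h
    proof -
      define M where "M = (\<lambda>(p, q, r). \<beta> (p, q, r) * GH.mon p q r f (iota i h))"
      define \<phi> where "\<phi> n = (a - n, b - n, n)" for n :: nat
      have "T f h = sum M K"
        unfolding exp[OF f h] M_def ..
      also have "\<dots> = sum M (\<phi> ` {n. n \<le> min a b \<and> \<phi> n \<in> K})"
      proof (rule sum.mono_neutral_right[OF K])
        show "\<forall>k\<in>K - \<phi> ` {n. n \<le> min a b \<and> \<phi> n \<in> K}. M k = 0"
        proof
          fix k assume k: "k \<in> K - \<phi> ` {n. n \<le> min a b \<and> \<phi> n \<in> K}"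
          obtain p q r where pqr: "k = (p, q, r)" by (cases k)
          have "\<beta> k = 0"
          proof (rule ccontr)
            assume "\<beta> k \<noteq> 0"
            then have "weights i lam \<nu> (p + r) (q + r)"
              using Diff_weights(1)[OF i T K exp, of p q r] k pqr by auto
            with weights_unique[OF w] have "a = p + r" "b = q + r" by auto
            then have "k = \<phi> r" "r \<le> min a b"
              by (auto simp: \<phi>_def pqr)
            with k show False by auto
          qed
          then show "M k = 0"
            by (simp add: M_def pqr)
        qed
      qed auto
      also have "\<dots> = (\<Sum>n | n \<le> min a b \<and> \<phi> n \<in> K. M (\<phi> n))"
        by (rule sum.reindex_cong[of \<phi>]) (auto simp: inj_on_def \<phi>_def)
      also have "\<dots> = (\<Sum>n\<le>min a b. c n * GH.mon (a - n) (b - n) n f (iota i h))"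
        by (rule sum.mono_neutral_cong_left) (auto simp: c_def M_def \<phi>_def)
      finally show ?thesis
        by (simp add: GH.mon_sum_def)
    qed
    have "hyp_recurrence i lam \<nu> a b c"
    proof -
      have c0: "c (Suc (min a b)) = 0"
        by (auto simp: c_def min_def)
      define \<kappa> where "\<kappa> n = (par_A i a b + of_nat n) * (par_B i lam \<nu> + of_nat n) * c n - of_nat (Suc n) * c (Suc n)" for n
      \<comment> \<open>Exponents of the monomial carrying \<open>\<kappa> n\<close>. The third
        entry keeps the map injective even where the truncated subtraction clips.\<close>
      define \<psi> where "\<psi> n = (if i = 1 then (a - n - 1, b - n, n) else (a - n, b - n - 1, n))" for n
      have inj: "inj_on \<psi> {..min a b}"
        by (auto simp: inj_on_def \<psi>_def split: if_splits)
      have "\<kappa> n = 0" if n: "n \<le> min a b" for n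
      proof -
        have "(\<lambda>k. \<kappa> (snd (snd k))) (\<psi> n) = 0"
        proof (rule mon_nondegenerate[of "\<psi> ` {..min a b}"])
          show "\<psi> n \<in> \<psi> ` {..min a b}"
            using n by simp
          fix f assume f: "f \<in> I_series \<xi> lam"
          define F where "F = GH.mon_sum a b c f"
          have F: "F \<in> Csmooth GL"
            unfolding F_def by (rule GH.mon_sum_mem[OF I_series_Csmooth[OF f]])
          \<comment> \<open>Right unipotent invariance of \<open>T f\<close>, used along the curve
            through the identity only; its derivative there is the raising derivative.\<close>
          have const: "F (mat 1 + s *\<^sub>R raise_mat i) = F (mat 1)" for s
          proof -
            define u :: "real^2^2" where "u = mat 1 + s *\<^sub>R elem_mat 1 2"
            have u: "u \<in> unip2" "u \<in> GL" "iota i u = mat 1 + s *\<^sub>R raise_mat i"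
            proof -
              show "u \<in> unip2"
                by (simp add: u_def unip2_def elem_mat_def)
              then show "iota i u = mat 1 + s *\<^sub>R raise_mat i"
                by (simp add: iota_unip2) (simp add: u_def elem_mat_def)
              show "u \<in> GL"
                by (simp add: GL_iff_det det_2 u_def elem_mat_def)
            qed
            have "F (iota i u) = F (iota i (mat 1))"
              using J_series_unipotent[OF J[OF f] u(1)] Teq[OF f u(2)] Teq[OF f GL_one] by (simp add: F_def)
            then show ?thesis
              by (simp add: u(3) iota_one)
          qed
          have "((\<lambda>s. mat 1 + s *\<^sub>R raise_mat i) has_vector_derivative raise_mat i) (at 0)"
            by (auto intro!: derivative_eq_intros simp: has_vector_derivative_def)
          from dderiv_curve[OF this, of F] Csmooth_differentiable[OF F GL_one]
          have "((\<lambda>s. F (mat 1)) has_vector_derivative dderiv (raise_mat i) F (mat 1)) (at 0)"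
            by (simp add: const)
          then have "right_deriv (raise_mat i) F (mat 1) = 0"
            using vector_derivative_unique_at[OF _ has_vector_derivative_const] by (simp add: right_deriv_eq) blast
          then have z: "(\<Sum>n\<le>min a b. \<kappa> n * (if i = 1 then GH.mon (a - n - 1) (b - n) n f (mat 1)
              else GH.mon (a - n) (b - n - 1) n f (mat 1))) = 0"
            unfolding F_def right_deriv_raise_mon_sum[where c = c, OF f w c0] \<kappa>_def[symmetric] by (simp split: if_splits)
          have "(\<Sum>(p, q, r)\<in>\<psi> ` {..min a b}. \<kappa> (snd (snd (p, q, r))) * GH.mon p q r f (mat 1)) =
              (\<Sum>n\<le>min a b. \<kappa> n * (if i = 1 then GH.mon (a - n - 1) (b - n) n f (mat 1)
              else GH.mon (a - n) (b - n - 1) n f (mat 1)))"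
            by (rule sum.reindex_cong[OF inj refl]) (auto simp: \<psi>_def)
          with z show "(\<Sum>(p, q, r)\<in>\<psi> ` {..min a b}. \<kappa> (snd (snd (p, q, r))) * GH.mon p q r f (mat 1)) = 0"
            by simp
        qed simp
        then show ?thesis
          by (simp add: \<psi>_def split: if_splits)
      qed
      with c0 show ?thesis
        unfolding hyp_recurrence_def \<kappa>_def by simp
    qed
    moreover have "T = diff_op i \<xi> lam a b c"
    proof (intro ext)
      fix f h
      show "T f h = diff_op i \<xi> lam a b c f h"
        using Teq[of f h] outI[of f] outGL[of f h] unfolding diff_op_def
        by (cases "f \<in> I_series \<xi> lam"; cases "h \<in> GL") simp_all
    qed
    moreover have "r0 \<le> min a b" "c r0 \<noteq> 0"
      using k0 by (auto simp: c_def a_b_def)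
    ultimately show ?thesis
      using w par by blast
  qed
qed

section \<open>Solving the recurrence\<close>

definition hyp_coeff :: "nat \<Rightarrow> complex^3 \<Rightarrow> complex^2 \<Rightarrow> nat \<Rightarrow> nat \<Rightarrow> nat \<Rightarrow> complex" where
  "hyp_coeff i lam \<nu> a b n = (if n \<le> min a b then fps_nth (hyp2F0 (par_A i a b) (par_B i lam \<nu>)) n else 0)"

text \<open>Up to a factorial this product is the coefficient of the series one degree beyond the
  last monomial.\<close>

definition terminates :: "nat \<Rightarrow> complex^3 \<Rightarrow> complex^2 \<Rightarrow> nat \<Rightarrow> nat \<Rightarrow> bool" where
  "terminates i lam \<nu> a b \<longleftrightarrow> pochhammer (par_A i a b) (Suc (min a b)) * pochhammer (par_B i lam \<nu>) (Suc (min a b)) = 0"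

lemma hyp2F0_step:
  "(A + of_nat n) * (B + of_nat n) * fps_nth (hyp2F0 A B) n = of_nat (Suc n) * fps_nth (hyp2F0 A B) (Suc n)"
  by (simp add: hyp2F0_def pochhammer_Suc field_simps del: of_nat_Suc)

lemma hyp_recurrence_hyp_coeff:
  assumes "terminates i lam \<nu> a b"
  shows "hyp_recurrence i lam \<nu> a b (\<lambda>n. c0 * hyp_coeff i lam \<nu> a b n)"
proof -
  let ?A = "par_A i a b" and ?B = "par_B i lam \<nu>"
  have last: "fps_nth (hyp2F0 ?A ?B) (Suc (min a b)) = 0"
    using assms by (simp add: hyp2F0_def terminates_def)
  have "(?A + of_nat n) * (?B + of_nat n) * hyp_coeff i lam \<nu> a b n = of_nat (Suc n) * hyp_coeff i lam \<nu> a b (Suc n)"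
    if "n \<le> min a b" for n
  proof (cases "n = min a b")
    case True
    then show ?thesis
      using hyp2F0_step[of ?A n ?B] last by (simp add: hyp_coeff_def)
  next
    case False
    with that have "Suc n \<le> min a b"
      by (metis Suc_leI le_neq_implies_less)
    then show ?thesis
      using hyp2F0_step[of ?A n ?B] by (simp add: hyp_coeff_def)
  qed
  then show ?thesis
    unfolding hyp_recurrence_def
    by (auto simp: hyp_coeff_def[of _ _ _ _ _ "Suc (min a b)"] mult.left_commute)
qed

text \<open>Division by n + 1 determines every coefficient from \<open>c 0\<close>, up to and
  including index min(a, b) + 1. The prescribed value 0 at that index forces termination unless
  \<open>c 0\<close>, and with it the whole solution, is 0.\<close>

lemma hyp_recurrence_unique:
  assumes c: "hyp_recurrence i lam \<nu> a b c"
  shows "n \<le> min a b \<Longrightarrow> c n = c 0 * hyp_coeff i lam \<nu> a b n"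
    and "(\<exists>n\<le>min a b. c n \<noteq> 0) \<Longrightarrow> terminates i lam \<nu> a b"
proof -
  let ?A = "par_A i a b" and ?B = "par_B i lam \<nu>"
  have eq: "c n = c 0 * fps_nth (hyp2F0 ?A ?B) n" if "n \<le> Suc (min a b)" for n
    using that
  proof (induction n)
    case 0
    then show ?case by (simp add: hyp2F0_def)
  next
    case (Suc n)
    have "of_nat (Suc n) * c (Suc n) = (?A + of_nat n) * (?B + of_nat n) * c n"
      using c Suc.prems by (simp add: hyp_recurrence_def)
    also have "\<dots> = c 0 * ((?A + of_nat n) * (?B + of_nat n) * fps_nth (hyp2F0 ?A ?B) n)"
      using Suc by simp
    also have "\<dots> = of_nat (Suc n) * (c 0 * fps_nth (hyp2F0 ?A ?B) (Suc n))"
      unfolding hyp2F0_step by (simp only: mult.left_commute)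
    finally show ?case
      by (metis mult_left_cancel of_nat_neq_0)
  qed
  show "n \<le> min a b \<Longrightarrow> c n = c 0 * hyp_coeff i lam \<nu> a b n"
    using eq[OF le_SucI, of n] by (simp add: hyp_coeff_def)
  assume "\<exists>n\<le>min a b. c n \<noteq> 0"
  then have "c 0 \<noteq> 0"
    by (metis eq le_SucI mult_zero_left)
  moreover have "c (Suc (min a b)) = 0"
    using c by (simp add: hyp_recurrence_def)
  ultimately have "fps_nth (hyp2F0 ?A ?B) (Suc (min a b)) = 0"
    using eq[of "Suc (min a b)"] by simp
  then show "terminates i lam \<nu> a b"
    by (simp add: hyp2F0_def terminates_def del: fact_Suc)
qed

lemma diff_op_cong:
  "(\<And>n. n \<le> min a b \<Longrightarrow> c n = c' n) \<Longrightarrow> diff_op i \<xi> lam a b c = diff_op i \<xi> lam a b c'"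
  by (simp add: diff_op_def GH.mon_sum_def fun_eq_iff)

lemma diff_op_cmult:
  "diff_op i \<xi> lam a b (\<lambda>n. s * c n) = (\<lambda>f g. s * diff_op i \<xi> lam a b c f g)"
  by (simp add: diff_op_def GH.mon_sum_def fun_eq_iff sum_distrib_left mult.assoc)

text \<open>Write the first parameter as - s and let t be the other exponent. Its Pochhammer symbol
  vanishes exactly if s <= t; otherwise min(a, b) = t, and the second parameter must be one of 0,
  -1, ..., - t.\<close>

lemma terminates_iff:
  "terminates i lam \<nu> a b \<longleftrightarrow> (if i = 1 then a \<le> b else b \<le> a) \<or>
     (\<exists>k\<le>if i = 1 then b else a. par_B i lam \<nu> = - of_nat k)"
proof -
  define s t where "s = (if i = 1 then a else b)" "t = (if i = 1 then b else a)"
  have A: "par_A i a b = - of_nat s" and m: "min a b = min s t"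
    by (auto simp: par_A_def s_t_def)
  have "terminates i lam \<nu> a b \<longleftrightarrow> s \<le> min s t \<or> (\<exists>k\<le>min s t. par_B i lam \<nu> = - of_nat k)"
    unfolding terminates_def A m mult_eq_0_iff pochhammer_of_nat_eq_0_iff pochhammer_eq_0_iff[of "par_B i lam \<nu>"]
    by (auto simp: less_Suc_eq_le)
  also have "\<dots> \<longleftrightarrow> s \<le> t \<or> (\<exists>k\<le>t. par_B i lam \<nu> = - of_nat k)"
    by (cases "s \<le> t") (auto simp: min_def)
  finally show ?thesis
    by (auto simp: s_t_def)
qed

section \<open>Matching weights, termination and parity with the support condition\<close>

lemma Nats_pos_of_nat: "of_nat n \<in> Nats_pos \<longleftrightarrow> n > 0"
  by (auto simp: Nats_pos_def)

lemma weights_PhiI: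
  assumes i: "i \<in> {1, 2}" and w: "weights i lam \<nu> a b" and t: "terminates i lam \<nu> a b"
  shows "(lam, \<nu>) \<in> Phi i"
proof (cases "i = 1")
  case True
  have e: "\<nu>$1 - lam$1 = of_nat a" "\<nu>$1 + \<nu>$2 - lam$1 - lam$2 = of_nat b"
    using w True by (auto simp: weights_def)
  have e2: "\<nu>$2 - lam$2 = of_nat b - of_nat a"
    unfolding e[symmetric] by simp
  show ?thesis
  proof (cases "a \<le> b")
    case le: True
    then have "\<nu>$2 - lam$2 = of_nat (b - a)"
      unfolding e2 by (simp add: of_nat_diff)
    with e True show ?thesis
      by (simp add: Phi_def Phi_a_def)
  next
    case False
    then obtain k where k: "k \<le> b" "lam$1 - \<nu>$2 - 1 = - of_nat k"
      using t True unfolding terminates_iff by (auto simp: par_B_def)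
    have "- (\<nu>$2 - lam$2) = of_nat (a - b)"
      unfolding e2 using False by (simp add: of_nat_diff)
    then have pos: "- (\<nu>$2 - lam$2) \<in> Nats_pos" "\<nu>$1 - lam$1 \<in> Nats_pos"
      unfolding e(1) using False by (simp_all only: Nats_pos_of_nat)
    have N: "\<nu>$1 - lam$1 + \<nu>$2 - lam$2 = of_nat b"
      unfolding e(2)[symmetric] by simp
    \<comment> \<open>The substitution k -> b + 1 - k turns the range 0..b for the root of the
      second parameter into the interval 1..b + 1 of \<open>Phi_b\<close>.\<close>
    have "\<nu>$1 - lam$2 = of_int (int b + 1 - int k)"
    proof -
      have "\<nu>$1 - lam$2 = (\<nu>$1 + \<nu>$2 - lam$1 - lam$2) + (lam$1 - \<nu>$2 - 1) + 1"
        by simp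
      then show ?thesis
        unfolding e(2) k(2) by simp
    qed
    then have "\<nu>$1 - lam$2 \<in> of_int ` {1..int b + 1}"
      by (rule image_eqI) (use k(1) in auto)
    with N have "\<exists>N::nat. \<nu>$1 - lam$1 + \<nu>$2 - lam$2 = of_nat N \<and> \<nu>$1 - lam$2 \<in> of_int ` {1..int N + 1}"
      by blast
    with pos have "(lam, \<nu>) \<in> Phi_b 1"
      unfolding Phi_b_def by simp
    with True show ?thesis
      by (simp add: Phi_def)
  qed
next
  case False
  have e: "lam$2 + lam$3 - \<nu>$1 - \<nu>$2 = of_nat a" "lam$3 - \<nu>$2 = of_nat b"
    using w False by (auto simp: weights_def)
  have e2: "lam$2 - \<nu>$1 = of_nat a - of_nat b"
    unfolding e[symmetric] by simp
  show ?thesis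
  proof (cases "b \<le> a")
    case le: True
    then have "lam$2 - \<nu>$1 = of_nat (a - b)"
      unfolding e2 by (simp add: of_nat_diff)
    with e False show ?thesis
      by (simp add: Phi_def Phi_a_def)
  next
    case nle: False
    then obtain k where k: "k \<le> a" "\<nu>$2 - lam$2 + 1 = - of_nat k"
      using t False unfolding terminates_iff by (auto simp: par_B_def)
    have "- (lam$2 - \<nu>$1) = of_nat (b - a)"
      unfolding e2 using nle by (simp add: of_nat_diff)
    then have pos: "- (lam$2 - \<nu>$1) \<in> Nats_pos" "lam$3 - \<nu>$2 \<in> Nats_pos"
      unfolding e(2) using nle by (simp_all only: Nats_pos_of_nat)
    have N: "lam$3 - \<nu>$2 + lam$2 - \<nu>$1 = of_nat a"
      unfolding e(1)[symmetric] by simp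
    \<comment> \<open>For i = 2 the correspondence is the plain shift k -> k + 1.\<close>
    have "lam$2 - \<nu>$2 = of_int (int k + 1)"
    proof -
      have "lam$2 - \<nu>$2 = - (\<nu>$2 - lam$2 + 1) + 1"
        by simp
      then show ?thesis
        unfolding k(2) by simp
    qed
    then have "lam$2 - \<nu>$2 \<in> of_int ` {1..int a + 1}"
      by (rule image_eqI) (use k(1) in auto)
    with N have "\<exists>N::nat. lam$3 - \<nu>$2 + lam$2 - \<nu>$1 = of_nat N \<and> lam$2 - \<nu>$2 \<in> of_int ` {1..int N + 1}"
      by blast
    with pos False have "(lam, \<nu>) \<in> Phi_b i"
      unfolding Phi_b_def by simp
    then show ?thesis
      by (simp add: Phi_def)
  qed
qed

lemma Phi_weights:
  assumes i: "i \<in> {1, 2}" and P: "(lam, \<nu>) \<in> Phi i"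
  obtains a b where "weights i lam \<nu> a b" "terminates i lam \<nu> a b"
proof (cases "i = 1")
  case True
  show thesis
  proof (cases "(lam, \<nu>) \<in> Phi_a i")
    case a: True
    then obtain a k where e: "\<nu>$1 - lam$1 = of_nat a" "\<nu>$2 - lam$2 = of_nat k"
      using True by (auto simp: Phi_a_def Nats_def)
    have "\<nu>$1 + \<nu>$2 - lam$1 - lam$2 = (\<nu>$1 - lam$1) + (\<nu>$2 - lam$2)" by simp
    also have "\<dots> = of_nat (a + k)" unfolding e by simp
    finally show thesis
      using e True by (intro that[of a "a + k"]) (simp_all add: weights_def terminates_iff)
  next
    case False
    then have "(lam, \<nu>) \<in> Phi_b i" using P by (simp add: Phi_def)
    then obtain a N j where e: "\<nu>$1 - lam$1 = of_nat a" "\<nu>$1 - lam$1 + \<nu>$2 - lam$2 = of_nat N"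
      and j: "j \<in> {1..int N + 1}" "\<nu>$1 - lam$2 = of_int j"
      using True by (auto simp: Phi_b_def Nats_pos_def Nats_def)
    have "lam$1 - \<nu>$2 - 1 = (\<nu>$1 - lam$2) - (\<nu>$1 - lam$1 + \<nu>$2 - lam$2) - 1" by simp
    also have "\<dots> = of_int (j - int N - 1)"
      unfolding j(2) e(2) by simp
    also have "j - int N - 1 = - int (nat (int N + 1 - j))"
      using j(1) by simp
    finally have "lam$1 - \<nu>$2 - 1 = - of_nat (nat (int N + 1 - j))"
      by simp
    moreover have "nat (int N + 1 - j) \<le> N"
      using j(1) by auto
    moreover have "\<nu>$1 + \<nu>$2 - lam$1 - lam$2 = of_nat N"
      using e(2) by (simp add: algebra_simps)
    ultimately show thesis
      using e(1) True by (intro that[of a N]) (auto simp: weights_def terminates_iff par_B_def)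
  qed
next
  case False
  show thesis
  proof (cases "(lam, \<nu>) \<in> Phi_a i")
    case True
    then obtain b k where e: "lam$3 - \<nu>$2 = of_nat b" "lam$2 - \<nu>$1 = of_nat k"
      using False by (auto simp: Phi_a_def Nats_def)
    have "lam$2 + lam$3 - \<nu>$1 - \<nu>$2 = (lam$3 - \<nu>$2) + (lam$2 - \<nu>$1)" by simp
    also have "\<dots> = of_nat (b + k)" unfolding e by simp
    finally show thesis
      using e False by (intro that[of "b + k" b]) (simp_all add: weights_def terminates_iff)
  next
    case nP: False
    then have "(lam, \<nu>) \<in> Phi_b i" using P by (simp add: Phi_def)
    then obtain b N j where e: "lam$3 - \<nu>$2 = of_nat b" "lam$3 - \<nu>$2 + lam$2 - \<nu>$1 = of_nat N"
      and j: "j \<in> {1..int N + 1}" "lam$2 - \<nu>$2 = of_int j"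
      using False by (auto simp: Phi_b_def Nats_pos_def Nats_def)
    have "\<nu>$2 - lam$2 + 1 = - (lam$2 - \<nu>$2) + 1" by simp
    also have "\<dots> = of_int (1 - j)"
      unfolding j(2) by simp
    also have "1 - j = - int (nat (j - 1))"
      using j(1) by simp
    finally have "\<nu>$2 - lam$2 + 1 = - of_nat (nat (j - 1))"
      by simp
    moreover have "nat (j - 1) \<le> N"
      using j(1) by auto
    moreover have "lam$2 + lam$3 - \<nu>$1 - \<nu>$2 = of_nat N"
      using e(2) by (simp add: algebra_simps)
    ultimately show thesis
      using e(1) False by (intro that[of N b]) (auto simp: weights_def terminates_iff par_B_def)
  qed
qed

lemma cong_mod2_of_int: "cong_mod2 e (of_int k) \<longleftrightarrow> e = of_int k"
  by (auto simp: cong_mod2_def)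

lemma parity_iff_cong:
  assumes i: "i \<in> {1, 2}" and w: "weights i lam \<nu> a b"
  shows "parity i \<xi> \<eta> a b \<longleftrightarrow> (if i = 1
    then cong_mod2 (\<xi>$1 + \<eta>$1) (\<nu>$1 - lam$1) \<and> cong_mod2 (\<xi>$2 + \<eta>$2) (\<nu>$2 - lam$2)
    else cong_mod2 (\<xi>$2 + \<eta>$1) (lam$2 - \<nu>$1) \<and> cong_mod2 (\<xi>$3 + \<eta>$2) (lam$3 - \<nu>$2))"
proof -
  \<comment> \<open>The shift is the negative of the difference in the definition of
    \<open>Supp\<close> when i = 1; modulo 2 the sign disappears.\<close>
  have neg: "(of_int (- k) :: bit) = of_int k" for k
    by (simp only: of_int_bit even_minus)
  show ?thesis
  proof (cases "i = 1")
    case True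
    have "\<nu>$1 - lam$1 = of_int (- shift1 i a b 0)" "\<nu>$2 - lam$2 = of_int (- shift2 i a b 0)"
      using w[unfolded weights_iff_shift[OF i]] True by (simp_all add: idx1_def idx2_def)
    then show ?thesis
      using True by (simp only: parity_def cong_mod2_of_int neg idx1_def idx2_def if_True refl)
  next
    case False
    have "lam$2 - \<nu>$1 = of_int (shift1 i a b 0)" "lam$3 - \<nu>$2 = of_int (shift2 i a b 0)"
      using w[unfolded weights_iff_shift[OF i]] False by (simp_all add: idx1_def idx2_def)
    then show ?thesis
      using False by (simp only: parity_def cong_mod2_of_int neg idx1_def idx2_def if_False)
  qed
qed

lemma Supp_iff:
  assumes i: "i \<in> {1, 2}"
  shows "(\<xi>, \<eta>, lam, \<nu>) \<in> Supp i \<longleftrightarrow>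
    (\<exists>a b. weights i lam \<nu> a b \<and> terminates i lam \<nu> a b \<and> parity i \<xi> \<eta> a b)"
proof
  assume S: "(\<xi>, \<eta>, lam, \<nu>) \<in> Supp i"
  then have "(lam, \<nu>) \<in> Phi i" by (simp add: Supp_def)
  then obtain a b where ab: "weights i lam \<nu> a b" "terminates i lam \<nu> a b"
    using Phi_weights[OF i] by blast
  moreover have "parity i \<xi> \<eta> a b"
    using S unfolding parity_iff_cong[OF i ab(1)] Supp_def mem_Collect_eq case_prod_conv by (rule conjunct2)
  ultimately show "\<exists>a b. weights i lam \<nu> a b \<and> terminates i lam \<nu> a b \<and> parity i \<xi> \<eta> a b"
    by blast
next
  assume "\<exists>a b. weights i lam \<nu> a b \<and> terminates i lam \<nu> a b \<and> parity i \<xi> \<eta> a b"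
  then obtain a b where ab: "weights i lam \<nu> a b" "terminates i lam \<nu> a b" "parity i \<xi> \<eta> a b"
    by blast
  then show "(\<xi>, \<eta>, lam, \<nu>) \<in> Supp i"
    using weights_PhiI[OF i ab(1,2)] ab(3)
    unfolding parity_iff_cong[OF i ab(1)] Supp_def mem_Collect_eq case_prod_conv by blast
qed

lemma zero_Diff: "(\<lambda>f g. 0) \<in> Diff i \<xi> lam \<eta> \<nu>"
proof -
  have "(\<lambda>g. 0) \<in> J_series \<eta> \<nu>"
    by (simp add: J_series_def principal_series_def)
  moreover have "differential_operator i (I_series \<xi> lam) (\<lambda>f g. 0)"
    unfolding differential_operator_def
    by (intro ballI exI[of _ UNIV] exI[of _ "{}"]) simp
  ultimately show ?thesis
    by (simp add: Diff_def left_translate_def)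
qed

theorem theoremE:
  fixes i :: nat and \<xi> :: "bit^3" and \<eta> :: "bit^2" and lam :: "complex^3" and \<nu> :: "complex^2"
  assumes "i \<in> {1, 2}"
  shows "if (\<xi>, \<eta>, lam, \<nu>) \<in> Supp i
    then (\<exists>T. given_on_cells_by (I_series \<xi> lam) T (DD_sym i lam \<nu>) \<and>
              Diff i \<xi> lam \<eta> \<nu> = {\<lambda>f g. c * T f g | c. True}) \<and>
         (\<forall>F. smooth_on UNIV F \<longrightarrow> DD_sym i lam \<nu> F = DD_ord i lam \<nu> F)
    else Diff i \<xi> lam \<eta> \<nu> = {\<lambda>f g. 0}"
proof (cases "(\<xi>, \<eta>, lam, \<nu>) \<in> Supp i")
  case True
  then obtain a b where w: "weights i lam \<nu> a b" and t: "terminates i lam \<nu> a b" and par: "parity i \<xi> \<eta> a b"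
    unfolding Supp_iff[OF assms] by blast
  \<comment> \<open>The solution normalized by \<open>c 0 = 1\<close>, that is, the coefficients of
    the hypergeometric series itself.\<close>
  define c where "c = hyp_coeff i lam \<nu> a b"
  define T where "T = diff_op i \<xi> lam a b c"
  have e1: "i = 1 \<longrightarrow> \<nu>$1 - lam$1 = of_nat a \<and> \<nu>$1 + \<nu>$2 - lam$1 - lam$2 = of_nat b"
    and e2: "i \<noteq> 1 \<longrightarrow> lam$2 + lam$3 - \<nu>$1 - \<nu>$2 = of_nat a \<and> lam$3 - \<nu>$2 = of_nat b"
    using w by (auto simp: weights_def)
  have sym: "DD_sym i lam \<nu> F = DD_ord i lam \<nu> F" if "smooth_on UNIV F" for F
    by (rule DD_sym_eq_mon_sum(1)[OF that e1 e2])
  have ord: "DD_ord i lam \<nu> F = Rest i (DH.mon_sum a b c F)" if "smooth_on UNIV F" for F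
  proof -
    have "DH.mon_sum a b (fps_nth (if i = 1 then hyp2F0 (- of_nat a) (lam$1 - \<nu>$2 - 1)
        else hyp2F0 (- of_nat b) (\<nu>$2 - lam$2 + 1))) F = DH.mon_sum a b c F"
      unfolding DH.mon_sum_def by (intro ext sum.cong refl) (auto simp: c_def hyp_coeff_def par_A_def par_B_def)
    then show ?thesis
      using DD_sym_eq_mon_sum(2)[OF that e1 e2] by simp
  qed
  have "given_on_cells_by (I_series \<xi> lam) T (DD_sym i lam \<nu>)"
    unfolding given_on_cells_by_def
  proof
    fix f assume f: "f \<in> I_series \<xi> lam"
    have s: "smooth_on UNIV (f \<circ> cell3)"
      using cell3_pullback_mem[OF I_series_Csmooth[OF f]] by (simp add: Csmooth_UNIV comp_def)
    show "T f \<circ> cell2 = DD_sym i lam \<nu> (f \<circ> cell3)"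
      unfolding sym[OF s] ord[OF s]
      using diff_op_cells[OF f GL_one, of i a b c] by (simp add: fun_eq_iff T_def Rest_def iota_one comp_def)
  qed
  moreover have "Diff i \<xi> lam \<eta> \<nu> = {\<lambda>f g. s * T f g | s. True}"
  proof (intro set_eqI iffI)
    fix S assume "S \<in> {\<lambda>f g. s * T f g | s. True}"
    \<comment> \<open>A multiple of the operator is the operator with multiplied coefficients, which
      again solve the recurrence.\<close>
    then obtain s where "S = diff_op i \<xi> lam a b (\<lambda>n. s * c n)"
      by (auto simp: diff_op_cmult T_def)
    then show "S \<in> Diff i \<xi> lam \<eta> \<nu>"
      using diff_op_Diff[OF assms w par hyp_recurrence_hyp_coeff[OF t]] by (simp add: c_def)
  next
    fix S assume "S \<in> Diff i \<xi> lam \<eta> \<nu>"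
    from Diff_eq_diff_op[OF assms this] show "S \<in> {\<lambda>f g. s * T f g | s. True}"
    proof
      assume "S = (\<lambda>f g. 0)"
      then have "S = (\<lambda>f g. 0 * T f g)" by simp
      then show ?thesis by blast
    next
      assume "\<exists>a b c. weights i lam \<nu> a b \<and> parity i \<xi> \<eta> a b \<and> hyp_recurrence i lam \<nu> a b c \<and>
        S = diff_op i \<xi> lam a b c \<and> (\<exists>n\<le>min a b. c n \<noteq> 0)"
      \<comment> \<open>Uniqueness of the weights identifies the exponents found for
        \<open>S\<close> with the fixed \<open>a\<close> and \<open>b\<close>.\<close>
      then obtain c' where c': "hyp_recurrence i lam \<nu> a b c'" "S = diff_op i \<xi> lam a b c'"
        using weights_unique[OF w] by metis
      have "S = diff_op i \<xi> lam a b (\<lambda>n. c' 0 * c n)"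
        unfolding c'(2) c_def by (rule diff_op_cong) (rule hyp_recurrence_unique(1)[OF c'(1)])
      then show ?thesis
        by (auto simp: diff_op_cmult T_def)
    qed
  qed
  ultimately show ?thesis
    using True sym by auto
next
  case False
  \<comment> \<open>A nonzero operator would supply weights, parity and, through its nonzero
    coefficient, termination, and thus membership in \<open>Supp\<close>.\<close>
  have "S = (\<lambda>f g. 0)" if "S \<in> Diff i \<xi> lam \<eta> \<nu>" for S
    using Diff_eq_diff_op[OF assms that] hyp_recurrence_unique(2) False
    unfolding Supp_iff[OF assms] by blast
  then have "Diff i \<xi> lam \<eta> \<nu> = {\<lambda>f g. 0}"
    using zero_Diff by blast
  with False show ?thesis by simp
qed

end
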